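(* Let $\lambda>0$, $p,q\in(0,1)$, and let $\phi\colon[0,\infty)\to[0,1]$ be a measurable function of bounded support. If $\lambda\|\phi\|_0<1$ or $\lambda I_\phi(p,q)<1$, then no estimator exactly recovers the communities in the $\mathrm{GKBM}_n(\lambda,\phi,p,q)$ model. That is, for every sequence of estimators $\hat\sigma^{(n)}=\hat\sigma^{(n)}(A^{(n)},V^{(n)})$, it is not the case that $\lim_{n\to\infty}\mathbb{P}\big(\mathrm{Ham}(\hat\sigma^{(n)},\sigma^{(n)})/n=0\big)=1$.
   Context: Logarithms are natural. The interval $(-n/2,n/2]$ with endpoints identified represents a circle of circumference $n$, with distance $\|x-y\|=\min\{|x-y|,\,n-|x-y|\}$. Model $\mathrm{GKBM}_n(\lambda,\phi,p,q)$: (i) the node set $V=V^{(n)}\subset(-n/2,n/2]$ is a homogeneous Poisson point process of intensity $\lambda$ (nodes are identified with their locations); (ii) given $V$, community labels $\sigma_v\in\{-1,+1\}$, $v\in V$, are independent and uniform; (iii) given $V$ and $\sigma=(\sigma_v)$, each unordered pair $\{u,v\}$ of distinct nodes is linked ($A_{uv}=A_{vu}=1$, otherwise $A_{uv}=A_{vu}=0$; $A_{uu}=0$) independently with probability $P_{\sigma_u\sigma_v}Q_{uv}$, where $P_{\sigma_u\sigma_v}=p$ if $\sigma_u=\sigma_v$ and $q$ if $\sigma_u\neq\sigma_v$, and $Q_{uv}=\phi(\|u-v\|/\log n)$. $\mathbb{P}=\mathbb{P}^{(n)}$ denotes the joint law of $(V,\sigma,A)$. An estimator is a $\{-1,+1\}^{V}$-valued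 measurable function of $(A,V)$ only (it may depend on $n$ and on the model parameters). The permutation-invariant Hamming distance is $\mathrm{Ham}(\hat\sigma,\sigma)=\min_{s\in\{\pm1\}}|\{v\in V:\hat\sigma_v\ne s\sigma_v\}|$. Define $$I_\phi(p,q)=2\int_0^\infty\Big(1-\sqrt{pq}\,\phi(x)-\sqrt{(1-p\phi(x))(1-q\phi(x))}\Big)dx,\qquad \|\phi\|_0=\sup\{x\ge0:\phi(x)\ne0\}.$$ *)

theory Defs
  imports "HOL-Probability.Probability"
begin

text \<open>The circle of circumference \<open>n\<close>, with its Borel sets and its distance. Identifying the
  endpoints does not affect the Borel sets of the half-open interval.\<close>

definition circle :: "nat \<Rightarrow> real measure" where
  "circle n = restrict_space borel {- real n / 2 <.. real n / 2}"

definition circle_dist :: "nat \<Rightarrow> real \<Rightarrow> real \<Rightarrow> real" where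
  "circle_dist n x y = min \<bar>x - y\<bar> (real n - \<bar>x - y\<bar>)"

text \<open>Finite subsets of a measurable space, with the usual sigma-algebra for (simple) point
  processes: the one generated by the counts in measurable sets.\<close>

definition point_configs :: "'a measure \<Rightarrow> 'a set measure" where
  "point_configs S = sigma {X. finite X \<and> X \<subseteq> space S}
     {{X. finite X \<and> X \<subseteq> space S \<and> card (X \<inter> B) = k} | B k. B \<in> sets S}"

definition node_space :: "nat \<Rightarrow> real set measure" where
  "node_space n = point_configs (circle n)"

text \<open>An element of \<open>{-1,+1}\<^sup>V\<close> is represented by a function on the reals that is 0 off \<open>V\<close>.
  A labelling is measured through the locations of its \<open>+1\<close> nodes and of its \<open>-1\<close> nodes.\<close>

definition labellings :: "real set \<Rightarrow> (real \<Rightarrow> int) set" where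
  "labellings V = {s. (\<forall>v\<in>V. s v \<in> {-1, 1}) \<and> (\<forall>v. v \<notin> V \<longrightarrow> s v = 0)}"

definition label_space :: "nat \<Rightarrow> (real \<Rightarrow> int) measure" where
  "label_space n = vimage_algebra (\<Union>V\<in>space (node_space n). labellings V)
     (\<lambda>s. ({v. s v = 1}, {v. s v = -1})) (node_space n \<Otimes>\<^sub>M node_space n)"

text \<open>Adjacency matrices are indexed by all pairs of reals, with entry 0 for pairs that are not
  pairs of nodes; they are measured through the locations of the pairs of linked nodes.\<close>

definition adj_space :: "nat \<Rightarrow> (real \<Rightarrow> real \<Rightarrow> nat) measure" where
  "adj_space n = vimage_algebra
     {a. (\<forall>u v. a u v \<in> {0, 1}) \<and> (\<forall>u v. a u v = a v u) \<and> (\<forall>u. a u u = 0) \<and>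
         {(u, v). a u v = 1} \<in> space (point_configs (circle n \<Otimes>\<^sub>M circle n))}
     (\<lambda>a. {(u, v). a u v = 1}) (point_configs (circle n \<Otimes>\<^sub>M circle n))"

text \<open>Homogeneous Poisson point process on the circle. The counting law is written out because
  null sets \<open>B\<close> have rate 0, for which \<^const>\<open>poisson_pmf\<close> is unspecified.\<close>

definition poisson_process ::
    "'w measure \<Rightarrow> nat \<Rightarrow> real \<Rightarrow> ('w \<Rightarrow> real set) \<Rightarrow> bool" where
  "poisson_process M n lam V \<longleftrightarrow>
     V \<in> M \<rightarrow>\<^sub>M node_space n \<and>
     (\<forall>B\<in>sets (circle n). \<forall>k. measure M {\<omega> \<in> space M. card (V \<omega> \<inter> B) = k} =
        exp (- (lam * measure lborel B)) * (lam * measure lborel B) ^ k / fact k) \<and>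
     (\<forall>m (B :: nat \<Rightarrow> real set). (\<forall>i<m. B i \<in> sets (circle n)) \<longrightarrow> disjoint_family_on B {..<m} \<longrightarrow>
        prob_space.indep_vars M (\<lambda>_. count_space UNIV) (\<lambda>i \<omega>. card (V \<omega> \<inter> B i)) {..<m})"

definition link_prob :: "nat \<Rightarrow> (real \<Rightarrow> real) \<Rightarrow> real \<Rightarrow> real \<Rightarrow> (real \<Rightarrow> int) \<Rightarrow> real \<Rightarrow> real \<Rightarrow> real" where
  "link_prob n \<phi> p q s u v = (if s u = s v then p else q) * \<phi> (circle_dist n u v / ln (real n))"

definition label_pmf :: "real set \<Rightarrow> (real \<Rightarrow> int) pmf" where
  "label_pmf V = Pi_pmf V 0 (\<lambda>_. pmf_of_set {-1, 1})"

text \<open>An unordered pair of distinct nodes is represented by the pair \<open>(u, v)\<close> with \<open>u < v\<close>;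
  one independent coin is thrown for each, and the outcome is symmetrised.\<close>

definition adj_pmf ::
    "nat \<Rightarrow> (real \<Rightarrow> real) \<Rightarrow> real \<Rightarrow> real \<Rightarrow> real set \<Rightarrow> (real \<Rightarrow> int) \<Rightarrow> (real \<Rightarrow> real \<Rightarrow> nat) pmf" where
  "adj_pmf n \<phi> p q V s =
     map_pmf (\<lambda>f u v. of_bool (f (min u v, max u v)))
       (Pi_pmf {(u, v). u \<in> V \<and> v \<in> V \<and> u < v} False
          (\<lambda>(u, v). bernoulli_pmf (link_prob n \<phi> p q s u v)))"

definition label_adj_pmf ::
    "nat \<Rightarrow> (real \<Rightarrow> real) \<Rightarrow> real \<Rightarrow> real \<Rightarrow> real set \<Rightarrow> ((real \<Rightarrow> int) \<times> (real \<Rightarrow> real \<Rightarrow> nat)) pmf" where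
  "label_adj_pmf n \<phi> p q V =
     bind_pmf (label_pmf V) (\<lambda>s. map_pmf (\<lambda>a. (s, a)) (adj_pmf n \<phi> p q V s))"

text \<open>The model, realised by random elements \<open>V\<close>, \<open>\<sigma>\<close>, \<open>A\<close> of an arbitrary probability space.
  The last assumption says that \<^const>\<open>label_adj_pmf\<close> is the regular conditional distribution of
  \<open>(\<sigma>, A)\<close> given \<open>V\<close>. In particular, almost surely, \<open>\<sigma>\<close> lies in \<open>labellings V\<close> and all linked
  pairs lie in \<open>V \<times> V\<close>.\<close>

locale GKBM = prob_space M
  for M :: "'w measure" and n :: nat and lam :: real and \<phi> :: "real \<Rightarrow> real" and p q :: real
    and V :: "'w \<Rightarrow> real set" and \<sigma> :: "'w \<Rightarrow> real \<Rightarrow> int" and A :: "'w \<Rightarrow> real \<Rightarrow> real \<Rightarrow> nat" +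
  assumes nodes: "poisson_process M n lam V"
    and labels_measurable: "\<sigma> \<in> M \<rightarrow>\<^sub>M label_space n"
    and adj_measurable: "A \<in> M \<rightarrow>\<^sub>M adj_space n"
    and conditional_law:
      "\<And>S. S \<in> sets (node_space n \<Otimes>\<^sub>M label_space n \<Otimes>\<^sub>M adj_space n) \<Longrightarrow>
         measure M {\<omega> \<in> space M. (V \<omega>, \<sigma> \<omega>, A \<omega>) \<in> S} =
         (\<integral>\<omega>. measure_pmf.prob (label_adj_pmf n \<phi> p q (V \<omega>)) {(s, a). (V \<omega>, s, a) \<in> S} \<partial>M)"

definition estimator ::
    "nat \<Rightarrow> ((real \<Rightarrow> real \<Rightarrow> nat) \<times> real set \<Rightarrow> real \<Rightarrow> int) \<Rightarrow> bool" where
  "estimator n est \<longleftrightarrow>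
     est \<in> adj_space n \<Otimes>\<^sub>M node_space n \<rightarrow>\<^sub>M label_space n \<and>
     (\<forall>a\<in>space (adj_space n). \<forall>V\<in>space (node_space n). est (a, V) \<in> labellings V)"

definition Ham :: "real set \<Rightarrow> (real \<Rightarrow> int) \<Rightarrow> (real \<Rightarrow> int) \<Rightarrow> nat" where
  "Ham V t s = Min ((\<lambda>e. card {v \<in> V. t v \<noteq> e * s v}) ` {-1, 1})"

definition I_phi :: "(real \<Rightarrow> real) \<Rightarrow> real \<Rightarrow> real \<Rightarrow> real" where
  "I_phi \<phi> p q = 2 * (LINT x:{0..}|lborel.
     1 - sqrt (p * q) * \<phi> x - sqrt ((1 - p * \<phi> x) * (1 - q * \<phi> x)))"

text \<open>Inserting 0 only implements the convention that the supremum of the empty subset of the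
  half-line \<open>[0, \<infinity>)\<close> is 0.\<close>

definition phi_range :: "(real \<Rightarrow> real) \<Rightarrow> real" where
  "phi_range \<phi> = Sup (insert 0 {x. 0 \<le> x \<and> \<phi> x \<noteq> 0})"

end

theory Submission
  imports Defs "HOL-Real_Asymp.Real_Asymp"
begin

text \<open>An estimator sees the graph and the locations, so it can do no better than to guess the labelling
with the largest posterior probability, up to a global sign. Each hypothesis makes this guess wrong
with a probability that stays away from 0.

\<^emph>\<open>Empty arcs.\<close> If \<open>lam * phi_range \<phi> < 1\<close>, choose
\<open>\<kappa>\<close> slightly above \<open>phi_range \<phi>\<close>. An arc of length
\<open>\<kappa> ln n\<close> contains no node with probability \<open>n powr - (lam *
\<kappa>)\<close>, and the number of disjoint ones is of order \<open>n / ln n\<close>. Hence, with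
probability tending to 1, two empty arcs split the nodes into two nonempty groups that cannot be
linked to each other. Flipping all labels in one group preserves the conditional law of labels and
links but changes the labelling by more than a global sign, so that, given such nodes, no estimator
is correct with probability above 1/2 (\<open>disconnected_bound\<close>).

\<^emph>\<open>Lone nodes.\<close> If \<open>lam * I_phi \<phi> p q < 1\<close>, choose
\<open>\<kappa>\<close> above \<open>phi_range \<phi>\<close> and cut the circle into blocks of
length \<open>2 * \<kappa> ln n + 1\<close>. A node that is alone in the unit interval at the centre
of its block can be linked only to nodes of the same block. Suppose that all labels are revealed
except those of these lone nodes. Then the hidden labels become independent binary tests, and the
estimator succeeds with conditional probability at most \<open>2 * (\<Prod>c. 1 - e c)\<close>,
where \<open>e c\<close> is the Bayes error of the test at \<open>c\<close> and the factor 2 pays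
for the global sign (\<open>genie_bound\<close>, \<open>isolated_blocks_bound\<close>).

The Bayes error is half the sum of \<open>min x y\<close> over the outcomes, where \<open>x\<close>
and \<open>y\<close> are their two likelihoods, and \<open>min x y = sqrt (x * y) * exp (- \<bar>ln
x - ln y\<bar> / 2)\<close>. The weights \<open>sqrt (x * y)\<close> are a product over the nodes
\<open>u\<close> of the block. Under the weights averaged over the labels of these nodes, \<open>ln
x - ln y\<close> has a symmetric law and fluctuations of order \<open>sqrt (ln n)\<close>, so that
replacing \<open>min x y\<close> by \<open>sqrt (x * y)\<close> costs only a factor \<open>n powr -
\<delta>\<close>, for any \<open>\<delta> > 0\<close> (\<open>min_ge_tilt\<close>,
\<open>expectation_min_centre_lik\<close>). What remains is a product of Hellinger affinities over a
Poisson set of nodes. Its expectation is an exponential of an integral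
(\<open>laplace_functional\<close>), and scaling by \<open>ln n\<close> turns this exponential into
\<open>n powr - (lam * I_phi \<phi> p q)\<close> (\<open>integral_affinity_scaled\<close>). Nodes in
different blocks are independent. The success probability is therefore at most \<open>2 * exp (- m *
b)\<close>, where the number \<open>m\<close> of blocks is of order \<open>n / ln n\<close> and
\<open>b\<close> is of order \<open>n powr - (lam * I_phi \<phi> p q + \<delta>)\<close>. This tends
to 0 when \<open>\<delta>\<close> is small.

The independence of the configurations in disjoint sets follows from the probabilities that sets
contain no node, because these void events generate the whole sigma-algebra of finite configurations
(\<open>sets_node_space_void\<close>).\<close>

section \<open>Interpolating between two Bernoulli laws\<close>

text \<open>The weights \<open>tilt t x y\<close> interpolate geometrically between two likelihoods
\<open>x\<close> and \<open>y\<close>, with the symmetric point at \<open>t = 0\<close>. Their use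
is that they are multiplicative, unlike the minimum that they bound.\<close>

definition tilt :: "real \<Rightarrow> real \<Rightarrow> real \<Rightarrow> real" where
  "tilt t x y = x powr (1/2 + t) * y powr (1/2 - t)"

text \<open>The Hellinger affinity (Bhattacharyya coefficient) of the two Bernoulli laws with parameters
\<open>p * k\<close> and \<open>q * k\<close>.\<close>

definition affinity :: "real \<Rightarrow> real \<Rightarrow> real \<Rightarrow> real" where
  "affinity p q k = sqrt (p * q) * k + sqrt ((1 - p * k) * (1 - q * k))"

lemma tilt_nonneg: "0 \<le> tilt t x y"
  by (simp add: tilt_def)

lemma tilt_0: "0 \<le> x \<Longrightarrow> 0 \<le> y \<Longrightarrow> tilt 0 x y = sqrt (x * y)"
  by (simp add: tilt_def powr_half_sqrt real_sqrt_mult)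

lemma tilt_prod:
  assumes "\<And>i. i \<in> A \<Longrightarrow> 0 \<le> f i" "\<And>i. i \<in> A \<Longrightarrow> 0 \<le> g i"
  shows "tilt t (\<Prod>i\<in>A. f i) (\<Prod>i\<in>A. g i) = (\<Prod>i\<in>A. tilt t (f i) (g i))"
proof -
  have "(\<Prod>i\<in>A. h i) powr a = (\<Prod>i\<in>A. h i powr a)" if "\<And>i. i \<in> A \<Longrightarrow> 0 \<le> h i"
    for h :: "_ \<Rightarrow> real" and a
    using that by (simp add: prod_powr_distrib)
  then show ?thesis using assms by (simp add: tilt_def prod.distrib)
qed

lemma tilt_scale: "0 \<le> c \<Longrightarrow> 0 \<le> x \<Longrightarrow> 0 \<le> y \<Longrightarrow> tilt t (c * x) (c * y) = c * tilt t x y"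
proof -
  assume *: "0 \<le> c" "0 \<le> x" "0 \<le> y"
  have "c powr (1/2 + t) * c powr (1/2 - t) = c"
    using * by (simp flip: powr_add add: mult.commute)
  then show ?thesis using * by (simp add: tilt_def powr_mult ac_simps)
qed

lemma tilt_exp:
  assumes "0 < x" "0 < y"
  shows "tilt t x y = sqrt (x * y) * exp (t * (ln x - ln y))"
proof -
  have "tilt t x y = exp ((ln x + ln y) / 2) * exp (t * (ln x - ln y))"
    using assms by (simp add: tilt_def powr_def flip: exp_add) (simp add: algebra_simps add_divide_distrib)
  also have "exp ((ln x + ln y) / 2) = sqrt (x * y)"
    using assms by (simp add: powr_half_sqrt[symmetric] powr_def ln_mult)
  finally show ?thesis .
qed

text \<open>Adding the two orders of the arguments leaves only the even part \<open>cosh\<close> of the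
exponential tilt. This is why the cost of a small tilt is of second order in \<open>t\<close>.\<close>

lemma tilt_add_swap_le:
  assumes "0 \<le> x" "0 \<le> y" "x = 0 \<longleftrightarrow> y = 0" "x \<noteq> 0 \<Longrightarrow> \<bar>ln x - ln y\<bar> \<le> K"
  shows "tilt t x y + tilt t y x \<le> 2 * cosh (t * K) * sqrt (x * y)"
proof (cases "x = 0")
  case True then show ?thesis by (simp add: tilt_def)
next
  case False
  define r where "r = ln x - ln y"
  have pos: "0 < x" "0 < y" using False assms by auto
  have K: "\<bar>r\<bar> \<le> \<bar>K\<bar>" using assms(4) False by (auto simp: r_def)
  have "tilt t x y + tilt t y x = sqrt (x * y) * (exp (t * r) + exp (- (t * r)))"
    using pos by (simp add: tilt_exp r_def algebra_simps)
  also have "exp (t * r) + exp (- (t * r)) = 2 * cosh \<bar>t * r\<bar>"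
    by (simp add: cosh_real_abs) (simp add: cosh_def)
  also have "cosh \<bar>t * r\<bar> \<le> cosh \<bar>t * K\<bar>"
    using K by (subst cosh_real_nonneg_le_iff) (auto simp: abs_mult mult_left_mono)
  finally show ?thesis using pos by (simp add: ac_simps)
qed

text \<open>The minimum is \<open>sqrt (x * y)\<close> times \<open>exp (- \<bar>ln x - ln y\<bar> / 2)\<close>.
If \<open>\<bar>ln x - ln y\<bar> \<le> 2 * d\<close>, the first term alone is small enough.
Otherwise the subtracted tilts exceed it, by the exponential form of Markov's inequality, and the
left-hand side is negative.\<close>

lemma min_ge_tilt:
  assumes "0 \<le> x" "0 \<le> y" "0 \<le> t"
  shows "exp (- d) * (tilt 0 x y - exp (- (2 * t * d)) * (tilt t x y + tilt (- t) x y)) \<le> min x y"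
proof (cases "x = 0 \<or> y = 0")
  case True then show ?thesis using assms by (auto simp: tilt_def min_def)
next
  case False
  then have pos: "0 < x" "0 < y" using assms by auto
  define r where "r = ln x - ln y"
  have eqs: "tilt t x y = sqrt (x*y) * exp (t * r)" "tilt (-t) x y = sqrt (x*y) * exp (- (t * r))"
    "tilt 0 x y = sqrt (x * y)"
    using pos by (simp_all add: tilt_exp r_def)
  have mn: "min x y = sqrt (x * y) * exp (- \<bar>r\<bar> / 2)"
  proof -
    have "sqrt (x * y) = exp ((ln x + ln y) / 2)"
      using pos by (simp add: powr_half_sqrt[symmetric] powr_def ln_mult)
    then have "sqrt (x * y) * exp (- \<bar>r\<bar> / 2) = exp ((ln x + ln y) / 2 - \<bar>r\<bar> / 2)"
      by (simp flip: exp_add)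
    also have "(ln x + ln y) / 2 - \<bar>r\<bar> / 2 = ln (min x y)"
      using pos unfolding r_def by (auto simp: min_def abs_if field_simps)
    finally show ?thesis using pos by auto
  qed
  show ?thesis
  proof (cases "\<bar>r\<bar> \<le> 2 * d")
    case True
    have "exp (- d) * (tilt 0 x y - exp (- (2 * t * d)) * (tilt t x y + tilt (- t) x y))
        \<le> exp (- d) * tilt 0 x y"
      by (intro mult_left_mono) (auto simp: tilt_nonneg)
    also have "\<dots> \<le> min x y"
      unfolding mn eqs using True pos by (subst mult.commute, intro mult_left_mono) auto
    finally show ?thesis .
  next
    case False
    have "2 * t * d \<le> t * \<bar>r\<bar>" using False assms mult_left_mono[of "2*d" "\<bar>r\<bar>" t] by auto
    then have "exp (2 * t * d) \<le> exp (t * \<bar>r\<bar>)" by simp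
    also have "\<dots> \<le> exp (t * r) + exp (- (t * r))"
      by (cases "r \<ge> 0") (auto simp: abs_if)
    finally have "exp (- (2 * t * d)) * (exp (t * r) + exp (- (t * r))) \<ge> exp (- (2 * t * d)) * exp (2 * t * d)"
      by (intro mult_left_mono) auto
    then have "exp (- (2 * t * d)) * (exp (t * r) + exp (- (t * r))) \<ge> 1"
      by (simp flip: exp_add)
    then have "sqrt (x*y) * (exp (- (2 * t * d)) * (exp (t * r) + exp (- (t * r)))) \<ge> sqrt (x*y) * 1"
      using pos by (intro mult_left_mono) auto
    then have "tilt 0 x y - exp (- (2 * t * d)) * (tilt t x y + tilt (- t) x y) \<le> 0"
      unfolding eqs by (simp add: algebra_simps)
    then have "exp (- d) * (tilt 0 x y - exp (- (2 * t * d)) * (tilt t x y + tilt (- t) x y)) \<le> 0"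
      by (simp add: mult_le_0_iff)
    also have "0 \<le> min x y" using pos by auto
    finally show ?thesis .
  qed
qed

text \<open>The total tilted weight of one potential link, averaged over a uniform label at its other end. The
average restores the symmetry between the two likelihoods.\<close>

definition mean_tilt :: "real \<Rightarrow> real \<Rightarrow> real \<Rightarrow> real \<Rightarrow> real" where
  "mean_tilt p q t k = (tilt t (p * k) (q * k) + tilt t (q * k) (p * k)
     + tilt t (1 - p * k) (1 - q * k) + tilt t (1 - q * k) (1 - p * k)) / 2"

lemma prob_mult_le:
  fixes p k :: real
  assumes "0 < p" "p < 1" "0 \<le> k" "k \<le> 1"
  shows "p * k \<le> p" "0 \<le> p * k" "1 - p \<le> 1 - p * k" "0 < 1 - p * k" "1 - p * k \<le> 1"
proof -
  show "p * k \<le> p" using assms by (simp add: mult_left_le)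
  then have "p * k < 1" using assms(2) by linarith
  with \<open>p * k \<le> p\<close> show "0 \<le> p * k" "1 - p \<le> 1 - p * k" "0 < 1 - p * k" "1 - p * k \<le> 1" using assms by auto
qed

lemma mean_tilt_0:
  assumes "0 < p" "p < 1" "0 < q" "q < 1" "0 \<le> k" "k \<le> 1"
  shows "mean_tilt p q 0 k = affinity p q k"
proof -
  have "sqrt (p * k * (q * k)) = sqrt (p * q) * k"
    using assms by (simp add: real_sqrt_mult)
  then show ?thesis
    using assms prob_mult_le[of p k] prob_mult_le[of q k]
    by (simp add: mean_tilt_def affinity_def tilt_0 mult.commute)
qed

text \<open>A common bound for the absolute log-likelihood ratio of one potential link, whether the link is
present or absent, uniform over \<open>k\<close> in the unit interval.\<close>

definition llr_max :: "real \<Rightarrow> real \<Rightarrow> real" where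
  "llr_max p q = - ln p - ln q - ln (1 - p) - ln (1 - q)"

lemma mean_tilt_le:
  assumes "0 < p" "p < 1" "0 < q" "q < 1" "0 \<le> k" "k \<le> 1"
  shows "mean_tilt p q t k \<le> cosh (t * llr_max p q) * affinity p q k"
proof -
  note b = prob_mult_le[OF assms(1,2,5,6)] prob_mult_le[OF assms(3,4,5,6)]
  have neg: "ln p < 0" "ln q < 0" "ln (1-p) < 0" "ln (1-q) < 0" using assms by auto
  have l: "ln (1 - p) \<le> ln (1 - p * k)" "ln (1 - p * k) \<le> 0"
     "ln (1 - q) \<le> ln (1 - q * k)" "ln (1 - q * k) \<le> 0"
    using assms b by (auto simp: ln_mono)
  have K: "\<bar>ln p - ln q\<bar> \<le> llr_max p q"
    unfolding llr_max_def using neg by linarith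
  have "tilt t (p * k) (q * k) + tilt t (q * k) (p * k) \<le> 2 * cosh (t * llr_max p q) * sqrt ((p*k)*(q*k))"
    using assms K by (intro tilt_add_swap_le) (simp_all add: ln_mult)
  moreover have "tilt t (1 - p * k) (1 - q * k) + tilt t (1 - q * k) (1 - p * k)
      \<le> 2 * cosh (t * llr_max p q) * sqrt ((1-p*k)*(1-q*k))"
  proof -
    have K': "\<bar>ln (1 - p * k) - ln (1 - q * k)\<bar> \<le> llr_max p q"
    unfolding llr_max_def using l neg by linarith
    show ?thesis using b K' by (intro tilt_add_swap_le) auto
  qed
  moreover have "sqrt (p * k * (q * k)) = sqrt (p * q) * k"
    using assms by (simp add: real_sqrt_mult)
  ultimately show ?thesis unfolding mean_tilt_def affinity_def by (simp add: algebra_simps)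
qed

lemma affinity_le_1:
  assumes "0 < p" "p < 1" "0 < q" "q < 1" "0 \<le> k" "k \<le> 1"
  shows "affinity p q k \<le> 1"
proof -
  note b = prob_mult_le[OF assms(1,2,5,6)] prob_mult_le[OF assms(3,4,5,6)]
  have "sqrt (p * q) \<le> (p + q) / 2" using assms by (intro arith_geo_mean_sqrt) auto
  then have "sqrt (p * q) * k \<le> (p + q) / 2 * k" using assms by (intro mult_right_mono)
  moreover have "sqrt ((1 - p*k) * (1 - q*k)) \<le> ((1 - p*k) + (1 - q*k)) / 2"
    using b by (intro arith_geo_mean_sqrt) auto
  ultimately show ?thesis unfolding affinity_def by (simp add: field_simps)
qed

lemma affinity_ge:
  assumes "0 < p" "p < 1" "0 < q" "q < 1" "0 \<le> k" "k \<le> 1"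
  shows "affinity p q k > 0"
  unfolding affinity_def
  using prob_mult_le[OF assms(1,2,5,6)] prob_mult_le[OF assms(3,4,5,6)] assms
  by (intro add_nonneg_pos) auto

lemma affinity_0: "affinity p q 0 = 1"
  by (simp add: affinity_def)

section \<open>Finite product distributions\<close>

lemmas expectation_nonneg = Bochner_Integration.integral_nonneg

abbreviation E_pmf :: "'a pmf \<Rightarrow> ('a \<Rightarrow> real) \<Rightarrow> real" where
  "E_pmf P \<equiv> measure_pmf.expectation P"

abbreviation P_pmf :: "'a pmf \<Rightarrow> 'a set \<Rightarrow> real" where
  "P_pmf P \<equiv> measure_pmf.prob P"

text \<open>Functions of disjoint sets of coordinates are independent under a product distribution. This
predicate says that a function uses only the coordinates in \<open>B\<close>.\<close>

definition depends_on :: "'a set \<Rightarrow> (('a \<Rightarrow> 'b) \<Rightarrow> 'c) \<Rightarrow> bool" where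
  "depends_on B F \<longleftrightarrow> (\<forall>f g. (\<forall>x\<in>B. f x = g x) \<longrightarrow> F f = F g)"

lemma depends_onD: "depends_on B F \<Longrightarrow> (\<And>x. x \<in> B \<Longrightarrow> f x = g x) \<Longrightarrow> F f = F g"
  unfolding depends_on_def by blast

lemma depends_on_mono: "depends_on B F \<Longrightarrow> B \<subseteq> C \<Longrightarrow> depends_on C F"
  unfolding depends_on_def by blast

lemma depends_on_prod:
  "(\<And>i. i \<in> I \<Longrightarrow> depends_on B (F i)) \<Longrightarrow> depends_on B (\<lambda>f. \<Prod>i\<in>I. F i f)"
  unfolding depends_on_def by (intro allI impI prod.cong refl) blast

lemma finite_set_Pi_pmf:
  "finite A \<Longrightarrow> (\<And>x. x \<in> A \<Longrightarrow> finite (set_pmf (P x))) \<Longrightarrow> finite (set_pmf (Pi_pmf A d P))"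
  by (subst set_Pi_pmf) auto

lemma expectation_mono_pmf:
  fixes F G :: "'a \<Rightarrow> real"
  assumes "finite (set_pmf P)" "\<And>x. x \<in> set_pmf P \<Longrightarrow> F x \<le> G x"
  shows "E_pmf P F \<le> E_pmf P G"
  using assms by (intro integral_mono_AE integrable_measure_pmf_finite) (auto simp: AE_measure_pmf_iff)

lemma expectation_swap_pmf:
  fixes F :: "'a \<Rightarrow> 'b \<Rightarrow> real"
  assumes "finite (set_pmf P)" "finite (set_pmf Q)"
  shows "E_pmf P (\<lambda>x. E_pmf Q (F x))
       = E_pmf Q (\<lambda>y. E_pmf P (\<lambda>x. F x y))"
proof -
  have P: "E_pmf P h = (\<Sum>x\<in>set_pmf P. h x * pmf P x)" for h
    using assms(1) by (intro integral_measure_pmf_real) auto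
  have Q: "E_pmf Q h = (\<Sum>x\<in>set_pmf Q. h x * pmf Q x)" for h
    using assms(2) by (intro integral_measure_pmf_real) auto
  show ?thesis
    unfolding P Q sum_distrib_right by (subst sum.swap) (simp add: ac_simps)
qed

lemma expectation_Pi_pmf_mult:
  fixes F G :: "('a \<Rightarrow> 'b) \<Rightarrow> real"
  assumes "finite A" "\<And>x. x \<in> A \<Longrightarrow> finite (set_pmf (P x))" "B \<subseteq> A"
    and F: "depends_on B F" and G: "depends_on (A - B) G"
  shows "E_pmf (Pi_pmf A d P) (\<lambda>f. F f * G f) =
    E_pmf (Pi_pmf A d P) F * E_pmf (Pi_pmf A d P) G"
proof -
  let ?h = "\<lambda>(f, g) x. if x \<in> B then f x else g x"
  let ?P = "Pi_pmf B d P" and ?Q = "Pi_pmf (A - B) d P"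
  have fin: "finite (set_pmf ?P)" "finite (set_pmf ?Q)"
    using assms(1-3) finite_subset[OF assms(3,1)] by (auto intro!: finite_set_Pi_pmf)
  have split: "Pi_pmf A d P = map_pmf ?h (pair_pmf ?P ?Q)"
  proof -
    have "Pi_pmf (B \<union> (A - B)) d P = map_pmf ?h (pair_pmf ?P ?Q)"
      using assms(1,3) by (intro Pi_pmf_union) (auto intro: finite_subset)
    moreover have "B \<union> (A - B) = A" using assms(3) by blast
    ultimately show ?thesis by (simp only:)
  qed
  have Fh: "F (?h z) = F (fst z)" for z
    by (rule depends_onD[OF F]) (auto simp: case_prod_unfold)
  have Gh: "G (?h z) = G (snd z)" for z
    by (rule depends_onD[OF G]) (auto simp: case_prod_unfold)
  have "E_pmf (pair_pmf ?P ?Q) (\<lambda>z. F (fst z) * G (snd z)) =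
      (\<Sum>z\<in>set_pmf ?P \<times> set_pmf ?Q. (F (fst z) * G (snd z)) * pmf (pair_pmf ?P ?Q) z)"
    using fin by (intro integral_measure_pmf_real) auto
  also have "\<dots> = (\<Sum>x\<in>set_pmf ?P. \<Sum>y\<in>set_pmf ?Q. (F x * pmf ?P x) * (G y * pmf ?Q y))"
    unfolding sum.cartesian_product by (intro sum.cong refl) (auto simp: pmf_pair)
  also have "\<dots> = E_pmf ?P F * E_pmf ?Q G"
    using fin by (simp add: integral_measure_pmf_real[where A = "set_pmf ?P"]
        integral_measure_pmf_real[where A = "set_pmf ?Q"] sum_product)
  finally show ?thesis
    unfolding split by (simp add: Fh Gh)
qed

lemma expectation_Pi_pmf_prod:
  fixes F :: "'i \<Rightarrow> ('a \<Rightarrow> 'b) \<Rightarrow> real"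
  assumes "finite A" "\<And>x. x \<in> A \<Longrightarrow> finite (set_pmf (P x))" "finite I"
    and "disjoint_family_on B I" "\<And>i. i \<in> I \<Longrightarrow> B i \<subseteq> A"
    and "\<And>i. i \<in> I \<Longrightarrow> depends_on (B i) (F i)"
  shows "E_pmf (Pi_pmf A d P) (\<lambda>f. \<Prod>i\<in>I. F i f) =
    (\<Prod>i\<in>I. E_pmf (Pi_pmf A d P) (F i))"
  using assms(3-)
proof (induction I rule: finite_induct)
  case (insert i I)
  have disj: "B j \<subseteq> A - B i" if "j \<in> I" for j
  proof -
    have "B j \<inter> B i = {}" using insert.prems(1) insert.hyps that by (auto simp: disjoint_family_on_def)
    moreover have "B j \<subseteq> A" using insert.prems(2) that by auto
    ultimately show ?thesis by auto
  qed
  have "E_pmf (Pi_pmf A d P) (\<lambda>f. F i f * (\<Prod>i\<in>I. F i f)) =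
    E_pmf (Pi_pmf A d P) (F i) * E_pmf (Pi_pmf A d P) (\<lambda>f. \<Prod>i\<in>I. F i f)"
  proof (rule expectation_Pi_pmf_mult[OF assms(1,2)])
    show "B i \<subseteq> A" "depends_on (B i) (F i)" using insert.prems(2,3) by blast+
    have "depends_on (A - B i) (F j)" if "j \<in> I" for j
      using depends_on_mono[of "B j" "F j" "A - B i"] insert.prems(3)[of j] disj[OF that] that by blast
    then show "depends_on (A - B i) (\<lambda>f. \<Prod>i\<in>I. F i f)" by (rule depends_on_prod)
  qed
  also have "E_pmf (Pi_pmf A d P) (\<lambda>f. \<Prod>i\<in>I. F i f) =
      (\<Prod>i\<in>I. E_pmf (Pi_pmf A d P) (F i))"
    using insert.prems by (intro insert.IH) (auto simp: disjoint_family_on_def)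
  finally show ?case using insert.hyps by simp
qed simp

lemma expectation_Pi_pmf_component:
  fixes h :: "'b \<Rightarrow> real"
  assumes "finite A" "x \<in> A"
  shows "E_pmf (Pi_pmf A d P) (\<lambda>f. h (f x)) = E_pmf (P x) h"
proof -
  have "E_pmf (map_pmf (\<lambda>f. f x) (Pi_pmf A d P)) h = E_pmf (P x) h"
    using assms by (subst Pi_pmf_component) auto
  then show ?thesis by simp
qed

lemma prob_bind_pmf:
  "P_pmf (bind_pmf P K) S = E_pmf P (\<lambda>x. P_pmf (K x) S)"
proof -
  have "ennreal (P_pmf (bind_pmf P K) S) = (\<integral>\<^sup>+x. ennreal (P_pmf (K x) S) \<partial>P)"
    by (simp flip: measure_pmf.emeasure_eq_measure)
  also have "\<dots> = ennreal (E_pmf P (\<lambda>x. P_pmf (K x) S))"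
    by (intro nn_integral_eq_integral measure_pmf.integrable_const_bound[where B = 1]) auto
  finally show ?thesis by (simp add: expectation_nonneg)
qed

definition bit_weight :: "real \<Rightarrow> bool \<Rightarrow> real" where
  "bit_weight r b = (if b then r else 1 - r)"

text \<open>Fair coins serve as reference law for the links. The dependence of the links on the labels then sits
in a density, which is a product over pairs and can be bounded factor by factor.\<close>

definition coin_pmf :: "'e set \<Rightarrow> ('e \<Rightarrow> bool) pmf" where
  "coin_pmf E = Pi_pmf E False (\<lambda>_. bernoulli_pmf (1/2))"

lemma finite_coin_pmf: "finite E \<Longrightarrow> finite (set_pmf (coin_pmf E))"
  unfolding coin_pmf_def by (intro finite_set_Pi_pmf) auto

lemma finite_label_pmf: "finite V \<Longrightarrow> finite (set_pmf (label_pmf V))"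
  unfolding label_pmf_def by (intro finite_set_Pi_pmf) auto

lemma set_label_pmf: "finite V \<Longrightarrow> set_pmf (label_pmf V) = labellings V"
  unfolding label_pmf_def by (subst set_Pi_pmf) (auto simp: PiE_dflt_def labellings_def)

lemma expectation_label_component:
  fixes h :: "int \<Rightarrow> real"
  assumes "finite V" "v \<in> V"
  shows "E_pmf (label_pmf V) (\<lambda>s. h (s v)) = (h 1 + h (-1)) / 2"
  using assms unfolding label_pmf_def
  by (subst expectation_Pi_pmf_component) (auto simp: integral_pmf_of_set)

lemma expectation_coin_component:
  fixes h :: "bool \<Rightarrow> real"
  assumes "finite E" "e \<in> E"
  shows "E_pmf (coin_pmf E) (\<lambda>f. h (f e)) = (h True + h False) / 2"
  using assms unfolding coin_pmf_def
  by (subst expectation_Pi_pmf_component) (auto simp: integral_bernoulli_pmf)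

text \<open>Change of measure to fair coins. The factor 2 normalises each coin.\<close>

lemma expectation_bernoulli_Pi_eq_coin:
  fixes F :: "('e \<Rightarrow> bool) \<Rightarrow> real"
  assumes "finite E" "\<And>e. e \<in> E \<Longrightarrow> 0 \<le> r e \<and> r e \<le> 1"
  shows "E_pmf (Pi_pmf E False (\<lambda>e. bernoulli_pmf (r e))) F =
    E_pmf (coin_pmf E) (\<lambda>f. F f * (\<Prod>e\<in>E. 2 * bit_weight (r e) (f e)))"
proof -
  let ?S = "PiE_dflt E False (\<lambda>_. UNIV :: bool set)"
  have fin: "finite ?S" using assms by auto
  have sub: "f \<in> ?S" if "f \<in> set_pmf (Pi_pmf E False P)" for f P
    using subsetD[OF set_Pi_pmf_subset[OF assms(1)] that] by (auto simp: PiE_dflt_def)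
  have "E_pmf (Pi_pmf E False (\<lambda>e. bernoulli_pmf (r e))) F =
      (\<Sum>f\<in>?S. F f * pmf (Pi_pmf E False (\<lambda>e. bernoulli_pmf (r e))) f)"
    using sub fin by (intro integral_measure_pmf_real)
  also have "\<dots> = (\<Sum>f\<in>?S. (F f * (\<Prod>e\<in>E. 2 * bit_weight (r e) (f e))) * pmf (coin_pmf E) f)"
  proof (intro sum.cong refl)
    fix f assume f: "f \<in> ?S"
    have 1: "pmf (Pi_pmf E False (\<lambda>e. bernoulli_pmf (r e))) f = (\<Prod>e\<in>E. bit_weight (r e) (f e))"
      using assms f by (subst pmf_Pi') (auto simp: PiE_dflt_def bit_weight_def intro!: prod.cong)
    have 2: "pmf (coin_pmf E) f = (\<Prod>e\<in>E. 1/2)"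
      using assms f unfolding coin_pmf_def
      by (subst pmf_Pi') (auto simp: PiE_dflt_def intro!: prod.cong)
    have "(\<Prod>e\<in>E. 2 * bit_weight (r e) (f e)) * (\<Prod>e\<in>E. 1/2::real) = (\<Prod>e\<in>E. bit_weight (r e) (f e))"
      unfolding prod.distrib[symmetric] by (intro prod.cong) auto
    then show "F f * pmf (Pi_pmf E False (\<lambda>e. bernoulli_pmf (r e))) f =
        (F f * (\<Prod>e\<in>E. 2 * bit_weight (r e) (f e))) * pmf (coin_pmf E) f"
      by (simp add: 1 2 mult.assoc)
  qed
  also have "\<dots> = E_pmf (coin_pmf E) (\<lambda>f. F f * (\<Prod>e\<in>E. 2 * bit_weight (r e) (f e)))"
    using sub fin unfolding coin_pmf_def by (intro integral_measure_pmf_real[symmetric])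
  finally show ?thesis .
qed

section \<open>The likelihood of the links of one node\<close>

definition pair_prob :: "real \<Rightarrow> real \<Rightarrow> ('a \<Rightarrow> 'a \<Rightarrow> real) \<Rightarrow> ('a \<Rightarrow> int) \<Rightarrow> 'a \<times> 'a \<Rightarrow> real" where
  "pair_prob p q k s e = (if s (fst e) = s (snd e) then p else q) * k (fst e) (snd e)"

definition node_pairs :: "real set \<Rightarrow> (real \<times> real) set" where
  "node_pairs V = {(u, v). u \<in> V \<and> v \<in> V \<and> u < v}"

lemma finite_node_pairs: "finite V \<Longrightarrow> finite (node_pairs V)"
  by (rule finite_subset[of _ "V \<times> V"]) (auto simp: node_pairs_def)

definition label_edge_pmf ::
    "real \<Rightarrow> real \<Rightarrow> (real \<Rightarrow> real \<Rightarrow> real) \<Rightarrow> real set \<Rightarrow> ((real \<Rightarrow> int) \<times> (real \<times> real \<Rightarrow> bool)) pmf" where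
  "label_edge_pmf p q k V = bind_pmf (label_pmf V) (\<lambda>s. map_pmf (Pair s)
     (Pi_pmf (node_pairs V) False (\<lambda>e. bernoulli_pmf (pair_prob p q k s e))))"

text \<open>Links are indexed by pairs with increasing entries.\<close>

definition upair :: "real \<Rightarrow> real \<Rightarrow> real \<times> real" where
  "upair c u = (min c u, max c u)"

text \<open>The density, with respect to fair coins, of the links between \<open>c\<close> and the nodes of
\<open>N\<close> when the label of \<open>c\<close> is \<open>x\<close> and the other labels are
those of \<open>s\<close>.\<close>

definition centre_lik ::
    "real \<Rightarrow> real \<Rightarrow> (real \<Rightarrow> real \<Rightarrow> real) \<Rightarrow> real set \<Rightarrow> real \<Rightarrow> int \<Rightarrow> (real \<Rightarrow> int) \<Rightarrow> (real \<times> real \<Rightarrow> bool) \<Rightarrow> real" where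
  "centre_lik p q k N c x s f =
     (\<Prod>u\<in>N. 2 * bit_weight ((if x = s u then p else q) * k c u) (f (upair c u)))"

text \<open>A lower bound for the Bayes error at a node. Here \<open>d\<close> is the admitted size of half the
log-likelihood ratio and \<open>t\<close> is the tilt that controls the probability of larger
values. The truncation at 0 keeps it a lower bound when the correction term dominates.\<close>

definition flip_bound :: "real \<Rightarrow> real \<Rightarrow> real \<Rightarrow> real \<Rightarrow> real set \<Rightarrow> (real \<Rightarrow> real) \<Rightarrow> real" where
  "flip_bound p q t d N h = max 0 (exp (- d) / 2 * ((\<Prod>u\<in>N. affinity p q (h u))
      - 2 * exp (- (2 * t * d)) * (\<Prod>u\<in>N. cosh (t * llr_max p q) * affinity p q (h u))))"

lemma bit_weight_nonneg: "0 \<le> r \<Longrightarrow> r \<le> 1 \<Longrightarrow> 0 \<le> bit_weight r b"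
  by (auto simp: bit_weight_def)

lemma expectation_coin_prod:
  fixes h :: "'i \<Rightarrow> bool \<Rightarrow> real"
  assumes "finite E" "finite I" "inj_on e I" "e ` I \<subseteq> E"
  shows "E_pmf (coin_pmf E) (\<lambda>f. \<Prod>i\<in>I. h i (f (e i))) = (\<Prod>i\<in>I. (h i True + h i False) / 2)"
proof -
  have "E_pmf (coin_pmf E) (\<lambda>f. \<Prod>i\<in>I. h i (f (e i))) =
      (\<Prod>i\<in>I. E_pmf (coin_pmf E) (\<lambda>f. h i (f (e i))))"
    unfolding coin_pmf_def
  proof (rule expectation_Pi_pmf_prod[where B = "\<lambda>i. {e i}"])
    show "disjoint_family_on (\<lambda>i. {e i}) I"
      using assms(3) by (auto simp: disjoint_family_on_def inj_on_def)
  qed (use assms in \<open>auto simp: depends_on_def\<close>)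
  also have "\<dots> = (\<Prod>i\<in>I. (h i True + h i False) / 2)"
    using assms by (intro prod.cong refl expectation_coin_component) auto
  finally show ?thesis .
qed

lemma expectation_label_prod:
  fixes h :: "real \<Rightarrow> int \<Rightarrow> real"
  assumes "finite V" "I \<subseteq> V"
  shows "E_pmf (label_pmf V) (\<lambda>s. \<Prod>i\<in>I. h i (s i)) = (\<Prod>i\<in>I. (h i 1 + h i (-1)) / 2)"
proof -
  have "E_pmf (label_pmf V) (\<lambda>s. \<Prod>i\<in>I. h i (s i)) =
      (\<Prod>i\<in>I. E_pmf (label_pmf V) (\<lambda>s. h i (s i)))"
    unfolding label_pmf_def
  proof (rule expectation_Pi_pmf_prod[where B = "\<lambda>i. {i}"])
    show "finite I" using assms finite_subset by auto
  qed (use assms in \<open>auto simp: disjoint_family_on_def depends_on_def\<close>)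
  also have "\<dots> = (\<Prod>i\<in>I. (h i 1 + h i (-1)) / 2)"
    using assms by (intro prod.cong refl expectation_label_component) auto
  finally show ?thesis .
qed

lemma pair_prob_bounds:
  assumes "0 < p" "p < 1" "0 < q" "q < 1" "0 \<le> k" "k \<le> (1::real)"
  shows "0 \<le> (if b then p else q) * k" "(if b then p else q) * k \<le> 1"
  using prob_mult_le[of p k] prob_mult_le[of q k] assms by auto

lemma upair_inj: "inj_on (upair c) N"
  by (auto simp: inj_on_def upair_def min_def max_def split: if_splits)

lemma upair_in: "c \<in> V \<Longrightarrow> u \<in> V \<Longrightarrow> u \<noteq> c \<Longrightarrow> upair c u \<in> node_pairs V"
  by (auto simp: upair_def node_pairs_def min_def max_def)

lemma upair_image: "c \<in> V \<Longrightarrow> N \<subseteq> V - {c} \<Longrightarrow> upair c ` N \<subseteq> node_pairs V"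
  by (intro image_subsetI upair_in) auto

context
  fixes V N :: "real set" and c :: real and k :: "real \<Rightarrow> real \<Rightarrow> real" and p q :: real
  assumes fin: "finite V" and N: "N \<subseteq> V - {c}" "c \<in> V"
    and pq: "0 < p" "p < 1" "0 < q" "q < 1"
    and k01: "\<And>u v. u \<in> V \<Longrightarrow> v \<in> V \<Longrightarrow> 0 \<le> k u v \<and> k u v \<le> (1::real)"
begin

lemma finN: "finite N" using N fin finite_subset by auto

lemma centre_lik_nonneg: "0 \<le> centre_lik p q k N c x s f"
  unfolding centre_lik_def using N k01 pq
  by (intro prod_nonneg ballI mult_nonneg_nonneg bit_weight_nonneg pair_prob_bounds[OF pq]) auto

lemma expectation_centre_lik:
  "E_pmf (coin_pmf (node_pairs V)) (\<lambda>f. centre_lik p q k N c x s f) = 1"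
  unfolding centre_lik_def
  by (subst expectation_coin_prod[OF finite_node_pairs[OF fin] finN upair_inj upair_image[OF N(2,1)]])
     (simp add: bit_weight_def)

lemma tilt_centre_lik:
  "tilt t (centre_lik p q k N c 1 s f) (centre_lik p q k N c (-1) s f) =
    (\<Prod>u\<in>N. 2 * tilt t (bit_weight ((if 1 = s u then p else q) * k c u) (f (upair c u)))
                (bit_weight ((if - 1 = s u then p else q) * k c u) (f (upair c u))))"
proof -
  have b: "0 \<le> bit_weight ((if x = s u then p else q) * k c u) y" if "u \<in> N" for x u y
    using N k01 that by (intro bit_weight_nonneg pair_prob_bounds[OF pq]) auto
  show ?thesis
    unfolding centre_lik_def
  proof (subst tilt_prod)
    show "(\<Prod>u\<in>N. tilt t (2 * bit_weight ((if 1 = s u then p else q) * k c u) (f (upair c u)))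
         (2 * bit_weight ((if - 1 = s u then p else q) * k c u) (f (upair c u)))) =
      (\<Prod>u\<in>N. 2 * tilt t (bit_weight ((if 1 = s u then p else q) * k c u) (f (upair c u)))
         (bit_weight ((if - 1 = s u then p else q) * k c u) (f (upair c u))))"
      by (intro prod.cong refl tilt_scale b) auto
  qed (rule mult_nonneg_nonneg, simp, rule b, assumption)+
qed

text \<open>By independence of the coins and of the labels, the expectation of a product over \<open>N\<close>
is the product of the expectations.\<close>

lemma expectation_tilt_centre_lik:
  "E_pmf (label_pmf V) (\<lambda>s. E_pmf (coin_pmf (node_pairs V))
      (\<lambda>f. tilt t (centre_lik p q k N c 1 s f) (centre_lik p q k N c (-1) s f)))
    = (\<Prod>u\<in>N. mean_tilt p q t (k c u))"
proof -
  let ?h = "\<lambda>u (x::int) b. 2 * tilt t (bit_weight ((if 1 = x then p else q) * k c u) b)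
                (bit_weight ((if - 1 = x then p else q) * k c u) b)"
  have 1: "E_pmf (coin_pmf (node_pairs V)) (\<lambda>f. \<Prod>u\<in>N. ?h u (s u) (f (upair c u)))
    = (\<Prod>u\<in>N. (?h u (s u) True + ?h u (s u) False) / 2)" for s :: "real \<Rightarrow> int"
    by (rule expectation_coin_prod[OF finite_node_pairs[OF fin] finN upair_inj upair_image[OF N(2,1)]])
  have 2: "E_pmf (label_pmf V) (\<lambda>s. \<Prod>u\<in>N. (?h u (s u) True + ?h u (s u) False) / 2)
    = (\<Prod>u\<in>N. ((?h u 1 True + ?h u 1 False) / 2 + (?h u (-1) True + ?h u (-1) False) / 2) / 2)"
    using N by (intro expectation_label_prod fin) auto
  show ?thesis
    unfolding tilt_centre_lik 1 2
    by (intro prod.cong refl) (simp add: mean_tilt_def bit_weight_def field_simps)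
qed

text \<open>The left-hand side is \<open>min_ge_tilt\<close> integrated over labels and links. The two tilts
have the same mean, and this mean exceeds the affinity by at most a factor \<open>cosh\<close> per
node.\<close>

lemma expectation_min_centre_lik:
  assumes t: "0 \<le> t"
  shows "2 * flip_bound p q t d N (k c) \<le>
    E_pmf (label_pmf V) (\<lambda>s. E_pmf (coin_pmf (node_pairs V))
      (\<lambda>f. min (centre_lik p q k N c 1 s f) (centre_lik p q k N c (-1) s f)))"
    (is "_ \<le> ?R")
proof -
  let ?E = "\<lambda>t. E_pmf (label_pmf V) (\<lambda>s. E_pmf (coin_pmf (node_pairs V))
      (\<lambda>f. tilt t (centre_lik p q k N c 1 s f) (centre_lik p q k N c (-1) s f)))"
  let ?A = "(\<Prod>u\<in>N. affinity p q (k c u))" and ?B = "(\<Prod>u\<in>N. cosh (t * llr_max p q) * affinity p q (k c u))"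
  note fins = finite_label_pmf[OF fin] finite_coin_pmf[OF finite_node_pairs[OF fin]]
  have kk: "0 \<le> k c u" "k c u \<le> 1" if "u \<in> N" for u using N k01 that by auto
  have mt: "?E t' \<le> ?B" if "\<bar>t'\<bar> = t" for t'
  proof -
    have "cosh (t' * llr_max p q) = cosh (t * llr_max p q)"
      using that t by (simp add: abs_mult)
    from mean_tilt_le[OF pq, of _ t', unfolded this] have "0 \<le> mean_tilt p q t' (k c u) \<and>
        mean_tilt p q t' (k c u) \<le> cosh (t * llr_max p q) * affinity p q (k c u)" if "u \<in> N" for u
      using kk[OF that] by (auto simp: mean_tilt_def tilt_nonneg)
    then show ?thesis unfolding expectation_tilt_centre_lik by (intro prod_mono) auto
  qed
  have e0: "?E 0 = ?A"
    unfolding expectation_tilt_centre_lik by (intro prod.cong refl mean_tilt_0 pq kk)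
  have "exp (- d) * (?A
      - 2 * exp (- (2 * t * d)) * ?B)
    \<le> exp (- d) * (?E 0 - exp (- (2 * t * d)) * (?E t + ?E (- t)))"
  proof (intro mult_left_mono)
    have "exp (- (2 * t * d)) * (?E t + ?E (- t)) \<le> exp (- (2 * t * d)) *
        (?B + ?B)"
      using t by (intro mult_left_mono add_mono mt) auto
    then show "?A
      - 2 * exp (- (2 * t * d)) * ?B
      \<le> ?E 0 - exp (- (2 * t * d)) * (?E t + ?E (- t))" unfolding e0 by (simp add: algebra_simps)
  qed auto
  also have "\<dots> = E_pmf (label_pmf V) (\<lambda>s. E_pmf (coin_pmf (node_pairs V))
      (\<lambda>f. exp (- d) * (tilt 0 (centre_lik p q k N c 1 s f) (centre_lik p q k N c (-1) s f)
        - exp (- (2 * t * d)) * (tilt t (centre_lik p q k N c 1 s f) (centre_lik p q k N c (-1) s f)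
           + tilt (- t) (centre_lik p q k N c 1 s f) (centre_lik p q k N c (-1) s f)))))"
    using fins by (simp add: integrable_measure_pmf_finite)
  also have "\<dots> \<le> ?R"
    using t by (intro expectation_mono_pmf fins min_ge_tilt centre_lik_nonneg)
  finally have "exp (- d) * (?A
      - 2 * exp (- (2 * t * d)) * ?B) \<le> ?R" .
  moreover have "0 \<le> ?R" by (intro expectation_nonneg) (simp add: centre_lik_nonneg)
  ultimately show ?thesis unfolding flip_bound_def by (auto simp: max_def)
qed

text \<open>The success probability of the best test between two equally likely labels is half the integral of
the larger likelihood. It is one minus the Bayes error, because \<open>max x y + min x y = x +
y\<close>.\<close>

lemma half_expectation_max_centre_lik:
  assumes t: "0 \<le> t"
  shows "E_pmf (label_pmf V) (\<lambda>s. E_pmf (coin_pmf (node_pairs V))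
      (\<lambda>f. max (centre_lik p q k N c 1 s f) (centre_lik p q k N c (-1) s f))) / 2
    \<le> 1 - flip_bound p q t d N (k c)"
proof -
  note fins = finite_label_pmf[OF fin] finite_coin_pmf[OF finite_node_pairs[OF fin]]
  have mx: "max x y = x + y - min x y" for x y :: real by auto
  show ?thesis
    using expectation_min_centre_lik[OF t, of d] fins
    by (simp add: mx integrable_measure_pmf_finite expectation_centre_lik)
qed

end

section \<open>Success probability when some nodes do not interact\<close>

lemma pair_prob_range:
  assumes pq: "0 < p" "p < 1" "0 < q" "q < 1"
    and k01: "\<And>u v. u \<in> V \<Longrightarrow> v \<in> V \<Longrightarrow> 0 \<le> k u v \<and> k u v \<le> (1::real)"
    and e: "e \<in> node_pairs V"
  shows "0 \<le> pair_prob p q k s e \<and> pair_prob p q k s e \<le> 1"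
proof -
  have "0 \<le> k (fst e) (snd e) \<and> k (fst e) (snd e) \<le> 1"
    using e by (intro k01) (auto simp: node_pairs_def)
  then show ?thesis unfolding pair_prob_def using pair_prob_bounds[OF pq] by blast
qed

lemma prob_label_edge_pmf:
  assumes fin: "finite V" and pq: "0 < p" "p < 1" "0 < q" "q < 1"
    and k01: "\<And>u v. u \<in> V \<Longrightarrow> v \<in> V \<Longrightarrow> 0 \<le> k u v \<and> k u v \<le> (1::real)"
  shows "P_pmf (label_edge_pmf p q k V) {(s, f). Q s f} =
    E_pmf (label_pmf V) (\<lambda>s. E_pmf (coin_pmf (node_pairs V))
      (\<lambda>f. of_bool (Q s f) * (\<Prod>e\<in>node_pairs V. 2 * bit_weight (pair_prob p q k s e) (f e))))"
proof -
  have r: "0 \<le> pair_prob p q k s e \<and> pair_prob p q k s e \<le> 1" if "e \<in> node_pairs V" for s :: "real \<Rightarrow> int" and e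
    using that by (intro pair_prob_range[OF pq k01])
  let ?B = "\<lambda>s. Pi_pmf (node_pairs V) False (\<lambda>e. bernoulli_pmf (pair_prob p q k s e))"
  have "P_pmf (label_edge_pmf p q k V) {(s, f). Q s f} =
      E_pmf (label_pmf V) (\<lambda>s. P_pmf (map_pmf (Pair s) (?B s)) {(s, f). Q s f})"
    unfolding label_edge_pmf_def
    by (rule prob_bind_pmf)
  also have "(\<lambda>s. P_pmf (map_pmf (Pair s) (?B s)) {(s, f). Q s f}) =
      (\<lambda>s. E_pmf (?B s) (\<lambda>f. of_bool (Q s f)))"
  proof
    fix s :: "real \<Rightarrow> int"
    have "P_pmf (map_pmf (Pair s) (?B s)) {(s, f). Q s f} = P_pmf (?B s) {f. Q s f}"
      by (simp add: vimage_def)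
    also have "\<dots> = E_pmf (?B s) (indicator {f. Q s f})" by simp
    also have "indicator {f. Q s f} = (\<lambda>f. of_bool (Q s f) :: real)" by (auto simp: indicator_def)
    finally show "P_pmf (map_pmf (Pair s) (?B s)) {(s, f). Q s f} =
      E_pmf (?B s) (\<lambda>f. of_bool (Q s f))" .
  qed
  also have "\<dots> = (\<lambda>s. E_pmf (coin_pmf (node_pairs V))
      (\<lambda>f. of_bool (Q s f) * (\<Prod>e\<in>node_pairs V. 2 * bit_weight (pair_prob p q k s e) (f e))))"
    by (intro ext expectation_bernoulli_Pi_eq_coin finite_node_pairs[OF fin] r)
  finally show ?thesis .
qed

text \<open>Given the other labels, the labels of the nodes in \<open>C\<close> are independent, and each of
them influences only its own links. For every outcome of the links, \<open>T\<close> names a single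
value for each of these labels, so it collects at most the larger of the two likelihoods at each
node of \<open>C\<close>. Integrating over links and labels factorises this bound.\<close>

lemma genie_bound:
  fixes V C :: "real set" and N :: "real \<Rightarrow> real set"
    and k :: "real \<Rightarrow> real \<Rightarrow> real" and p q :: real
    and T :: "(real \<times> real \<Rightarrow> bool) \<Rightarrow> real \<Rightarrow> int"
  assumes fin: "finite V" and pq: "0 < p" "p < 1" "0 < q" "q < 1"
    and k01: "\<And>u v. u \<in> V \<Longrightarrow> v \<in> V \<Longrightarrow> 0 \<le> k u v \<and> k u v \<le> 1"
    and ksym: "\<And>u v. u \<in> V \<Longrightarrow> v \<in> V \<Longrightarrow> k u v = k v u"
    and C: "C \<subseteq> V" and N: "\<And>c. c \<in> C \<Longrightarrow> N c \<subseteq> V - C"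
    and disj: "disjoint_family_on N C"
    and far: "\<And>c u. c \<in> C \<Longrightarrow> u \<in> V - N c - {c} \<Longrightarrow> k c u = 0"
    and t: "0 \<le> t"
  shows "P_pmf (label_edge_pmf p q k V) {(s, f). s = T f}
      \<le> (\<Prod>c\<in>C. 1 - flip_bound p q t d (N c) (k c))"
proof -
  let ?E = "node_pairs V"
  let ?L = "label_pmf V" and ?K = "coin_pmf ?E"
  define Ec where "Ec c = upair c ` N c" for c
  define E0 where "E0 = ?E - (\<Union>c\<in>C. Ec c)"
  define X where "X c x s f = centre_lik p q k (N c) c x s f" for c x s f
  define M where "M c s f = max (X c 1 s f) (X c (-1) s f)" for c s f
  define w where "w s e f = 2 * bit_weight (pair_prob p q k s e) (f e)" for s e and f :: "real \<times> real \<Rightarrow> bool"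
  \<comment> \<open>The links outside all \<open>Ec c\<close> do not depend on the labels on \<open>C\<close>, so these may be reset to a fixed value.\<close>
  define r where "r s v = (if v \<in> C then 1 else s v)" for s :: "real \<Rightarrow> int" and v
  define G where "G s f = (\<Prod>e\<in>E0. w (r s) e f)" for s f
  have finC: "finite C" using C fin finite_subset by auto
  have finE: "finite ?E" by (rule finite_node_pairs[OF fin])
  note fins = finite_label_pmf[OF fin] finite_coin_pmf[OF finE]
  have NV: "N c \<subseteq> V - {c}" "c \<in> V" if "c \<in> C" for c using N[OF that] C that by auto
  have EcE: "Ec c \<subseteq> ?E" if "c \<in> C" for c
    unfolding Ec_def using NV[OF that] by (intro upair_image) auto
  have finEc: "finite (Ec c)" if "c \<in> C" for c using EcE[OF that] finE finite_subset by auto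
  have disjE: "disjoint_family_on Ec C"
  proof (unfold disjoint_family_on_def, intro ballI impI)
    fix c c' assume cc: "c \<in> C" "c' \<in> C" "c \<noteq> c'"
    have False if "upair c u = upair c' u'" "u \<in> N c" "u' \<in> N c'" for u u'
      using that N[OF cc(1)] N[OF cc(2)] cc
      by (auto simp: upair_def min_def max_def split: if_splits)
    then show "Ec c \<inter> Ec c' = {}" unfolding Ec_def by blast
  qed
  have rr: "0 \<le> pair_prob p q k s e \<and> pair_prob p q k s e \<le> 1" if "e \<in> ?E" for s :: "real \<Rightarrow> int" and e
    using that by (intro pair_prob_range[OF pq k01])
  have w0: "0 \<le> w s e f" if "e \<in> ?E" for s e f
    unfolding w_def using rr[OF that] by (intro mult_nonneg_nonneg bit_weight_nonneg) auto
  have X0: "0 \<le> X c x s f" if "c \<in> C" for c x s f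
    unfolding X_def using centre_lik_nonneg[OF fin NV[OF that] pq k01] .
  have M0: "0 \<le> M c s f" if "c \<in> C" for c s f
    unfolding M_def using X0[OF that] by (auto simp: max_def)
  have G0: "0 \<le> G s f" for s f
    unfolding G_def by (intro prod_nonneg ballI w0) (auto simp: E0_def)
  have XE: "(\<Prod>e\<in>Ec c. w s e f) = X c (s c) s f" if c: "c \<in> C" for c s f
    unfolding Ec_def
  proof (subst prod.reindex[OF upair_inj], unfold X_def centre_lik_def, intro prod.cong refl)
    fix u assume u: "u \<in> N c"
    then have "u \<in> V" "c \<in> V" using NV[OF c] by auto
    then have "pair_prob p q k s (upair c u) = (if s c = s u then p else q) * k c u"
      using ksym[of c u] by (auto simp: pair_prob_def upair_def min_def max_def)
    then show "((\<lambda>e. w s e f) \<circ> upair c) u =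
        2 * bit_weight ((if s c = s u then p else q) * k c u) (f (upair c u))"
      by (simp add: w_def)
  qed
  \<comment> \<open>A remaining pair either avoids \<open>C\<close> or has link probability 0.\<close>
  have wr: "w s e f = w (r s) e f" if e: "e \<in> E0" for s e f
  proof -
    obtain a b where ab: "e = (a, b)" "a \<in> V" "b \<in> V" "a < b" "e \<in> ?E"
      using e by (auto simp: E0_def node_pairs_def)
    have k0: "k a b = 0" if c: "a \<in> C \<or> b \<in> C"
      using c
    proof
      assume a: "a \<in> C"
      have "b \<notin> N a"
      proof
        assume "b \<in> N a"
        then have "upair a b \<in> Ec a" by (auto simp: Ec_def)
        then show False using e a ab by (auto simp: E0_def upair_def min_def max_def)
      qed
      then show "k a b = 0" using far[OF a, of b] ab by auto
    next
      assume b: "b \<in> C"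
      have "a \<notin> N b"
      proof
        assume "a \<in> N b"
        then have "upair b a \<in> Ec b" by (auto simp: Ec_def)
        then show False using e b ab by (auto simp: E0_def upair_def min_def max_def)
      qed
      then show "k a b = 0" using far[OF b, of a] ab ksym[of a b] by auto
    qed
    show ?thesis
      using k0 ab by (cases "a \<in> C \<or> b \<in> C") (auto simp: w_def pair_prob_def r_def)
  qed
  have split: "(\<Prod>e\<in>?E. w s e f) = G s f * (\<Prod>c\<in>C. X c (s c) s f)" for s f
  proof -
    have "(\<Prod>e\<in>?E. w s e f) = (\<Prod>e\<in>E0. w s e f) * (\<Prod>e\<in>(\<Union>c\<in>C. Ec c). w s e f)"
      unfolding E0_def using EcE finE by (intro prod.subset_diff) auto
    also have "(\<Prod>e\<in>(\<Union>c\<in>C. Ec c). w s e f) = (\<Prod>c\<in>C. \<Prod>e\<in>Ec c. w s e f)"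
      using disjE finEc finC by (intro prod.UNION_disjoint) (auto simp: disjoint_family_on_def)
    also have "\<dots> = (\<Prod>c\<in>C. X c (s c) s f)" by (intro prod.cong refl XE)
    also have "(\<Prod>e\<in>E0. w s e f) = G s f" unfolding G_def by (intro prod.cong refl wr)
    finally show ?thesis .
  qed
  have depM_s: "depends_on (N c) (\<lambda>s. M c s f)" for c f
    unfolding M_def X_def depends_on_def centre_lik_def by simp
  have depM_f: "depends_on (Ec c) (\<lambda>f. M c s f)" for c s
    unfolding M_def X_def depends_on_def centre_lik_def Ec_def by simp
  have depG: "depends_on (V - C) (\<lambda>s. G s f)" for f
  proof (unfold depends_on_def, intro allI impI)
    fix s s' :: "real \<Rightarrow> int" assume "\<forall>x\<in>V - C. s x = s' x"
    then have "r s x = r s' x" if "x \<in> V" for x using that by (auto simp: r_def)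
    then show "G s f = G s' f" unfolding G_def w_def pair_prob_def
      by (intro prod.cong refl) (auto simp: E0_def node_pairs_def)
  qed
  let ?GM = "\<lambda>s f. G s f * (\<Prod>c\<in>C. M c s f)"
  let ?O = "\<lambda>s f. \<Prod>c\<in>C. of_bool (s c = T f c) :: real"
  let ?H = "\<lambda>c. E_pmf ?L (\<lambda>s. E_pmf ?K (\<lambda>f. M c s f))"
  have "P_pmf (label_edge_pmf p q k V) {(s, f). s = T f} =
    E_pmf ?L (\<lambda>s. E_pmf ?K
      (\<lambda>f. of_bool (s = T f) * (\<Prod>e\<in>?E. w s e f)))"
    unfolding w_def by (rule prob_label_edge_pmf[OF fin pq k01])
  \<comment> \<open>Correctness is required only on \<open>C\<close>, and the likelihood of each node of \<open>C\<close> is replaced by the larger one.\<close>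
  also have "\<dots> \<le> E_pmf ?L (\<lambda>s. E_pmf ?K
      (\<lambda>f. ?O s f * ?GM s f))"
  proof (intro expectation_mono_pmf fins mult_mono)
    fix s f assume "s \<in> set_pmf ?L"
    then have sc: "s c \<in> {1, -1}" if "c \<in> C" for c
      using C that by (auto simp: set_label_pmf[OF fin] labellings_def)
    have "X c (s c) s f \<le> M c s f" if "c \<in> C" for c
      using sc[OF that] by (auto simp: M_def)
    then show "(\<Prod>e\<in>?E. w s e f) \<le> ?GM s f"
      unfolding split by (intro mult_left_mono G0 prod_mono) (auto simp: X0)
    show "of_bool (s = T f) \<le> (\<Prod>c\<in>C. of_bool (s c = T f c) :: real)"
      by (cases "s = T f") (auto intro: prod_nonneg)
  qed (auto intro!: prod_nonneg w0)
  also have "\<dots> = E_pmf ?K (\<lambda>f. E_pmf ?L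
      (\<lambda>s. ?O s f * ?GM s f))"
    by (rule expectation_swap_pmf[OF fins])
  \<comment> \<open>For fixed links, a uniform label agrees with the one named by \<open>T\<close> with probability at most 1/2, independently of the other factor.\<close>
  also have "\<dots> \<le> E_pmf ?K (\<lambda>f. (\<Prod>c\<in>C. 1/2) * E_pmf ?L
      (\<lambda>s. ?GM s f))"
  proof (intro expectation_mono_pmf fins)
    fix f
    have "E_pmf ?L (\<lambda>s. ?O s f * ?GM s f)
      = E_pmf ?L (\<lambda>s. ?O s f) *
        E_pmf ?L (\<lambda>s. ?GM s f)"
      unfolding label_pmf_def
    proof (rule expectation_Pi_pmf_mult[OF fin _ C])
      show "depends_on C (\<lambda>s. \<Prod>c\<in>C. of_bool (s c = T f c) :: real)"
        unfolding depends_on_def by simp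
      have "depends_on (V - C) (\<lambda>s. M c s f)" if "c \<in> C" for c
        by (rule depends_on_mono[OF depM_s N[OF that]])
      then have "depends_on (V - C) (\<lambda>s. \<Prod>c\<in>C. M c s f)" by (rule depends_on_prod)
      with depG[of f] show "depends_on (V - C) (\<lambda>s. ?GM s f)"
        unfolding depends_on_def by metis
    qed auto
    also have "E_pmf ?L (\<lambda>s. ?O s f) =
        (\<Prod>c\<in>C. (of_bool (1 = T f c) + of_bool (-1 = T f c)) / (2::real))"
      using fin C by (rule expectation_label_prod)
    also have "(\<Prod>c\<in>C. (of_bool (1 = T f c) + of_bool (-1 = T f c)) / (2::real)) *
         E_pmf ?L (\<lambda>s. ?GM s f)
        \<le> (\<Prod>c\<in>C. 1/2) * E_pmf ?L (\<lambda>s. ?GM s f)"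
    proof (intro mult_right_mono prod_mono expectation_nonneg mult_nonneg_nonneg G0 prod_nonneg ballI M0)
      fix c assume "c \<in> C"
      show "0 \<le> (of_bool (1 = T f c) + of_bool (-1 = T f c)) / (2::real) \<and>
         (of_bool (1 = T f c) + of_bool (-1 = T f c)) / (2::real) \<le> 1/2"
        by (auto simp: of_bool_def)
    qed
    finally show "E_pmf ?L (\<lambda>s. ?O s f * ?GM s f)
      \<le> (\<Prod>c\<in>C. 1/2) * E_pmf ?L (\<lambda>s. ?GM s f)" .
  qed
  also have "\<dots> = (\<Prod>c\<in>C. 1/2) * E_pmf ?L (\<lambda>s. E_pmf ?K
      (\<lambda>f. ?GM s f))"
    by (simp add: expectation_swap_pmf[OF fins])
  also have "(\<lambda>s. E_pmf ?K (\<lambda>f. ?GM s f)) =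
      (\<lambda>s. \<Prod>c\<in>C. E_pmf ?K (\<lambda>f. M c s f))"
  proof
    fix s
    have "E_pmf ?K (\<lambda>f. ?GM s f) =
        E_pmf ?K (\<lambda>f. G s f) * E_pmf ?K (\<lambda>f. \<Prod>c\<in>C. M c s f)"
      unfolding coin_pmf_def
    proof (rule expectation_Pi_pmf_mult[OF finE])
      show "E0 \<subseteq> ?E" by (auto simp: E0_def)
      show "depends_on E0 (G s)" unfolding depends_on_def G_def w_def by simp
      have "depends_on (?E - E0) (M c s)" if "c \<in> C" for c
        by (rule depends_on_mono[OF depM_f]) (use that EcE[OF that] in \<open>auto simp: E0_def\<close>)
      then show "depends_on (?E - E0) (\<lambda>f. \<Prod>c\<in>C. M c s f)" by (rule depends_on_prod)
    qed auto
    also have "E_pmf ?K (\<lambda>f. G s f) = 1"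
    proof -
      have "E_pmf ?K (\<lambda>f. \<Prod>e\<in>E0. (\<lambda>e b. 2 * bit_weight (pair_prob p q k (r s) e) b) e (f (id e)))
        = (\<Prod>e\<in>E0. (2 * bit_weight (pair_prob p q k (r s) e) True + 2 * bit_weight (pair_prob p q k (r s) e) False) / 2)"
        using finE by (intro expectation_coin_prod) (auto simp: E0_def)
      then show ?thesis by (simp add: G_def w_def bit_weight_def)
    qed
    also have "E_pmf ?K (\<lambda>f. \<Prod>c\<in>C. M c s f) = (\<Prod>c\<in>C. E_pmf ?K (\<lambda>f. M c s f))"
      unfolding coin_pmf_def using EcE depM_f
      by (intro expectation_Pi_pmf_prod[where B = Ec] finE finC disjE) auto
    finally show "E_pmf ?K (\<lambda>f. ?GM s f) =
      (\<Prod>c\<in>C. E_pmf ?K (\<lambda>f. M c s f))" by simp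
  qed
  also have "E_pmf ?L (\<lambda>s. \<Prod>c\<in>C. E_pmf ?K (\<lambda>f. M c s f)) =
      (\<Prod>c\<in>C. ?H c)"
    unfolding label_pmf_def
  proof (intro expectation_Pi_pmf_prod[where B = N] fin finC disj)
    fix c assume "c \<in> C"
    show "N c \<subseteq> V" using NV[OF \<open>c \<in> C\<close>] by auto
    show "depends_on (N c) (\<lambda>s. E_pmf ?K (\<lambda>f. M c s f))"
      unfolding depends_on_def
    proof (intro allI impI)
      fix s s' :: "real \<Rightarrow> int" assume "\<forall>x\<in>N c. s x = s' x"
      then have "M c s f = M c s' f" for f using depM_s[of c f] unfolding depends_on_def by blast
      then show "E_pmf ?K (\<lambda>f. M c s f) = E_pmf ?K (\<lambda>f. M c s' f)" by simp
    qed
  qed auto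
  also have "(\<Prod>c\<in>C. 1/2) * (\<Prod>c\<in>C. ?H c)
    = (\<Prod>c\<in>C. ?H c / 2)"
    unfolding prod.distrib[symmetric] by simp
  also have "\<dots> \<le> (\<Prod>c\<in>C. 1 - flip_bound p q t d (N c) (k c))"
  proof (intro prod_mono conjI)
    fix c assume c: "c \<in> C"
    show "?H c / 2 \<le> 1 - flip_bound p q t d (N c) (k c)"
      unfolding M_def X_def
      by (rule half_expectation_max_centre_lik[OF fin NV[OF c] pq k01 t])
    show "0 \<le> ?H c / 2"
      using M0[OF c] by (intro divide_nonneg_nonneg expectation_nonneg) auto
  qed
  finally show ?thesis .
qed

section \<open>Flipping a set of nodes without outgoing links\<close>

lemma label_pmf_eq_pmf_of_set: "finite V \<Longrightarrow> label_pmf V = pmf_of_set (labellings V)"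
proof -
  assume fin: "finite V"
  have "label_pmf V = pmf_of_set (PiE_dflt V 0 (\<lambda>_. {-1, 1}))"
    unfolding label_pmf_def using fin by (intro Pi_pmf_of_set) auto
  also have "PiE_dflt V 0 (\<lambda>_. {-1, 1}) = labellings V"
    by (auto simp: PiE_dflt_def labellings_def)
  finally show ?thesis .
qed

definition flip_on :: "real set \<Rightarrow> (real \<Rightarrow> int) \<Rightarrow> real \<Rightarrow> int" where
  "flip_on W s v = (if v \<in> W then - s v else s v)"

lemma flip_on_flip_on: "flip_on W (flip_on W s) = s"
  by (auto simp: flip_on_def)

lemma flip_on_labellings: "s \<in> labellings V \<Longrightarrow> flip_on W s \<in> labellings V"
  by (auto simp: flip_on_def labellings_def)

lemma map_flip_on_label_pmf:
  assumes "finite V"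
  shows "map_pmf (flip_on W) (label_pmf V) = label_pmf V"
proof -
  have "bij_betw (flip_on W) (labellings V) (labellings V)"
    by (rule bij_betw_byWitness[where f' = "flip_on W"])
       (auto simp: flip_on_flip_on flip_on_labellings)
  moreover have "finite (labellings V)" "labellings V \<noteq> {}"
    using finite_label_pmf[OF assms] set_pmf_not_empty[of "label_pmf V"] by (auto simp: set_label_pmf[OF assms])
  ultimately show ?thesis
    unfolding label_pmf_eq_pmf_of_set[OF assms] by (intro map_pmf_of_set_bij_betw)
qed

lemma flip_invariance:
  fixes k :: "real \<Rightarrow> real \<Rightarrow> real"
  assumes fin: "finite V" and pq: "0 < p" "p < 1" "0 < q" "q < 1"
    and k01: "\<And>u v. u \<in> V \<Longrightarrow> v \<in> V \<Longrightarrow> 0 \<le> k u v \<and> k u v \<le> 1"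
    and cut: "\<And>u v. u \<in> V \<Longrightarrow> v \<in> V \<Longrightarrow> (u \<in> W) \<noteq> (v \<in> W) \<Longrightarrow> k u v = 0"
  shows "P_pmf (label_edge_pmf p q k V) {(s, f). Q (flip_on W s) f} =
    P_pmf (label_edge_pmf p q k V) {(s, f). Q s f}"
proof -
  let ?G = "\<lambda>s. E_pmf (coin_pmf (node_pairs V))
      (\<lambda>f. of_bool (Q s f) * (\<Prod>e\<in>node_pairs V. 2 * bit_weight (pair_prob p q k s e) (f e)))"
  have "pair_prob p q k (flip_on W s) e = pair_prob p q k s e" if "e \<in> node_pairs V" for s :: "real \<Rightarrow> int" and e
    using that cut[of "fst e" "snd e"] by (auto simp: pair_prob_def flip_on_def node_pairs_def)
  then have pr: "(\<Prod>e\<in>node_pairs V. 2 * bit_weight (pair_prob p q k (flip_on W s) e) (f e)) =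
      (\<Prod>e\<in>node_pairs V. 2 * bit_weight (pair_prob p q k s e) (f e))" for s f
    by (intro prod.cong) auto
  have "P_pmf (label_edge_pmf p q k V) {(s, f). Q (flip_on W s) f} =
      E_pmf (label_pmf V) (\<lambda>s. ?G (flip_on W s))"
    by (subst prob_label_edge_pmf[OF fin pq k01]) (auto simp: pr)
  also have "\<dots> = E_pmf (map_pmf (flip_on W) (label_pmf V)) ?G" by simp
  also have "\<dots> = P_pmf (label_edge_pmf p q k V) {(s, f). Q s f}"
    unfolding map_flip_on_label_pmf[OF fin] by (subst prob_label_edge_pmf[OF fin pq k01]) auto
  finally show ?thesis .
qed

lemma set_label_edge_pmf: "finite V \<Longrightarrow> (s, f) \<in> set_pmf (label_edge_pmf p q k V) \<Longrightarrow> s \<in> labellings V"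
  by (auto simp: label_edge_pmf_def set_label_pmf)

text \<open>The events that \<open>T\<close> is correct for the labelling and that it is correct for the
labelling flipped on \<open>W\<close> have the same probability, and they are disjoint because a
flip on a proper part of the nodes is not a global sign change.\<close>

lemma disconnected_bound:
  fixes k :: "real \<Rightarrow> real \<Rightarrow> real"
  assumes fin: "finite V" and pq: "0 < p" "p < 1" "0 < q" "q < 1"
    and k01: "\<And>u v. u \<in> V \<Longrightarrow> v \<in> V \<Longrightarrow> 0 \<le> k u v \<and> k u v \<le> 1"
    and cut: "\<And>u v. u \<in> V \<Longrightarrow> v \<in> V \<Longrightarrow> (u \<in> W) \<noteq> (v \<in> W) \<Longrightarrow> k u v = 0"
    and W: "a \<in> V \<inter> W" "b \<in> V - W"
  shows "P_pmf (label_edge_pmf p q k V) {(s, f). s = T f \<or> s = - T f} \<le> 1 / 2"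
proof -
  let ?P = "label_edge_pmf p q k V"
  let ?Q = "\<lambda>s f. s = T f \<or> s = - T f"
  have "P_pmf ?P {(s, f). ?Q s f} + P_pmf ?P {(s, f). ?Q (flip_on W s) f}
     = P_pmf ?P ({(s, f). ?Q s f} \<inter> set_pmf ?P) +
       P_pmf ?P ({(s, f). ?Q (flip_on W s) f} \<inter> set_pmf ?P)"
    by (simp add: measure_Int_set_pmf)
  also have "\<dots> = P_pmf ?P (({(s, f). ?Q s f} \<inter> set_pmf ?P) \<union> ({(s, f). ?Q (flip_on W s) f} \<inter> set_pmf ?P))"
  proof (rule measure_pmf.finite_measure_Union[symmetric])
    have False if "(s, f) \<in> set_pmf ?P" "?Q s f" "?Q (flip_on W s) f" for s f
    proof -
      have s: "s \<in> labellings V" using set_label_edge_pmf[OF fin that(1)] .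
      then have sv: "s a \<noteq> 0" "s b \<noteq> 0" using W by (auto simp: labellings_def)
      have "flip_on W s = s \<or> flip_on W s = - s" using that by auto
      then have "(flip_on W s a = s a \<and> flip_on W s b = s b) \<or> (flip_on W s a = - s a \<and> flip_on W s b = - s b)"
        by (auto simp: fun_eq_iff)
      then show False using sv W by (auto simp: flip_on_def)
    qed
    then show "({(s, f). ?Q s f} \<inter> set_pmf ?P) \<inter> ({(s, f). ?Q (flip_on W s) f} \<inter> set_pmf ?P) = {}"
      by blast
  qed auto
  also have "\<dots> \<le> 1" by simp
  finally show ?thesis
    using flip_invariance[OF fin pq k01 cut, where Q = ?Q] by simp
qed

lemma link_prob_eq_pair_prob:
  "link_prob n \<phi> p q s u v = pair_prob p q (\<lambda>u v. \<phi> (circle_dist n u v / ln (real n))) s (u, v)"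
  by (simp add: link_prob_def pair_prob_def)

text \<open>The link indicators on increasing pairs carry all the randomness of the adjacency matrix.\<close>

lemma label_adj_pmf_eq:
  "label_adj_pmf n \<phi> p q V =
    map_pmf (\<lambda>(s, f). (s, \<lambda>u v. of_bool (f (min u v, max u v))))
      (label_edge_pmf p q (\<lambda>u v. \<phi> (circle_dist n u v / ln (real n))) V)"
proof -
  have "(\<lambda>(u, v). bernoulli_pmf (link_prob n \<phi> p q s u v)) =
     (\<lambda>e. bernoulli_pmf (pair_prob p q (\<lambda>u v. \<phi> (circle_dist n u v / ln (real n))) s e))" for s
    by (auto simp: link_prob_eq_pair_prob)
  then show ?thesis
    unfolding label_adj_pmf_def label_edge_pmf_def adj_pmf_def node_pairs_def[symmetric]
    by (simp add: map_bind_pmf pmf.map_comp o_def)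
qed

lemma Ham_eq_0_iff_agree:
  assumes "finite V"
  shows "Ham V t s = 0 \<longleftrightarrow> (\<forall>v\<in>V. t v = - s v) \<or> (\<forall>v\<in>V. t v = s v)"
proof -
  have "Ham V t s = min (card {v \<in> V. t v \<noteq> - s v}) (card {v \<in> V. t v \<noteq> s v})"
    by (simp add: Ham_def)
  moreover have "min a b = 0 \<longleftrightarrow> a = 0 \<or> b = 0" for a b :: nat by auto
  ultimately show ?thesis using assms by (simp add: Ball_def)
qed

lemma Ham_eq_0_iff:
  assumes "finite V" "s \<in> labellings V" "t \<in> labellings V"
  shows "Ham V t s = 0 \<longleftrightarrow> s = t \<or> s = - t"
proof -
  have "(\<forall>v\<in>V. t v = s v) \<longleftrightarrow> s = t"
    using assms by (auto simp: labellings_def fun_eq_iff) metis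
  moreover have "(\<forall>v\<in>V. t v = - s v) \<longleftrightarrow> s = - t"
    using assms by (auto simp: labellings_def fun_eq_iff) (metis equation_minus_iff neg_equal_0_iff_equal)+
  ultimately show ?thesis
    unfolding Ham_eq_0_iff_agree[OF assms(1)] by (simp only: disj_commute)
qed

lemma prob_label_adj_pmf_le:
  assumes fin: "finite V" and S: "\<And>s a. (s, a) \<in> S \<Longrightarrow> s \<in> labellings V \<Longrightarrow> s = t a \<or> s = - t a"
  shows "P_pmf (label_adj_pmf n \<phi> p q V) S \<le>
    P_pmf (label_edge_pmf p q (\<lambda>u v. \<phi> (circle_dist n u v / ln (real n))) V)
      {(s, f). s = t (\<lambda>u v. of_bool (f (min u v, max u v))) \<or> s = - t (\<lambda>u v. of_bool (f (min u v, max u v)))}"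
proof -
  let ?P = "label_edge_pmf p q (\<lambda>u v. \<phi> (circle_dist n u v / ln (real n))) V"
  let ?h = "\<lambda>(s, f). (s, \<lambda>u v. of_bool (f (min u v, max u v)))"
  have "P_pmf (label_adj_pmf n \<phi> p q V) S = P_pmf ?P ((?h -` S) \<inter> set_pmf ?P)"
    unfolding label_adj_pmf_eq by (simp add: measure_Int_set_pmf)
  also have "\<dots> \<le> P_pmf ?P
      {(s, f). s = t (\<lambda>u v. of_bool (f (min u v, max u v))) \<or> s = - t (\<lambda>u v. of_bool (f (min u v, max u v)))}"
    using S set_label_edge_pmf[OF fin] by (intro measure_pmf.finite_measure_mono) fastforce+
  finally show ?thesis .
qed

section \<open>The sigma-algebra of finite configurations\<close>

lemma space_circle: "space (circle n) = {- real n / 2 <.. real n / 2}"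
  by (simp add: circle_def space_restrict_space)

lemma sets_circle_iff: "B \<in> sets (circle n) \<longleftrightarrow> B \<in> sets borel \<and> B \<subseteq> {- real n / 2 <.. real n / 2}"
  unfolding circle_def by (subst sets_restrict_space_iff) auto

lemma space_point_configs: "space (point_configs S) = {X. finite X \<and> X \<subseteq> space S}"
  unfolding point_configs_def by (intro space_measure_of) auto

lemma sets_point_configs:
  "sets (point_configs S) = sigma_sets {X. finite X \<and> X \<subseteq> space S}
     {{X. finite X \<and> X \<subseteq> space S \<and> card (X \<inter> B) = k} | B k. B \<in> sets S}"
  unfolding point_configs_def by (intro sets_measure_of) auto

lemma measurable_card_point_configs:
  assumes "B \<in> sets S"
  shows "(\<lambda>X. card (X \<inter> B)) \<in> measurable (point_configs S) (count_space UNIV)"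
proof (subst measurable_count_space_eq2_countable, intro conjI ballI)
  fix k :: nat
  have "(\<lambda>X. card (X \<inter> B)) -` {k} \<inter> space (point_configs S) = {X. finite X \<and> X \<subseteq> space S \<and> card (X \<inter> B) = k}"
    by (auto simp: space_point_configs)
  then show "(\<lambda>X. card (X \<inter> B)) -` {k} \<inter> space (point_configs S) \<in> sets (point_configs S)"
    unfolding sets_point_configs using assms by auto
qed auto

lemma measurable_point_configsI:
  assumes "\<And>\<omega>. \<omega> \<in> space M \<Longrightarrow> finite (f \<omega>) \<and> f \<omega> \<subseteq> space S"
    and "\<And>B. B \<in> sets S \<Longrightarrow> (\<lambda>\<omega>. card (f \<omega> \<inter> B)) \<in> measurable M (count_space UNIV)"
  shows "f \<in> measurable M (point_configs S)"
  unfolding point_configs_def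
proof (rule measurable_measure_of)
  fix y assume "y \<in> {{X. finite X \<and> X \<subseteq> space S \<and> card (X \<inter> B) = k} | B k. B \<in> sets S}"
  then obtain B k where B: "B \<in> sets S" "y = {X. finite X \<and> X \<subseteq> space S \<and> card (X \<inter> B) = k}" by blast
  have "f -` y \<inter> space M = (\<lambda>\<omega>. card (f \<omega> \<inter> B)) -` {k} \<inter> space M"
    using assms(1) by (auto simp: B(2))
  then show "f -` y \<inter> space M \<in> sets M" using assms(2)[OF B(1)] by (auto intro: measurable_sets)
qed (use assms(1) in auto)

lemma measurable_Int_point_configs:
  assumes "C \<in> sets S"
  shows "(\<lambda>X. X \<inter> C) \<in> measurable (point_configs S) (point_configs S)"
proof (rule measurable_point_configsI)
  fix B assume "B \<in> sets S"
  then show "(\<lambda>X. card (X \<inter> C \<inter> B)) \<in> measurable (point_configs S) (count_space UNIV)"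
    using measurable_card_point_configs[of "C \<inter> B" S] assms by (simp add: Int_assoc)
qed (auto simp: space_point_configs)

lemma measurable_card_node_space: "card \<in> measurable (node_space n) (count_space UNIV)"
proof -
  have "(\<lambda>X. card (X \<inter> space (circle n))) \<in> measurable (node_space n) (count_space UNIV)"
    unfolding node_space_def by (intro measurable_card_point_configs) auto
  then show ?thesis
    by (rule measurable_cong[THEN iffD1, rotated]) (auto simp: node_space_def space_point_configs Int_absorb2)
qed

text \<open>The events of containing no point of a given set. Unlike the events that prescribe counts, they are
closed under intersection.\<close>

definition void_events :: "nat \<Rightarrow> real set set set" where
  "void_events n = {{X \<in> space (node_space n). X \<inter> B = {}} | B. B \<in> sets (circle n)}"

definition cell :: "nat \<Rightarrow> int \<Rightarrow> real set" where
  "cell j i = {x. \<lfloor>x * 2 ^ j\<rfloor> = i}"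

lemma cell_borel: "cell j i \<in> sets borel"
  unfolding cell_def by measurable

text \<open>Distinct points of a finite set lie in distinct dyadic cells once the mesh is fine, so the occupied
cells count the points.\<close>

lemma card_eq_eventually_occupied_cells:
  fixes X :: "real set"
  assumes fin: "finite X" and X: "X \<subseteq> {- real n / 2 <.. real n / 2}"
  shows "\<forall>\<^sub>F j in sequentially. card X = (\<Sum>i\<in>{- int n * 2 ^ j .. int n * 2 ^ j}. of_bool (X \<inter> cell j i \<noteq> {}))"
proof -
  have sep: "\<forall>\<^sub>F j in sequentially. \<lfloor>x * 2 ^ j\<rfloor> \<noteq> \<lfloor>y * 2 ^ j\<rfloor>" if "x \<noteq> y" for x y :: real
  proof -
    obtain N where N: "1 / \<bar>x - y\<bar> < 2 ^ N" using real_arch_pow[of 2 "1 / \<bar>x - y\<bar>"] by auto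
    have "\<lfloor>x * 2 ^ j\<rfloor> \<noteq> \<lfloor>y * 2 ^ j\<rfloor>" if "N \<le> j" for j
    proof
      assume eq: "\<lfloor>x * 2 ^ j\<rfloor> = \<lfloor>y * 2 ^ j\<rfloor>"
      have "1 / \<bar>x - y\<bar> < 2 ^ j" using N power_increasing[OF that, of "2::real"] by linarith
      then have "1 < \<bar>x - y\<bar> * 2 ^ j" using \<open>x \<noteq> y\<close> by (simp add: field_simps)
      then have "1 < \<bar>x * 2 ^ j - y * 2 ^ j\<bar>" by (simp add: abs_mult flip: left_diff_distrib)
      then show False using eq by linarith
    qed
    then show ?thesis unfolding eventually_sequentially by blast
  qed
  have "\<forall>\<^sub>F j in sequentially. \<forall>z\<in>{(x, y). x \<in> X \<and> y \<in> X \<and> x \<noteq> y}. \<lfloor>fst z * 2 ^ j\<rfloor> \<noteq> \<lfloor>snd z * 2 ^ j\<rfloor>"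
    using sep by (intro eventually_ball_finite) (auto intro: finite_subset[OF _ finite_cartesian_product[OF fin fin]])
  then show ?thesis
  proof eventually_elim
    case (elim j)
    let ?I = "{- int n * 2 ^ j .. int n * 2 ^ j}"
    have "inj_on (\<lambda>x. \<lfloor>x * 2 ^ j\<rfloor>) X" using elim by (auto simp: inj_on_def)
    then have "card X = card ((\<lambda>x. \<lfloor>x * 2 ^ j\<rfloor>) ` X)" by (simp add: card_image)
    also have "(\<lambda>x. \<lfloor>x * 2 ^ j\<rfloor>) ` X = {i \<in> ?I. X \<inter> cell j i \<noteq> {}}"
    proof -
      have "\<lfloor>x * 2 ^ j\<rfloor> \<in> ?I" if "x \<in> X" for x
      proof -
        have "- real n \<le> x" "x \<le> real n" using X that by force+
        then have "- real n * 2 ^ j \<le> x * 2 ^ j" "x * 2 ^ j \<le> real n * 2 ^ j"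
          by (intro mult_right_mono; simp)+
        moreover have "real_of_int (int n * 2 ^ j) = real n * 2 ^ j"
          "real_of_int (- int n * 2 ^ j) = - real n * 2 ^ j" by simp_all
        ultimately show ?thesis unfolding atLeastAtMost_iff le_floor_iff floor_le_iff by linarith
      qed
      then show ?thesis by (auto simp: cell_def)
    qed
    also have "card \<dots> = (\<Sum>i\<in>?I. of_bool (X \<inter> cell j i \<noteq> {}))"
      by (simp add: sum.If_cases of_bool_def Int_def)
    finally show ?case .
  qed
qed

lemma void_events_subset: "void_events n \<subseteq> sets (node_space n)"
proof
  fix y assume "y \<in> void_events n"
  then obtain B where B: "B \<in> sets (circle n)" "y = {X \<in> space (node_space n). X \<inter> B = {}}"
    by (auto simp: void_events_def)
  have "y = (\<lambda>X. card (X \<inter> B)) -` {0} \<inter> space (node_space n)"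
    unfolding B(2) by (auto simp: node_space_def space_point_configs)
  then show "y \<in> sets (node_space n)"
    using measurable_card_point_configs[OF B(1)] unfolding node_space_def by (auto intro: measurable_sets)
qed

text \<open>Renyi's observation: a finite configuration has as many points as it occupies cells of a fine
partition, so all counts are limits of functions of void events.\<close>

lemma sets_node_space_void: "sets (node_space n) = sigma_sets (space (node_space n)) (void_events n)"
proof
  show "sigma_sets (space (node_space n)) (void_events n) \<subseteq> sets (node_space n)"
    using void_events_subset by (intro sets.sigma_sets_subset)
next
  let ?N = "sigma (space (node_space n)) (void_events n)"
  have sub: "void_events n \<subseteq> Pow (space (node_space n))" by (auto simp: void_events_def)
  have spN: "space ?N = space (node_space n)" by (rule space_measure_of[OF sub])
  have setsN: "sets ?N = sigma_sets (space (node_space n)) (void_events n)" by (rule sets_measure_of[OF sub])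
  have "{X. finite X \<and> X \<subseteq> space (circle n) \<and> card (X \<inter> B) = k} \<in> sets ?N" if B: "B \<in> sets (circle n)" for B k
  proof -
    \<comment> \<open>The number of occupied cells of mesh \<open>1 / 2 ^ j\<close>.\<close>
    let ?F = "\<lambda>j X. \<Sum>i\<in>{- int n * 2 ^ j .. int n * 2 ^ j}. of_bool (X \<inter> B \<inter> cell j i \<noteq> {}) :: real"
    have "{X \<in> space ?N. X \<inter> B \<inter> cell j i = {}} \<in> sets ?N" for j i
    proof -
      have "B \<inter> cell j i \<in> sets (circle n)" using B cell_borel by (auto simp: sets_circle_iff)
      then have "{X \<in> space (node_space n). X \<inter> (B \<inter> cell j i) = {}} \<in> void_events n"
        unfolding void_events_def by blast
      then show ?thesis unfolding setsN spN by (auto simp: Int_assoc)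
    qed
    then have "Measurable.pred ?N (\<lambda>X. X \<inter> B \<inter> cell j i = {})" for j i by (simp add: pred_def)
    then have meas: "?F j \<in> borel_measurable ?N" for j
      unfolding of_bool_def by (intro borel_measurable_sum measurable_If) auto
    have "(\<lambda>X. real (card (X \<inter> B))) \<in> borel_measurable ?N"
    proof (rule borel_measurable_LIMSEQ_real[OF _ meas])
      fix X assume "X \<in> space ?N"
      then have X: "finite (X \<inter> B)" "X \<inter> B \<subseteq> {- real n / 2 <.. real n / 2}"
        unfolding spN using B by (auto simp: node_space_def space_point_configs sets_circle_iff)
      show "(\<lambda>j. ?F j X) \<longlonglongrightarrow> real (card (X \<inter> B))"
      proof (rule tendsto_eventually)
        show "\<forall>\<^sub>F j in sequentially. ?F j X = real (card (X \<inter> B))"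
          using card_eq_eventually_occupied_cells[OF X]
          by eventually_elim (simp add: of_nat_sum Int_assoc)
      qed
    qed
    then have "(\<lambda>X. real (card (X \<inter> B))) -` {real k} \<inter> space ?N \<in> sets ?N"
      by (rule measurable_sets) auto
    also have "(\<lambda>X. real (card (X \<inter> B))) -` {real k} \<inter> space ?N =
        {X. finite X \<and> X \<subseteq> space (circle n) \<and> card (X \<inter> B) = k}"
      unfolding spN by (auto simp: node_space_def space_point_configs)
    finally show ?thesis .
  qed
  then have "sigma_sets (space ?N) {{X. finite X \<and> X \<subseteq> space (circle n) \<and> card (X \<inter> B) = k} | B k. B \<in> sets (circle n)} \<subseteq> sets ?N"
    by (intro sets.sigma_sets_subset) auto
  then show "sets (node_space n) \<subseteq> sigma_sets (space (node_space n)) (void_events n)"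
    unfolding setsN[symmetric] spN by (simp add: node_space_def sets_point_configs space_point_configs)
qed

lemma Int_stable_void_events: "Int_stable (void_events n)"
proof (rule Int_stableI)
  fix a b assume "a \<in> void_events n" "b \<in> void_events n"
  then obtain A B where AB: "A \<in> sets (circle n)" "B \<in> sets (circle n)"
    "a = {X \<in> space (node_space n). X \<inter> A = {}}" "b = {X \<in> space (node_space n). X \<inter> B = {}}"
    unfolding void_events_def by blast
  have "a \<inter> b = {X \<in> space (node_space n). X \<inter> (A \<union> B) = {}}" unfolding AB by auto
  then show "a \<inter> b \<in> void_events n" using AB unfolding void_events_def by blast
qed

section \<open>Poisson nodes: independence and Laplace functional\<close>

lemma prod_group_by_value:
  fixes h :: "'a \<Rightarrow> real"
  assumes "finite (X \<inter> B)" "finite (range h)"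
  shows "(\<Prod>u\<in>X \<inter> B. h u) = (\<Prod>y\<in>range h. y ^ card (X \<inter> (B \<inter> h -` {y})))"
proof -
  have "(\<Prod>u\<in>X \<inter> B. h u) = (\<Prod>y\<in>range h. \<Prod>u\<in>{u \<in> X \<inter> B. h u = y}. h u)"
    using assms by (intro prod.group[symmetric]) auto
  also have "\<dots> = (\<Prod>y\<in>range h. y ^ card (X \<inter> (B \<inter> h -` {y})))"
  proof (intro prod.cong refl)
    fix y
    have eq: "{u \<in> X \<inter> B. h u = y} = X \<inter> (B \<inter> h -` {y})" by auto
    have "(\<Prod>u\<in>X \<inter> (B \<inter> h -` {y}). h u) = (\<Prod>u\<in>X \<inter> (B \<inter> h -` {y}). y)" by (intro prod.cong) auto
    then show "(\<Prod>u\<in>{u \<in> X \<inter> B. h u = y}. h u) = y ^ card (X \<inter> (B \<inter> h -` {y}))"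
      unfolding eq by simp
  qed
  finally show ?thesis .
qed

locale poisson_nodes = prob_space M for M :: "'w measure" +
  fixes n :: nat and lam :: real and V :: "'w \<Rightarrow> real set"
  assumes poisson: "poisson_process M n lam V" and lam_pos: "0 < lam"
begin

lemma V_measurable [measurable]: "V \<in> measurable M (node_space n)"
  using poisson by (simp add: poisson_process_def)

lemma V_space: "\<omega> \<in> space M \<Longrightarrow> finite (V \<omega>) \<and> V \<omega> \<subseteq> {- real n / 2 <.. real n / 2}"
  using measurable_space[OF V_measurable] by (auto simp: node_space_def space_point_configs space_circle)

lemma V_Int_measurable:
  assumes "B \<in> sets (circle n)"
  shows "(\<lambda>\<omega>. V \<omega> \<inter> B) \<in> measurable M (node_space n)"
  using measurable_compose[OF V_measurable measurable_Int_point_configs[OF assms, folded node_space_def]] .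

lemma count_measurable:
  assumes "B \<in> sets (circle n)"
  shows "(\<lambda>\<omega>. card (V \<omega> \<inter> B)) \<in> measurable M (count_space UNIV)"
  using measurable_compose[OF V_measurable measurable_card_point_configs[OF assms, folded node_space_def]] .

lemma prob_count:
  assumes "B \<in> sets (circle n)"
  shows "prob {\<omega> \<in> space M. card (V \<omega> \<inter> B) = k} =
    exp (- (lam * measure lborel B)) * (lam * measure lborel B) ^ k / fact k"
  using poisson assms by (simp add: poisson_process_def)

lemma prob_void:
  assumes "B \<in> sets (circle n)"
  shows "prob {\<omega> \<in> space M. V \<omega> \<inter> B = {}} = exp (- (lam * measure lborel B))"
proof -
  have "{\<omega> \<in> space M. V \<omega> \<inter> B = {}} = {\<omega> \<in> space M. card (V \<omega> \<inter> B) = 0}"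
    using V_space by auto
  then show ?thesis using prob_count[OF assms, of 0] by simp
qed

lemma emeasure_circle_finite: "B \<in> sets (circle n) \<Longrightarrow> emeasure lborel B < \<infinity>"
proof -
  assume "B \<in> sets (circle n)"
  then have "emeasure lborel B \<le> emeasure lborel {- real n / 2 <.. real n / 2}"
    by (intro emeasure_mono) (auto simp: sets_circle_iff)
  also have "\<dots> < \<infinity>" by simp
  finally show ?thesis .
qed

text \<open>It suffices to check void events. The void events of disjoint sets intersect in the void event of
the union, and the exponential turns the additivity of Lebesgue measure into a product.\<close>

lemma indep_nodes:
  fixes B :: "'i \<Rightarrow> real set"
  assumes fin: "finite I" and B: "\<And>i. i \<in> I \<Longrightarrow> B i \<in> sets (circle n)"
    and disj: "disjoint_family_on B I"
  shows "indep_vars (\<lambda>_. node_space n) (\<lambda>i \<omega>. V \<omega> \<inter> B i) I"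
proof (cases "I = {}")
  case True
  then show ?thesis by (simp add: indep_vars_def indep_sets_def)
next
  case False
  have "indep_vars (\<lambda>_. node_space n) (\<lambda>i \<omega>. V \<omega> \<inter> B i) I \<longleftrightarrow>
    (\<forall>A\<in>(\<Pi> i\<in>I. void_events n). prob (\<Inter>j\<in>I. (\<lambda>\<omega>. V \<omega> \<inter> B j) -` A j \<inter> space M) =
      (\<Prod>j\<in>I. prob ((\<lambda>\<omega>. V \<omega> \<inter> B j) -` A j \<inter> space M)))"
  proof (rule indep_vars_finite[OF False fin])
    fix i assume "i \<in> I"
    show "space (node_space n) \<in> void_events n"
      unfolding void_events_def by (auto intro!: exI[of _ "{}"])
    show "void_events n \<subseteq> Pow (space (node_space n))" by (auto simp: void_events_def)
    show "(\<lambda>\<omega>. V \<omega> \<inter> B i) \<in> measurable M (node_space n)" using B[OF \<open>i \<in> I\<close>] by (rule V_Int_measurable)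
  qed (rule sets_node_space_void Int_stable_void_events)+
  moreover have "prob (\<Inter>j\<in>I. (\<lambda>\<omega>. V \<omega> \<inter> B j) -` A j \<inter> space M) =
      (\<Prod>j\<in>I. prob ((\<lambda>\<omega>. V \<omega> \<inter> B j) -` A j \<inter> space M))" if A: "A \<in> (\<Pi> i\<in>I. void_events n)" for A
  proof -
    have "\<forall>i\<in>I. \<exists>C. C \<in> sets (circle n) \<and> A i = {X \<in> space (node_space n). X \<inter> C = {}}"
      using A unfolding void_events_def by blast
    then obtain C where C: "\<And>i. i \<in> I \<Longrightarrow> C i \<in> sets (circle n)"
      "\<And>i. i \<in> I \<Longrightarrow> A i = {X \<in> space (node_space n). X \<inter> C i = {}}" by metis
    let ?D = "\<lambda>i. B i \<inter> C i"
    have D: "?D i \<in> sets (circle n)" if "i \<in> I" for i using B C that by auto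
    have ev: "(\<lambda>\<omega>. V \<omega> \<inter> B i) -` A i \<inter> space M = {\<omega> \<in> space M. V \<omega> \<inter> ?D i = {}}" if "i \<in> I" for i
      using C(2)[OF that] V_space by (auto simp: node_space_def space_point_configs space_circle)
    have "(\<Inter>j\<in>I. (\<lambda>\<omega>. V \<omega> \<inter> B j) -` A j \<inter> space M) = {\<omega> \<in> space M. V \<omega> \<inter> (\<Union>i\<in>I. ?D i) = {}}"
      using ev False by auto
    also have "prob \<dots> = exp (- (lam * measure lborel (\<Union>i\<in>I. ?D i)))"
      using D fin by (intro prob_void sets.finite_UN) auto
    also have "measure lborel (\<Union>i\<in>I. ?D i) = (\<Sum>i\<in>I. measure lborel (?D i))"
    proof (rule measure_finite_Union[OF fin])
      show "?D ` I \<subseteq> sets lborel" using D by (auto simp: sets_circle_iff)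
      show "disjoint_family_on ?D I" using disj by (auto simp: disjoint_family_on_def)
      show "emeasure lborel (?D i) \<noteq> \<infinity>" if "i \<in> I" for i using emeasure_circle_finite[OF D[OF that]] by simp
    qed
    also have "exp (- (lam * (\<Sum>i\<in>I. measure lborel (?D i)))) = (\<Prod>i\<in>I. exp (- (lam * measure lborel (?D i))))"
      using fin by (simp add: sum_distrib_left exp_sum flip: sum_negf)
    also have "\<dots> = (\<Prod>j\<in>I. prob ((\<lambda>\<omega>. V \<omega> \<inter> B j) -` A j \<inter> space M))"
      using ev D by (intro prod.cong refl) (simp add: prob_void)
    finally show ?thesis .
  qed
  ultimately show ?thesis by blast
qed

lemma expectation_prod_nodes:
  fixes B :: "'i \<Rightarrow> real set" and F :: "'i \<Rightarrow> real set \<Rightarrow> real"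
  assumes fin: "finite I" and B: "\<And>i. i \<in> I \<Longrightarrow> B i \<in> sets (circle n)"
    and disj: "disjoint_family_on B I"
    and F: "\<And>i. i \<in> I \<Longrightarrow> F i \<in> borel_measurable (node_space n)"
    and F01: "\<And>i X. i \<in> I \<Longrightarrow> \<bar>F i X\<bar> \<le> 1"
  shows "expectation (\<lambda>\<omega>. \<Prod>i\<in>I. F i (V \<omega> \<inter> B i)) = (\<Prod>i\<in>I. expectation (\<lambda>\<omega>. F i (V \<omega> \<inter> B i)))"
proof (rule indep_vars_lebesgue_integral[OF fin])
  show "indep_vars (\<lambda>_. borel) (\<lambda>i \<omega>. F i (V \<omega> \<inter> B i)) I"
    using indep_vars_compose2[OF indep_nodes[OF fin B disj] F] .
  show "integrable M (\<lambda>\<omega>. F i (V \<omega> \<inter> B i))" if "i \<in> I" for i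
    using F01[OF that] measurable_compose[OF V_Int_measurable[OF B[OF that]] F[OF that]]
    by (intro integrable_const_bound[where B = 1]) auto
qed

lemma nn_integral_power_count:
  assumes B: "B \<in> sets (circle n)" and y: "0 \<le> y"
  shows "(\<integral>\<^sup>+\<omega>. ennreal (y ^ card (V \<omega> \<inter> B)) \<partial>M) = ennreal (exp (lam * (measure lborel B * (y - 1))))"
proof -
  let ?r = "lam * measure lborel B"
  have r: "0 \<le> ?r" using lam_pos by simp
  let ?E = "\<lambda>k. {\<omega> \<in> space M. card (V \<omega> \<inter> B) = k}"
  have E: "?E k \<in> sets M" for k
  proof -
    have "?E k = (\<lambda>\<omega>. card (V \<omega> \<inter> B)) -` {k} \<inter> space M" by auto
    then show ?thesis using count_measurable[OF B] by (auto intro: measurable_sets)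
  qed
  have "(\<integral>\<^sup>+\<omega>. ennreal (y ^ card (V \<omega> \<inter> B)) \<partial>M) = (\<integral>\<^sup>+\<omega>. (\<Sum>k. ennreal (y ^ k) * indicator (?E k) \<omega>) \<partial>M)"
  proof (intro nn_integral_cong)
    fix \<omega> assume "\<omega> \<in> space M"
    then have "(\<Sum>k. ennreal (y ^ k) * indicator (?E k) \<omega>) = (\<Sum>k\<in>{card (V \<omega> \<inter> B)}. ennreal (y ^ k) * indicator (?E k) \<omega>)"
      by (intro suminf_finite) auto
    then show "ennreal (y ^ card (V \<omega> \<inter> B)) = (\<Sum>k. ennreal (y ^ k) * indicator (?E k) \<omega>)"
      using \<open>\<omega> \<in> space M\<close> by simp
  qed
  also have "\<dots> = (\<Sum>k. \<integral>\<^sup>+\<omega>. ennreal (y ^ k) * indicator (?E k) \<omega> \<partial>M)"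
    using E by (intro nn_integral_suminf) auto
  also have "\<dots> = (\<Sum>k. ennreal (y ^ k * (exp (- ?r) * ?r ^ k / fact k)))"
    using E y by (intro suminf_cong)
      (simp add: nn_integral_cmult_indicator emeasure_eq_measure prob_count[OF B] flip: ennreal_mult')
  also have "\<dots> = (\<Sum>k. ennreal (exp (- ?r) * ((?r * y) ^ k /\<^sub>R fact k)))"
    by (intro suminf_cong) (simp add: power_mult_distrib field_simps)
  also have "\<dots> = ennreal (exp (- ?r) * exp (?r * y))"
    using r y by (intro suminf_ennreal_eq sums_mult exp_converges) auto
  also have "exp (- ?r) * exp (?r * y) = exp (lam * (measure lborel B * (y - 1)))"
    by (simp flip: exp_add add: algebra_simps)
  finally show ?thesis .
qed

text \<open>A simple function splits \<open>B\<close> into finitely many level sets, whose counts are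
independent Poisson variables.\<close>

lemma laplace_simple:
  assumes B: "B \<in> sets (circle n)" and h: "simple_function borel h" and h0: "\<And>x. 0 \<le> (h x :: real)"
  shows "(\<integral>\<^sup>+\<omega>. ennreal (\<Prod>u\<in>V \<omega> \<inter> B. h u) \<partial>M) =
    ennreal (exp (lam * (LINT x|lborel. indicator B x * (h x - 1))))"
proof -
  let ?Y = "range h"
  let ?B = "\<lambda>y. B \<inter> h -` {y}"
  have fin: "finite ?Y" using simple_functionD(1)[OF h] by simp
  have hB: "?B y \<in> sets (circle n)" for y
    using B simple_functionD(2)[OF h, of "{y}"] by (auto simp: sets_circle_iff)
  have disj: "disjoint_family_on ?B ?Y" by (auto simp: disjoint_family_on_def)
  have "(\<integral>\<^sup>+\<omega>. ennreal (\<Prod>u\<in>V \<omega> \<inter> B. h u) \<partial>M) = (\<integral>\<^sup>+\<omega>. (\<Prod>y\<in>?Y. ennreal (y ^ card (V \<omega> \<inter> ?B y))) \<partial>M)"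
  proof (intro nn_integral_cong)
    fix \<omega> assume "\<omega> \<in> space M"
    then have "finite (V \<omega> \<inter> B)" using V_space by auto
    then have "(\<Prod>u\<in>V \<omega> \<inter> B. h u) = (\<Prod>y\<in>?Y. y ^ card (V \<omega> \<inter> ?B y))"
      using fin by (rule prod_group_by_value)
    then show "ennreal (\<Prod>u\<in>V \<omega> \<inter> B. h u) = (\<Prod>y\<in>?Y. ennreal (y ^ card (V \<omega> \<inter> ?B y)))"
      using h0 by (subst prod_ennreal) auto
  qed
  also have "\<dots> = (\<Prod>y\<in>?Y. \<integral>\<^sup>+\<omega>. ennreal (y ^ card (V \<omega> \<inter> ?B y)) \<partial>M)"
  proof (rule indep_vars_nn_integral[OF fin])
    have "(\<lambda>X. ennreal (y ^ card X)) \<in> borel_measurable (node_space n)" for y :: real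
      by (rule measurable_compose[OF measurable_card_node_space]) simp
    then show "indep_vars (\<lambda>_. borel) (\<lambda>y \<omega>. ennreal (y ^ card (V \<omega> \<inter> ?B y))) ?Y"
      by (intro indep_vars_compose2[OF indep_nodes[OF fin hB disj]])
  qed auto
  also have "\<dots> = (\<Prod>y\<in>?Y. ennreal (exp (lam * (measure lborel (?B y) * (y - 1)))))"
    using h0 by (intro prod.cong refl nn_integral_power_count hB) auto
  also have "\<dots> = ennreal (exp (lam * (\<Sum>y\<in>?Y. measure lborel (?B y) * (y - 1))))"
    using fin by (simp add: prod_ennreal exp_sum sum_distrib_left)
  also have "(\<Sum>y\<in>?Y. measure lborel (?B y) * (y - 1)) = (LINT x|lborel. indicator B x * (h x - 1))"
  proof -
    have "indicator B x * (h x - 1) = (\<Sum>y\<in>?Y. (y - 1) * indicator (?B y) x)" for x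
    proof -
      have "(\<Sum>y\<in>?Y. (y - 1) * indicator (?B y) x) = (\<Sum>y\<in>?Y. if h x = y then (y - 1) * indicator B x else 0)"
        by (intro sum.cong) (auto simp: indicator_def)
      also have "\<dots> = (h x - 1) * indicator B x" using fin by (subst sum.delta') auto
      finally show ?thesis by simp
    qed
    moreover have "integrable lborel (\<lambda>x. (y - 1) * indicator (?B y) x :: real)" for y
      using hB[of y] emeasure_circle_finite[OF hB[of y]] by (intro integrable_mult_right integrable_real_indicator) (auto simp: sets_circle_iff)
    moreover have "(LINT x|lborel. (y - 1) * indicator (?B y) x) = measure lborel (?B y) * (y - 1)" for y
      using hB[of y] emeasure_circle_finite[OF hB[of y]] by (simp add: sets_circle_iff)
    ultimately show ?thesis by (simp add: mult.commute)
  qed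
  finally show ?thesis .
qed

end

text \<open>The monotone limit of the case of simple functions.\<close>

lemma (in poisson_nodes) laplace_functional:
  assumes B: "B \<in> sets (circle n)" and g: "g \<in> borel_measurable borel"
    and g0: "\<And>x. 0 \<le> (g x :: real)" and gc: "\<And>x. g x \<le> c"
  shows "(\<integral>\<^sup>+\<omega>. ennreal (\<Prod>u\<in>V \<omega> \<inter> B. g u) \<partial>M) =
    ennreal (exp (lam * (LINT x|lborel. indicator B x * (g x - 1))))"
proof -
  obtain F where F: "\<And>i. simple_function borel (F i)" "incseq F" "\<And>i x. F i x < top"
     "\<And>x. (SUP i. F i x) = ennreal (g x)"
    using borel_measurable_implies_simple_function_sequence'[of "\<lambda>x. ennreal (g x)" borel] g by auto
  define h where "h i x = enn2real (F i x)" for i x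
  have h: "simple_function borel (h i)" for i
    using simple_function_compose1[OF F(1), of enn2real i] by (simp add: h_def[abs_def] o_def)
  have h0: "0 \<le> h i x" for i x by (simp add: h_def)
  have Fh: "F i x = ennreal (h i x)" for i x using F(3)[of i x] by (simp add: h_def)
  have incF: "incseq (\<lambda>i. F i x)" for x using F(2) by (auto simp: incseq_def le_fun_def)
  have hinc: "h i x \<le> h j x" if "i \<le> j" for i j x
    using incF[of x] that h0 by (auto simp: incseq_def Fh)
  have hg: "h i x \<le> g x" for i x
  proof -
    have "F i x \<le> (SUP i. F i x)" by (intro SUP_upper) auto
    then have "ennreal (h i x) \<le> ennreal (g x)" unfolding F(4) by (simp add: Fh)
    then show ?thesis using g0 by simp
  qed
  have lim: "(\<lambda>i. h i x) \<longlonglongrightarrow> g x" for x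
  proof -
    have "(\<lambda>i. F i x) \<longlonglongrightarrow> ennreal (g x)" using LIMSEQ_SUP[OF incF[of x]] F(4) by simp
    then show ?thesis using g0 h0 by (simp add: Fh tendsto_ennreal_iff)
  qed
  have fin: "finite (V \<omega> \<inter> B)" if "\<omega> \<in> space M" for \<omega> using V_space that by auto
  let ?P = "\<lambda>h \<omega>. if \<omega> \<in> space M then ennreal (\<Prod>u\<in>V \<omega> \<inter> B. h u) else 0"
  have P: "(\<integral>\<^sup>+\<omega>. ennreal (\<Prod>u\<in>V \<omega> \<inter> B. h u) \<partial>M) = (\<integral>\<^sup>+\<omega>. ?P h \<omega> \<partial>M)" for h
    by (intro nn_integral_cong) auto
  have "(\<lambda>i. \<integral>\<^sup>+\<omega>. ?P (h i) \<omega> \<partial>M) \<longlonglongrightarrow> (\<integral>\<^sup>+\<omega>. ?P g \<omega> \<partial>M)"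
  proof (rule nn_integral_LIMSEQ)
    show "incseq (\<lambda>i \<omega>. ?P (h i) \<omega>)"
      unfolding incseq_def le_fun_def by (auto intro!: ennreal_leI prod_mono h0 hinc)
    show "(\<lambda>i. ?P (h i) \<omega>) \<longlonglongrightarrow> ?P g \<omega>" for \<omega>
      using lim by (auto intro!: tendsto_ennrealI tendsto_prod)
    show "?P (h i) \<in> borel_measurable M" for i
    proof -
      let ?Y = "range (h i)"
      have finY: "finite ?Y" using simple_functionD(1)[OF h] by simp
      have hB: "B \<inter> h i -` {y} \<in> sets (circle n)" for y
        using B simple_functionD(2)[OF h, of i "{y}"] by (auto simp: sets_circle_iff)
      have "(\<lambda>\<omega>. \<Prod>y\<in>?Y. y ^ card (V \<omega> \<inter> (B \<inter> h i -` {y}))) \<in> borel_measurable M"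
        by (intro borel_measurable_prod measurable_compose[OF count_measurable[OF hB]]) simp
      then have m: "(\<lambda>\<omega>. ennreal (\<Prod>y\<in>?Y. y ^ card (V \<omega> \<inter> (B \<inter> h i -` {y})))) \<in> borel_measurable M"
        by measurable
      have "ennreal (\<Prod>y\<in>?Y. y ^ card (V \<omega> \<inter> (B \<inter> h i -` {y}))) = ?P (h i) \<omega>" if "\<omega> \<in> space M" for \<omega>
        using prod_group_by_value[OF fin[OF that] finY] that by simp
      then show ?thesis using m by (rule measurable_cong[THEN iffD1])
    qed
  qed
  moreover have "(\<lambda>i. \<integral>\<^sup>+\<omega>. ?P (h i) \<omega> \<partial>M) =
      (\<lambda>i. ennreal (exp (lam * (LINT x|lborel. indicator B x * (h i x - 1)))))"
    unfolding P[symmetric] by (intro ext laplace_simple B h h0)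
  moreover have "(\<lambda>i. ennreal (exp (lam * (LINT x|lborel. indicator B x * (h i x - 1)))))
     \<longlonglongrightarrow> ennreal (exp (lam * (LINT x|lborel. indicator B x * (g x - 1))))"
  proof (intro tendsto_ennrealI tendsto_exp tendsto_mult tendsto_const)
    have hm: "h i \<in> borel_measurable borel" for i using h borel_measurable_simple_function by blast
    have Bm: "B \<in> sets borel" using B by (simp add: sets_circle_iff)
    show "(\<lambda>i. LINT x|lborel. indicator B x * (h i x - 1)) \<longlonglongrightarrow> (LINT x|lborel. indicator B x * (g x - 1))"
    proof (rule integral_dominated_convergence)
      show "integrable lborel (\<lambda>x. indicator B x * (c + 1))"
        using Bm emeasure_circle_finite[OF B] by (intro integrable_mult_left integrable_real_indicator) auto
      show "AE x in lborel. (\<lambda>i. indicator B x * (h i x - 1)) \<longlonglongrightarrow> indicator B x * (g x - 1)"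
        by (intro AE_I2 tendsto_intros lim)
      show "AE x in lborel. norm (indicator B x * (h i x - 1)) \<le> indicator B x * (c + 1)" for i
      proof (intro AE_I2)
        fix x show "norm (indicator B x * (h i x - 1)) \<le> indicator B x * (c + 1)"
          using h0[of i x] hg[of i x] gc[of x] by (auto simp: indicator_def abs_if)
      qed
    qed (use hm g Bm in measurable)
  qed
  ultimately show ?thesis unfolding P by (auto intro: LIMSEQ_unique)
qed

text \<open>The normalised counting measure makes sums over a configuration into integrals against a probability
kernel. For the empty configuration its value is arbitrary, and sums are recovered by the factor
\<open>card X\<close>, which is then 0.\<close>

definition uniform_on :: "real set \<Rightarrow> real measure" where
  "uniform_on X = distr (measure_pmf (pmf_of_set X)) borel (\<lambda>x. x)"

lemma measurable_uniform_on: "uniform_on \<in> measurable (node_space n) (subprob_algebra borel)"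
proof (rule measurable_subprob_algebra)
  fix X show "subprob_space (uniform_on X)"
    unfolding uniform_on_def by (intro prob_space_imp_subprob_space measure_pmf.prob_space_distr) simp
next
  fix B :: "real set" assume B: "B \<in> sets borel"
  let ?C = "B \<inter> space (circle n)"
  have C: "?C \<in> sets (circle n)"
    using B by (auto simp: sets_circle_iff space_circle)
  have "(\<lambda>X. card (X \<inter> ?C)) \<in> measurable (node_space n) (count_space UNIV)"
    using C unfolding node_space_def by (rule measurable_card_point_configs)
  then have "(\<lambda>X. if card X = 0 then emeasure (uniform_on {}) B
      else ennreal (real (card (X \<inter> ?C)) / real (card X))) \<in> borel_measurable (node_space n)"
    using measurable_card_node_space[of n] by measurable
  then show "(\<lambda>X. emeasure (uniform_on X) B) \<in> borel_measurable (node_space n)"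
  proof (rule measurable_cong[THEN iffD1, rotated])
    fix X assume "X \<in> space (node_space n)"
    then have X: "finite X" "X \<inter> ?C = X \<inter> B" by (auto simp: node_space_def space_point_configs)
    show "(if card X = 0 then emeasure (uniform_on {}) B
      else ennreal (real (card (X \<inter> ?C)) / real (card X))) = emeasure (uniform_on X) B"
      unfolding X(2) using X(1) B
      by (auto simp: uniform_on_def emeasure_distr emeasure_pmf_of_set)
  qed
qed (simp_all add: uniform_on_def)

lemma measurable_sum_nodes:
  fixes f :: "'a \<Rightarrow> real \<Rightarrow> ennreal"
  assumes f: "(\<lambda>(y, u). f y u) \<in> borel_measurable (N \<Otimes>\<^sub>M borel)"
  shows "(\<lambda>(y, X). \<Sum>u\<in>X. f y u) \<in> borel_measurable (N \<Otimes>\<^sub>M node_space n)"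
proof -
  have L: "(\<lambda>z. uniform_on (snd z)) \<in> measurable (N \<Otimes>\<^sub>M node_space n) (subprob_algebra borel)"
    by (rule measurable_compose[OF measurable_snd measurable_uniform_on])
  have "(\<lambda>(z, u). f (fst z) u) \<in> borel_measurable ((N \<Otimes>\<^sub>M node_space n) \<Otimes>\<^sub>M borel)"
  proof -
    have "(\<lambda>w. (\<lambda>(y, u). f y u) (fst (fst w), snd w)) \<in> borel_measurable ((N \<Otimes>\<^sub>M node_space n) \<Otimes>\<^sub>M borel)"
      by (rule measurable_compose[OF _ f]) measurable
    then show ?thesis by (simp add: case_prod_unfold)
  qed
  from nn_integral_measurable_subprob_algebra2[OF this L]
  have I: "(\<lambda>z. \<integral>\<^sup>+u. f (fst z) u \<partial>uniform_on (snd z)) \<in> borel_measurable (N \<Otimes>\<^sub>M node_space n)" .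
  have "(\<lambda>z. of_nat (card (snd z)) * (\<integral>\<^sup>+u. f (fst z) u \<partial>uniform_on (snd z)))
      \<in> borel_measurable (N \<Otimes>\<^sub>M node_space n)"
  proof (intro borel_measurable_times_ennreal I)
    show "(\<lambda>z. of_nat (card (snd z))) \<in> borel_measurable (N \<Otimes>\<^sub>M node_space n)"
      by (rule measurable_compose[OF measurable_compose[OF measurable_snd measurable_card_node_space]]) simp
  qed
  then show ?thesis
  proof (rule measurable_cong[THEN iffD1, rotated])
    fix z assume z: "z \<in> space (N \<Otimes>\<^sub>M node_space n)"
    obtain y X where yX: "z = (y, X)" "y \<in> space N" "X \<in> space (node_space n)" using z by (auto simp: space_pair_measure)
    then have X: "finite X" by (auto simp: node_space_def space_point_configs)
    have fm: "f y \<in> borel_measurable borel"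
      using measurable_Pair2[OF f yX(2)] by simp
    have "of_nat (card X) * (\<integral>\<^sup>+u. f y u \<partial>uniform_on X) = (\<Sum>u\<in>X. f y u)"
    proof (cases "X = {}")
      case False
      have "(\<integral>\<^sup>+u. f y u \<partial>uniform_on X) = (\<integral>\<^sup>+u. f y u \<partial>pmf_of_set X)"
        unfolding uniform_on_def using fm by (subst nn_integral_distr) auto
      also have "\<dots> = (\<Sum>u\<in>X. f y u) / of_nat (card X)"
        using False X by (simp add: nn_integral_pmf_of_set ennreal_of_nat_eq_real_of_nat)
      finally show ?thesis using False X
        by (simp add: ennreal_times_divide) (metis card_eq_0_iff ennreal_mult_divide_eq ennreal_of_nat_neq_top mult.commute of_nat_eq_0_iff)
    qed simp
    then show "of_nat (card (snd z)) * (\<integral>\<^sup>+u. f (fst z) u \<partial>uniform_on (snd z)) =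
      (case z of (y, X) \<Rightarrow> \<Sum>u\<in>X. f y u)" by (simp add: yX)
  qed
qed

text \<open>A product of numbers in \<open>(0, 1]\<close> is the exponential of a sum of nonpositive terms,
which reduces products to sums.\<close>

lemma measurable_prod_nodes:
  fixes f :: "'a \<Rightarrow> real \<Rightarrow> real"
  assumes f: "(\<lambda>(y, u). f y u) \<in> borel_measurable (N \<Otimes>\<^sub>M borel)"
    and f01: "\<And>y u. 0 < f y u" "\<And>y u. f y u \<le> 1"
  shows "(\<lambda>(y, X). \<Prod>u\<in>X. f y u) \<in> borel_measurable (N \<Otimes>\<^sub>M node_space n)"
proof -
  have "(\<lambda>(y, u). ennreal (- ln (f y u))) \<in> borel_measurable (N \<Otimes>\<^sub>M borel)"
    using f by (simp add: case_prod_unfold)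
  from measurable_sum_nodes[OF this]
  have "(\<lambda>z. exp (- enn2real (case z of (y, X) \<Rightarrow> \<Sum>u\<in>X. ennreal (- ln (f y u))))) \<in> borel_measurable (N \<Otimes>\<^sub>M node_space n)"
    by measurable
  then show ?thesis
  proof (rule measurable_cong[THEN iffD1, rotated])
    fix z assume "z \<in> space (N \<Otimes>\<^sub>M node_space n)"
    then obtain y X where yX: "z = (y, X)" "finite X"
      by (auto simp: space_pair_measure node_space_def space_point_configs)
    have ln0: "0 \<le> - ln (f y u)" for u using f01[of y u] by simp
    have "(\<Sum>u\<in>X. ennreal (- ln (f y u))) = ennreal (\<Sum>u\<in>X. - ln (f y u))"
      using ln0 by (intro sum_ennreal) auto
    then have "exp (- enn2real (\<Sum>u\<in>X. ennreal (- ln (f y u)))) = exp (\<Sum>u\<in>X. ln (f y u))"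
      using ln0 sum_nonneg[of X "\<lambda>u. - ln (f y u)"] by (simp add: sum_negf)
    also have "\<dots> = (\<Prod>u\<in>X. f y u)" using f01(1) yX(2) by (simp add: exp_sum)
    finally show "exp (- enn2real (case z of (y, X) \<Rightarrow> \<Sum>u\<in>X. ennreal (- ln (f y u)))) = (case z of (y, X) \<Rightarrow> \<Prod>u\<in>X. f y u)"
      by (simp add: yX)
  qed
qed

section \<open>Expected error at a lone node\<close>

lemma flip_bound_nonneg: "0 \<le> flip_bound p q t d N h"
  by (simp add: flip_bound_def)

lemma flip_bound_le_half:
  assumes "0 < p" "p < 1" "0 < q" "q < 1" "0 \<le> d" "\<And>u. u \<in> N \<Longrightarrow> 0 \<le> h u \<and> h u \<le> 1"
  shows "flip_bound p q t d N h \<le> 1 / 2"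
proof -
  have a: "0 \<le> affinity p q (h u)" "affinity p q (h u) \<le> 1" if "u \<in> N" for u
    using assms that affinity_ge[of p q "h u"] affinity_le_1[of p q "h u"] by auto
  have A: "(\<Prod>u\<in>N. affinity p q (h u)) \<le> 1" using a by (intro prod_le_1) auto
  have B: "0 \<le> (\<Prod>u\<in>N. cosh (t * llr_max p q) * affinity p q (h u))"
    using a by (intro prod_nonneg ballI mult_nonneg_nonneg) auto
  have "(\<Prod>u\<in>N. affinity p q (h u)) - 2 * exp (- (2 * t * d)) * (\<Prod>u\<in>N. cosh (t * llr_max p q) * affinity p q (h u)) \<le> 1"
    using A mult_nonneg_nonneg[OF _ B, of "2 * exp (- (2 * t * d))"] by simp
  then have "exp (- d) / 2 * ((\<Prod>u\<in>N. affinity p q (h u)) - 2 * exp (- (2 * t * d)) * (\<Prod>u\<in>N. cosh (t * llr_max p q) * affinity p q (h u))) \<le> exp (- d) / 2 * 1"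
    by (intro mult_left_mono) auto
  also have "\<dots> \<le> 1 / 2" using assms by simp
  finally show ?thesis by (simp add: flip_bound_def)
qed

lemma affinity_measurable [measurable]:
  assumes [measurable]: "h \<in> borel_measurable N"
  shows "(\<lambda>x. affinity p q (h x)) \<in> borel_measurable N"
  unfolding affinity_def by measurable

text \<open>Both products in the bound have explicit expectations by the Laplace functional. The factor
\<open>cosh\<close> per node raises the exponent by at most \<open>lam * (cosh - 1)\<close> times
the length of \<open>R\<close>.\<close>

lemma (in poisson_nodes) nn_integral_flip_bound_ge:
  assumes R: "R \<in> sets (circle n)" and h: "h \<in> borel_measurable borel"
    and h01: "\<And>x. 0 \<le> h x" "\<And>x. h x \<le> (1::real)"
    and pq: "0 < p" "p < 1" "0 < q" "q < 1"
    and S: "(LINT x|lborel. indicator R x * (1 - affinity p q (h x))) \<le> S"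
  shows "ennreal (exp (- d) / 2 * exp (- (lam * S)) *
      (1 - 2 * exp (- (2 * t * d)) * exp (lam * ((cosh (t * llr_max p q) - 1) * measure lborel R))))
     \<le> (\<integral>\<^sup>+\<omega>. ennreal (flip_bound p q t d (V \<omega> \<inter> R) h) \<partial>M)"
proof -
  define c where "c = cosh (t * llr_max p q)"
  define D where "D = exp (- d) / 2"
  \<comment> \<open>The bound has the form \<open>max 0 (D * A - D' * B)\<close> with two products \<open>A\<close> and \<open>B\<close> over the nodes.\<close>
  define D' where "D' = exp (- d) * exp (- (2 * t * d))"
  define a where "a x = affinity p q (h x)" for x
  define A where "A \<omega> = (\<Prod>u\<in>V \<omega> \<inter> R. a u)" for \<omega>
  define B where "B \<omega> = (\<Prod>u\<in>V \<omega> \<inter> R. c * a u)" for \<omega>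
  define IA where "IA = (LINT x|lborel. indicator R x * (a x - 1))"
  define IB where "IB = (LINT x|lborel. indicator R x * (c * a x - 1))"
  have c1: "1 \<le> c" by (simp add: c_def cosh_real_ge_1)
  have a0: "0 < a x" "a x \<le> 1" for x
    unfolding a_def using affinity_ge[OF pq h01] affinity_le_1[OF pq h01] by auto
  have am: "a \<in> borel_measurable borel" unfolding a_def using h by measurable
  have EA: "(\<integral>\<^sup>+\<omega>. ennreal (A \<omega>) \<partial>M) = ennreal (exp (lam * IA))"
    unfolding A_def IA_def using a0 less_imp_le by (intro laplace_functional[OF R am, where c = 1]) auto
  have EB: "(\<integral>\<^sup>+\<omega>. ennreal (B \<omega>) \<partial>M) = ennreal (exp (lam * IB))"
    unfolding B_def IB_def using a0 c1 am
    by (intro laplace_functional[OF R, where c = c]) (auto intro!: mult_left_le mult_nonneg_nonneg less_imp_le[OF a0(1)])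
  have Rm: "R \<in> sets borel" using R by (simp add: sets_circle_iff)
  have intR: "integrable lborel (indicator R :: real \<Rightarrow> real)"
    using Rm emeasure_circle_finite[OF R] by (intro integrable_real_indicator) auto
  have intg: "integrable lborel (\<lambda>x. indicator R x * (k * a x - 1))" if "1 \<le> k" for k
  proof (rule Bochner_Integration.integrable_bound)
    show "integrable lborel (\<lambda>x. (k + 1) * indicator R x)" using intR by simp
    show "AE x in lborel. norm (indicator R x * (k * a x - 1)) \<le> norm ((k + 1) * indicator R x)"
    proof (intro AE_I2)
      fix x
      have "0 \<le> k * a x" "k * a x \<le> k" using a0[of x] that by (auto intro!: mult_left_le)
      then have "\<bar>k * a x - 1\<bar> \<le> \<bar>k + 1\<bar>" using that by linarith
      then show "norm (indicator R x * (k * a x - 1)) \<le> norm ((k + 1) * indicator R x)"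
        by (simp add: indicator_def)
    qed
  qed (use am Rm in measurable)
  have IAS: "- S \<le> IA"
  proof -
    have "IA = - (LINT x|lborel. indicator R x * (1 - affinity p q (h x)))"
      unfolding IA_def a_def by (subst Bochner_Integration.integral_minus[symmetric]) (simp add: algebra_simps)
    then show ?thesis using S by simp
  qed
  have IBA: "IB \<le> IA + (c - 1) * measure lborel R"
  proof -
    have "IB \<le> (LINT x|lborel. indicator R x * (1 * a x - 1) + (c - 1) * indicator R x)"
      unfolding IB_def
    proof (rule integral_mono)
      show "indicator R x * (c * a x - 1) \<le> indicator R x * (1 * a x - 1) + (c - 1) * indicator R x" for x
      proof -
        have "(c - 1) * a x \<le> c - 1" using a0[of x] c1 by (intro mult_left_le) auto
        then show ?thesis by (auto simp: indicator_def algebra_simps)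
      qed
    qed (use intg[of c] intg[of 1] intR c1 in auto)
    also have "\<dots> = IA + (c - 1) * measure lborel R"
      using intg[of 1] intR Rm unfolding IA_def by (subst Bochner_Integration.integral_add) (auto simp: emeasure_circle_finite[OF R])
    finally show ?thesis .
  qed
  have mA: "(\<lambda>\<omega>. ennreal (A \<omega>)) \<in> borel_measurable M" "(\<lambda>\<omega>. ennreal (B \<omega>)) \<in> borel_measurable M"
  proof -
    have "(\<lambda>(y::unit, X). \<Prod>u\<in>X. a u) \<in> borel_measurable (count_space UNIV \<Otimes>\<^sub>M node_space n)"
      using am a0 by (intro measurable_prod_nodes) auto
    from measurable_compose[OF measurable_Pair[OF _ V_Int_measurable[OF R]] this, of "\<lambda>_. ()"]
    have mA: "A \<in> borel_measurable M" by (simp add: A_def[abs_def])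
    have "B = (\<lambda>\<omega>. c ^ card (V \<omega> \<inter> R) * A \<omega>)"
      by (simp add: A_def[abs_def] B_def[abs_def] prod.distrib)
    moreover have "(\<lambda>\<omega>. c ^ card (V \<omega> \<inter> R)) \<in> borel_measurable M"
      by (rule measurable_compose[OF count_measurable[OF R]]) simp
    ultimately have "B \<in> borel_measurable M" using mA by simp
    with mA show "(\<lambda>\<omega>. ennreal (A \<omega>)) \<in> borel_measurable M" "(\<lambda>\<omega>. ennreal (B \<omega>)) \<in> borel_measurable M" by auto
  qed
  have AB0: "0 \<le> A \<omega>" "0 \<le> B \<omega>" for \<omega>
    unfolding A_def B_def using a0 c1 by (auto intro!: prod_nonneg mult_nonneg_nonneg simp: less_imp_le)
  have fl: "flip_bound p q t d (V \<omega> \<inter> R) h = max 0 (D * A \<omega> - D' * B \<omega>)" for \<omega>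
    unfolding flip_bound_def A_def B_def a_def c_def D_def D'_def by (simp add: algebra_simps)
  have DD: "0 \<le> D" "0 \<le> D'" by (auto simp: D_def D'_def)
  have "ennreal D * ennreal (exp (lam * IA)) = (\<integral>\<^sup>+\<omega>. ennreal D * ennreal (A \<omega>) \<partial>M)"
    using mA by (simp add: nn_integral_cmult EA)
  also have "\<dots> \<le> (\<integral>\<^sup>+\<omega>. ennreal (flip_bound p q t d (V \<omega> \<inter> R) h) + ennreal D' * ennreal (B \<omega>) \<partial>M)"
  proof (intro nn_integral_mono)
    fix \<omega>
    have "D * A \<omega> \<le> flip_bound p q t d (V \<omega> \<inter> R) h + D' * B \<omega>" unfolding fl by (auto simp: max_def)
    then show "ennreal D * ennreal (A \<omega>) \<le> ennreal (flip_bound p q t d (V \<omega> \<inter> R) h) + ennreal D' * ennreal (B \<omega>)"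
      using AB0 DD flip_bound_nonneg by (simp flip: ennreal_mult ennreal_plus add: ennreal_leI)
  qed
  also have "\<dots> = (\<integral>\<^sup>+\<omega>. ennreal (flip_bound p q t d (V \<omega> \<inter> R) h) \<partial>M) + ennreal D' * ennreal (exp (lam * IB))"
  proof (subst nn_integral_add)
    have "(\<lambda>\<omega>. max 0 (D * enn2real (ennreal (A \<omega>)) - D' * enn2real (ennreal (B \<omega>)))) \<in> borel_measurable M"
      using mA by measurable
    then have "(\<lambda>\<omega>. max 0 (D * A \<omega> - D' * B \<omega>)) \<in> borel_measurable M"
      using AB0 by simp
    then show "(\<lambda>\<omega>. ennreal (flip_bound p q t d (V \<omega> \<inter> R) h)) \<in> borel_measurable M"
      unfolding fl by (rule measurable_compose[OF _ measurable_ennreal])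
  qed (use mA in \<open>auto simp: nn_integral_cmult EB\<close>)
  finally have main: "ennreal (D * exp (lam * IA)) \<le>
      (\<integral>\<^sup>+\<omega>. ennreal (flip_bound p q t d (V \<omega> \<inter> R) h) \<partial>M) + ennreal (D' * exp (lam * IB))"
    using DD by (simp add: ennreal_mult)
  let ?r = "1 - 2 * exp (- (2 * t * d)) * exp (lam * ((c - 1) * measure lborel R))"
  have "D * exp (- (lam * S)) * ?r
      \<le> max 0 (D * exp (lam * IA) * ?r)"
  proof (cases "?r \<ge> 0")
    case True
    have "exp (- (lam * S)) \<le> exp (lam * IA)" using mult_left_mono[OF IAS, of lam] lam_pos by simp
    then show ?thesis using True DD by (intro max.coboundedI2 mult_right_mono mult_left_mono) auto
  next
    case False
    then have "D * exp (- (lam * S)) * ?r \<le> 0"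
      using DD by (intro mult_nonneg_nonpos) auto
    then show ?thesis by simp
  qed
  also have "\<dots> \<le> max 0 (D * exp (lam * IA) - D' * exp (lam * IB))"
  proof -
    have "D' * exp (lam * IB) \<le> D' * exp (lam * (IA + (c - 1) * measure lborel R))"
      using DD lam_pos IBA by (intro mult_left_mono) auto
    also have "\<dots> = D * exp (lam * IA) * (2 * exp (- (2 * t * d)) * exp (lam * ((c - 1) * measure lborel R)))"
      by (simp add: D_def D'_def ring_distribs exp_add)
    finally show ?thesis by (intro max.mono order_refl) (simp add: right_diff_distrib)
  qed
  finally have "ennreal (D * exp (- (lam * S)) * ?r)
     \<le> ennreal (max 0 (D * exp (lam * IA) - D' * exp (lam * IB)))" by (rule ennreal_leI)
  also have "\<dots> = ennreal (D * exp (lam * IA)) - ennreal (D' * exp (lam * IB))"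
    using DD by (simp add: ennreal_minus max_def ennreal_neg)
  also have "\<dots> \<le> (\<integral>\<^sup>+\<omega>. ennreal (flip_bound p q t d (V \<omega> \<inter> R) h) \<partial>M)"
    using main by (simp add: ennreal_minus_le_iff add.commute)
  finally show ?thesis unfolding D_def c_def .
qed

text \<open>Independence of the nodes in two disjoint sets, in the form of Fubini's theorem. It allows fixing
the lone node in \<open>J\<close> while averaging over the nodes in \<open>R\<close>.\<close>

lemma (in poisson_nodes) nn_integral_nodes_pair:
  assumes J: "J \<in> sets (circle n)" and R: "R \<in> sets (circle n)" and JR: "J \<inter> R = {}"
    and G: "G \<in> borel_measurable (node_space n \<Otimes>\<^sub>M node_space n)"
  shows "(\<integral>\<^sup>+\<omega>. G (V \<omega> \<inter> J, V \<omega> \<inter> R) \<partial>M) = (\<integral>\<^sup>+\<omega>. \<integral>\<^sup>+\<omega>'. G (V \<omega> \<inter> J, V \<omega>' \<inter> R) \<partial>M \<partial>M)"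
proof -
  let ?X = "\<lambda>\<omega>. V \<omega> \<inter> J" and ?Y = "\<lambda>\<omega>. V \<omega> \<inter> R"
  have X: "?X \<in> measurable M (node_space n)" "?Y \<in> measurable M (node_space n)"
    using J R by (auto intro: V_Int_measurable)
  have "indep_vars (\<lambda>_. node_space n) (\<lambda>i \<omega>. V \<omega> \<inter> (case i of True \<Rightarrow> J | False \<Rightarrow> R)) UNIV"
    using J R JR by (intro indep_nodes) (auto simp: disjoint_family_on_def split: bool.splits)
  then have "indep_var (node_space n) ?X (node_space n) ?Y"
    unfolding indep_var_def
    by (rule indep_vars_cong[THEN iffD1, rotated 3]) (auto split: bool.splits)
  then have eq: "distr M (node_space n) ?X \<Otimes>\<^sub>M distr M (node_space n) ?Y
      = distr M (node_space n \<Otimes>\<^sub>M node_space n) (\<lambda>\<omega>. (?X \<omega>, ?Y \<omega>))"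
    unfolding indep_var_distribution_eq by blast
  interpret Y: prob_space "distr M (node_space n) ?Y" using X by (intro prob_space_distr)
  have "(\<integral>\<^sup>+\<omega>. G (?X \<omega>, ?Y \<omega>) \<partial>M) = (\<integral>\<^sup>+z. G z \<partial>distr M (node_space n \<Otimes>\<^sub>M node_space n) (\<lambda>\<omega>. (?X \<omega>, ?Y \<omega>)))"
    using X G by (subst nn_integral_distr) auto
  also have "\<dots> = (\<integral>\<^sup>+x. \<integral>\<^sup>+y. G (x, y) \<partial>distr M (node_space n) ?Y \<partial>distr M (node_space n) ?X)"
    unfolding eq[symmetric] using G by (subst Y.nn_integral_fst) auto
  also have "\<dots> = (\<integral>\<^sup>+x. \<integral>\<^sup>+\<omega>'. G (x, ?Y \<omega>') \<partial>M \<partial>distr M (node_space n) ?X)"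
    using X G by (intro nn_integral_cong) (subst nn_integral_distr, auto)
  also have "\<dots> = (\<integral>\<^sup>+\<omega>. \<integral>\<^sup>+\<omega>'. G (?X \<omega>, ?Y \<omega>') \<partial>M \<partial>M)"
  proof -
    have "(\<lambda>(x, \<omega>'). G (x, ?Y \<omega>')) \<in> borel_measurable (node_space n \<Otimes>\<^sub>M M)"
      unfolding case_prod_unfold by (rule measurable_compose[OF _ G]) (use X(2) in measurable)
    then have "(\<lambda>x. \<integral>\<^sup>+\<omega>'. G (x, ?Y \<omega>') \<partial>M) \<in> borel_measurable (node_space n)"
      by (rule borel_measurable_nn_integral)
    then show ?thesis by (intro nn_integral_distr[OF X(1)]) simp
  qed
  finally show ?thesis .
qed

text \<open>The sum has a single term: it is written as a sum to express the unique node of \<open>X \<inter>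
J\<close> in a measurable way.\<close>

definition lone_bound ::
    "real \<Rightarrow> real \<Rightarrow> real \<Rightarrow> real \<Rightarrow> (real \<Rightarrow> real \<Rightarrow> real) \<Rightarrow> real set \<Rightarrow> real set \<Rightarrow> real" where
  "lone_bound p q t d k J X =
     (if card (X \<inter> J) = 1 then \<Sum>v\<in>X \<inter> J. flip_bound p q t d (X - J) (k v) else 0)"

lemma lone_bound_range:
  assumes "0 < p" "p < 1" "0 < q" "q < 1" "0 \<le> d" "\<And>u v. 0 \<le> k u v \<and> k u v \<le> 1"
  shows "0 \<le> lone_bound p q t d k J X" "lone_bound p q t d k J X \<le> 1"
proof -
  show "0 \<le> lone_bound p q t d k J X"
    by (auto simp: lone_bound_def intro!: sum_nonneg flip_bound_nonneg)
  have "flip_bound p q t d (X - J) (k v) \<le> 1" for v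
    using flip_bound_le_half[OF assms(1-5), of "X - J" "k v" t] assms(6) by fastforce
  then show "lone_bound p q t d k J X \<le> 1"
    by (auto simp: lone_bound_def card_1_singleton_iff)
qed

lemma measurable_flip_bound:
  fixes k :: "real \<Rightarrow> real \<Rightarrow> real"
  assumes pq: "0 < p" "p < 1" "0 < q" "q < 1"
    and k [measurable]: "(\<lambda>(v, u). k v u) \<in> borel_measurable (borel \<Otimes>\<^sub>M borel)"
    and k01: "\<And>u v. 0 \<le> k u v \<and> k u v \<le> 1"
  shows "(\<lambda>(v, X). flip_bound p q t d X (k v)) \<in> borel_measurable (borel \<Otimes>\<^sub>M node_space n)"
proof -
  have "(\<lambda>(v, u). affinity p q (k v u)) \<in> borel_measurable (borel \<Otimes>\<^sub>M borel)"
    unfolding case_prod_unfold by measurable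
  from measurable_prod_nodes[OF this, of n]
  have A: "(\<lambda>(v, X). \<Prod>u\<in>X. affinity p q (k v u)) \<in> borel_measurable (borel \<Otimes>\<^sub>M node_space n)"
    using affinity_ge[OF pq] affinity_le_1[OF pq] k01 by auto
  have C: "(\<lambda>z. cosh (t * llr_max p q) ^ card (snd z)) \<in> borel_measurable (borel \<Otimes>\<^sub>M node_space n)"
    by (rule measurable_compose[OF measurable_compose[OF measurable_snd measurable_card_node_space]]) simp
  have "(\<lambda>z. max 0 (exp (- d) / 2 * ((case z of (v, X) \<Rightarrow> \<Prod>u\<in>X. affinity p q (k v u)) -
      2 * exp (- (2 * t * d)) * (cosh (t * llr_max p q) ^ card (snd z) *
       (case z of (v, X) \<Rightarrow> \<Prod>u\<in>X. affinity p q (k v u)))))) \<in> borel_measurable (borel \<Otimes>\<^sub>M node_space n)"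
    using A C by measurable
  then show ?thesis
    by (simp add: flip_bound_def prod.distrib case_prod_unfold)
qed

lemma measurable_sum_flip_bound:
  assumes pq: "0 < p" "p < 1" "0 < q" "q < 1"
    and k: "(\<lambda>(v, u). k v u) \<in> borel_measurable (borel \<Otimes>\<^sub>M borel)"
    and k01: "\<And>u v. 0 \<le> k u v \<and> k u v \<le> 1"
  shows "(\<lambda>(W, X). \<Sum>v\<in>W. ennreal (flip_bound p q t d X (k v)))
    \<in> borel_measurable (node_space n \<Otimes>\<^sub>M node_space n)"
proof -
  have "(\<lambda>z. ennreal ((\<lambda>(v, X). flip_bound p q t d X (k v)) (snd z, fst z))) \<in> borel_measurable (node_space n \<Otimes>\<^sub>M borel)"
    by (rule measurable_compose[OF _ measurable_compose[OF measurable_flip_bound[OF assms] measurable_ennreal]]) measurable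
  then have "(\<lambda>(X, v). ennreal (flip_bound p q t d X (k v))) \<in> borel_measurable (node_space n \<Otimes>\<^sub>M borel)"
    by (simp add: case_prod_unfold)
  from measurable_sum_nodes[OF this, of n]
  have m: "(\<lambda>(X, W). \<Sum>v\<in>W. ennreal (flip_bound p q t d X (k v))) \<in> borel_measurable (node_space n \<Otimes>\<^sub>M node_space n)" .
  have "(\<lambda>z. (\<lambda>(X, W). \<Sum>v\<in>W. ennreal (flip_bound p q t d X (k v))) (snd z, fst z)) \<in> borel_measurable (node_space n \<Otimes>\<^sub>M node_space n)"
    by (rule measurable_compose[OF _ m]) measurable
  then show ?thesis by (simp add: case_prod_unfold)
qed

text \<open>The same quantity as a function of the configurations inside and outside \<open>J\<close>, which are
independent.\<close>

definition pair_bound ::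
    "real \<Rightarrow> real \<Rightarrow> real \<Rightarrow> real \<Rightarrow> (real \<Rightarrow> real \<Rightarrow> real) \<Rightarrow> real set \<times> real set \<Rightarrow> ennreal" where
  "pair_bound p q t d k z = (if card (fst z) = 1 then \<Sum>v\<in>fst z. ennreal (flip_bound p q t d (snd z) (k v)) else 0)"

lemma measurable_pair_bound:
  assumes pq: "0 < p" "p < 1" "0 < q" "q < 1"
    and k: "(\<lambda>(v, u). k v u) \<in> borel_measurable (borel \<Otimes>\<^sub>M borel)"
    and k01: "\<And>u v. 0 \<le> k u v \<and> k u v \<le> 1"
  shows "pair_bound p q t d k \<in> borel_measurable (node_space n \<Otimes>\<^sub>M node_space n)"
proof -
  have "(\<lambda>z. card (fst z)) \<in> measurable (node_space n \<Otimes>\<^sub>M node_space n) (count_space UNIV)"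
    by (rule measurable_compose[OF measurable_fst measurable_card_node_space])
  moreover have "(\<lambda>z. \<Sum>v\<in>fst z. ennreal (flip_bound p q t d (snd z) (k v))) \<in> borel_measurable (node_space n \<Otimes>\<^sub>M node_space n)"
    using measurable_sum_flip_bound[OF assms] by (simp add: case_prod_unfold)
  ultimately show ?thesis unfolding pair_bound_def by measurable
qed

lemma lone_bound_eq_pair:
  "ennreal (lone_bound p q t d k J X) = pair_bound p q t d k (X \<inter> J, X - J)"
  by (auto simp: lone_bound_def pair_bound_def flip_bound_nonneg)

lemma measurable_lone_bound:
  assumes pq: "0 < p" "p < 1" "0 < q" "q < 1"
    and k: "(\<lambda>(v, u). k v u) \<in> borel_measurable (borel \<Otimes>\<^sub>M borel)"
    and k01: "\<And>u v. 0 \<le> k u v \<and> k u v \<le> 1"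
    and J: "J \<in> sets (circle n)"
  shows "lone_bound p q t d k J \<in> borel_measurable (node_space n)"
proof -
  have R: "space (circle n) - J \<in> sets (circle n)" using J by auto
  have "(\<lambda>X. (X \<inter> J, X \<inter> (space (circle n) - J))) \<in> measurable (node_space n) (node_space n \<Otimes>\<^sub>M node_space n)"
    using measurable_Int_point_configs[OF J] measurable_Int_point_configs[OF R]
    by (intro measurable_Pair) (simp_all add: node_space_def)
  from measurable_compose[OF this measurable_pair_bound[OF pq k k01]]
  have "(\<lambda>X. enn2real (pair_bound p q t d k (X \<inter> J, X \<inter> (space (circle n) - J)))) \<in> borel_measurable (node_space n)"
    by measurable
  then show ?thesis
  proof (rule measurable_cong[THEN iffD1, rotated])
    fix X assume "X \<in> space (node_space n)"
    then have "X \<inter> (space (circle n) - J) = X - J" by (auto simp: node_space_def space_point_configs)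
    moreover have "0 \<le> lone_bound p q t d k J X"
      by (auto simp: lone_bound_def intro!: sum_nonneg flip_bound_nonneg)
    ultimately show "enn2real (pair_bound p q t d k (X \<inter> J, X \<inter> (space (circle n) - J))) = lone_bound p q t d k J X"
      by (simp flip: lone_bound_eq_pair)
  qed
qed

text \<open>With probability \<open>lam * \<bar>J\<bar> * exp (- lam * \<bar>J\<bar>)\<close> there is exactly
one node in \<open>J\<close>. Wherever it lies, the nodes of the rest of the block are independent
of it, so that \<open>nn_integral_flip_bound_ge\<close> applies.\<close>

lemma (in poisson_nodes) expectation_lone_bound_ge:
  assumes pq: "0 < p" "p < 1" "0 < q" "q < 1"
    and k [measurable]: "(\<lambda>(v, u). k v u) \<in> borel_measurable (borel \<Otimes>\<^sub>M borel)"
    and k01: "\<And>u v. 0 \<le> k u v \<and> k u v \<le> 1"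
    and J: "J \<in> sets (circle n)" and B: "B \<in> sets (circle n)" "J \<subseteq> B" and d: "0 \<le> d"
    and S: "\<And>v. v \<in> J \<Longrightarrow> (LINT x|lborel. indicator (B - J) x * (1 - affinity p q (k v x))) \<le> S"
    and b: "b = exp (- d) / 2 * exp (- (lam * S)) *
      (1 - 2 * exp (- (2 * t * d)) * exp (lam * ((cosh (t * llr_max p q) - 1) * measure lborel (B - J))))"
  shows "b * (lam * measure lborel J * exp (- (lam * measure lborel J)))
    \<le> expectation (\<lambda>\<omega>. lone_bound p q t d k J (V \<omega> \<inter> B))"
proof -
  let ?R = "B - J"
  have R: "?R \<in> sets (circle n)" using J B by auto
  let ?G = "pair_bound p q t d k"
  let ?E = "{\<omega> \<in> space M. card (V \<omega> \<inter> J) = 1}"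
  have E: "?E \<in> sets M"
  proof -
    have "?E = (\<lambda>\<omega>. card (V \<omega> \<inter> J)) -` {1} \<inter> space M" by auto
    then show ?thesis using count_measurable[OF J] by (auto intro: measurable_sets)
  qed
  have "ennreal b * indicator ?E \<omega> \<le> (\<integral>\<^sup>+\<omega>'. ?G (V \<omega> \<inter> J, V \<omega>' \<inter> ?R) \<partial>M)" for \<omega>
  proof (cases "\<omega> \<in> ?E")
    case True
    then obtain v where v: "V \<omega> \<inter> J = {v}" by (auto simp: card_1_singleton_iff)
    have kv: "k v \<in> borel_measurable borel" using measurable_Pair2[OF k, of v] by simp
    have "ennreal b \<le> (\<integral>\<^sup>+\<omega>'. ennreal (flip_bound p q t d (V \<omega>' \<inter> ?R) (k v)) \<partial>M)"
      unfolding b using v k01 by (intro nn_integral_flip_bound_ge R kv pq S) auto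
    then show ?thesis using v True by (simp add: pair_bound_def)
  qed simp
  then have "(\<integral>\<^sup>+\<omega>. ennreal b * indicator ?E \<omega> \<partial>M) \<le> (\<integral>\<^sup>+\<omega>. \<integral>\<^sup>+\<omega>'. ?G (V \<omega> \<inter> J, V \<omega>' \<inter> ?R) \<partial>M \<partial>M)"
    by (intro nn_integral_mono)
  also have "\<dots> = (\<integral>\<^sup>+\<omega>. ?G (V \<omega> \<inter> J, V \<omega> \<inter> ?R) \<partial>M)"
    by (rule nn_integral_nodes_pair[symmetric, OF J R _ measurable_pair_bound[OF pq k k01]]) auto
  also have "\<dots> = (\<integral>\<^sup>+\<omega>. ennreal (lone_bound p q t d k J (V \<omega> \<inter> B)) \<partial>M)"
  proof (intro nn_integral_cong)
    fix \<omega>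
    have "V \<omega> \<inter> B \<inter> J = V \<omega> \<inter> J" "V \<omega> \<inter> B - J = V \<omega> \<inter> ?R" using B by auto
    then show "?G (V \<omega> \<inter> J, V \<omega> \<inter> ?R) = ennreal (lone_bound p q t d k J (V \<omega> \<inter> B))"
      by (simp add: lone_bound_eq_pair)
  qed
  also have "\<dots> = ennreal (expectation (\<lambda>\<omega>. lone_bound p q t d k J (V \<omega> \<inter> B)))"
  proof (rule nn_integral_eq_integral)
    show "integrable M (\<lambda>\<omega>. lone_bound p q t d k J (V \<omega> \<inter> B))"
      using lone_bound_range[OF pq d, of k] k01
        measurable_compose[OF V_Int_measurable[OF B(1)] measurable_lone_bound[OF pq k k01 J]]
      by (intro integrable_const_bound[where B = 1]) auto
  qed (use lone_bound_range[OF pq d, of k] k01 in auto)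
  also have "(\<integral>\<^sup>+\<omega>. ennreal b * indicator ?E \<omega> \<partial>M) = ennreal b * ennreal (prob ?E)"
    using E by (simp add: nn_integral_cmult_indicator emeasure_eq_measure)
  finally have "ennreal (b * prob ?E) \<le> ennreal (expectation (\<lambda>\<omega>. lone_bound p q t d k J (V \<omega> \<inter> B)))"
    by (simp add: ennreal_mult'')
  moreover have "0 \<le> expectation (\<lambda>\<omega>. lone_bound p q t d k J (V \<omega> \<inter> B))"
    using lone_bound_range[OF pq d, of k] k01 by (intro expectation_nonneg) auto
  ultimately have "b * prob ?E \<le> expectation (\<lambda>\<omega>. lone_bound p q t d k J (V \<omega> \<inter> B))"
    by (simp add: ennreal_le_iff)
  then show ?thesis using prob_count[OF J, of 1] by (simp add: mult_ac)
qed

section \<open>The recovery event\<close>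

lemma pred_disjoint_point_configs:
  assumes "B \<in> sets S"
  shows "Measurable.pred (point_configs S) (\<lambda>X. X \<inter> B = {})"
proof -
  have "Measurable.pred (point_configs S) (\<lambda>X. card (X \<inter> B) = 0)"
    using measurable_card_point_configs[OF assms] by measurable
  then show ?thesis
    by (rule measurable_cong[THEN iffD1, rotated]) (auto simp: space_point_configs)
qed

text \<open>A point of \<open>X\<close> outside the finite set \<open>Y\<close> is separated from
\<open>Y\<close> by an interval with rational endpoints, so inclusion is a countable combination of
void events.\<close>

lemma pred_subset_node_space:
  "Measurable.pred (node_space n \<Otimes>\<^sub>M node_space n) (\<lambda>z. fst z \<subseteq> snd z)"
proof -
  let ?B = "\<lambda>a b. {real_of_rat a <..< real_of_rat b} \<inter> space (circle n)"
  have "Measurable.pred (node_space n) (\<lambda>X. X \<inter> ?B a b = {})" for a b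
    unfolding node_space_def by (intro pred_disjoint_point_configs) (auto simp: sets_circle_iff space_circle)
  then have [measurable]: "Measurable.pred (node_space n \<Otimes>\<^sub>M node_space n) (\<lambda>z. fst z \<inter> ?B a b = {})"
    "Measurable.pred (node_space n \<Otimes>\<^sub>M node_space n) (\<lambda>z. snd z \<inter> ?B a b = {})" for a b
    by (auto intro: measurable_compose[OF measurable_fst] measurable_compose[OF measurable_snd])
  have "Measurable.pred (node_space n \<Otimes>\<^sub>M node_space n)
     (\<lambda>z. \<forall>a b. snd z \<inter> ?B a b = {} \<longrightarrow> fst z \<inter> ?B a b = {})" by measurable
  then show ?thesis
  proof (rule measurable_cong[THEN iffD1, rotated])
    fix z assume "z \<in> space (node_space n \<Otimes>\<^sub>M node_space n)"
    then obtain X Y where z: "z = (X, Y)" "X \<subseteq> space (circle n)" "finite Y"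
      by (auto simp: space_pair_measure node_space_def space_point_configs)
    have "X \<subseteq> Y" if H: "\<forall>a b. Y \<inter> ?B a b = {} \<longrightarrow> X \<inter> ?B a b = {}"
    proof
      fix x assume x: "x \<in> X"
      show "x \<in> Y"
      proof (rule ccontr)
        assume "x \<notin> Y"
        moreover have "open (- Y)" using z(3) by (simp add: finite_imp_closed open_Compl)
        ultimately obtain e where e: "e > 0" "ball x e \<subseteq> - Y" by (auto simp: open_contains_ball)
        obtain a where a: "x - e < real_of_rat a" "real_of_rat a < x" using of_rat_dense[of "x - e" x] e by auto
        obtain b where b: "x < real_of_rat b" "real_of_rat b < x + e" using of_rat_dense[of x "x + e"] e by auto
        have "{real_of_rat a <..< real_of_rat b} \<subseteq> ball x e" using a b by (auto simp: dist_real_def)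
        then have "Y \<inter> ?B a b = {}" using e by auto
        moreover have "x \<in> X \<inter> ?B a b" using x a b z by auto
        ultimately show False using H by blast
      qed
    qed
    then show "(\<forall>a b. snd z \<inter> ?B a b = {} \<longrightarrow> fst z \<inter> ?B a b = {}) \<longleftrightarrow> fst z \<subseteq> snd z"
      using z(1) by auto
  qed
qed

lemma measurable_label_nodes:
  "(\<lambda>s. {v. s v = 1}) \<in> measurable (label_space n) (node_space n)"
  "(\<lambda>s. {v. s v = -1}) \<in> measurable (label_space n) (node_space n)"
proof -
  let ?g = "\<lambda>s :: real \<Rightarrow> int. ({v. s v = 1}, {v. s v = -1})"
  have "?g \<in> measurable (label_space n) (node_space n \<Otimes>\<^sub>M node_space n)"
    unfolding label_space_def
  proof (rule measurable_vimage_algebra1, rule Pi_I)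
    fix s assume "s \<in> (\<Union>V\<in>space (node_space n). labellings V)"
    then obtain V where V: "V \<in> space (node_space n)" "s \<in> labellings V" by blast
    then have "{v. s v = 1} \<subseteq> V" "{v. s v = -1} \<subseteq> V" by (auto simp: labellings_def)
    moreover have "finite V" "V \<subseteq> space (circle n)"
      using V(1) by (auto simp: node_space_def space_point_configs)
    ultimately have "finite {v. s v = 1}" "finite {v. s v = -1}" "{v. s v = 1} \<subseteq> space (circle n)"
       "{v. s v = -1} \<subseteq> space (circle n)" by (auto intro: finite_subset)
    then show "?g s \<in> space (node_space n \<Otimes>\<^sub>M node_space n)"
      by (simp add: space_pair_measure node_space_def space_point_configs)
  qed
  from measurable_compose[OF this measurable_fst] measurable_compose[OF this measurable_snd]
  show "(\<lambda>s. {v. s v = 1}) \<in> measurable (label_space n) (node_space n)"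
    "(\<lambda>s. {v. s v = -1}) \<in> measurable (label_space n) (node_space n)" by simp_all
qed

definition recovery_event ::
    "nat \<Rightarrow> ((real \<Rightarrow> real \<Rightarrow> nat) \<times> real set \<Rightarrow> real \<Rightarrow> int) \<Rightarrow>
      (real set \<times> (real \<Rightarrow> int) \<times> (real \<Rightarrow> real \<Rightarrow> nat)) set" where
  "recovery_event n est = {z \<in> space (node_space n \<Otimes>\<^sub>M label_space n \<Otimes>\<^sub>M adj_space n).
     case z of (V, s, a) \<Rightarrow> Ham V (est (a, V)) s = 0}"

text \<open>Agreement up to sign is a combination of inclusions between the sets of nodes labelled 1 and -1 by
the estimator and by the true labelling.\<close>

lemma recovery_event_measurable:
  assumes est: "estimator n est"
  shows "recovery_event n est \<in> sets (node_space n \<Otimes>\<^sub>M label_space n \<Otimes>\<^sub>M adj_space n)"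
proof -
  let ?S = "node_space n \<Otimes>\<^sub>M label_space n \<Otimes>\<^sub>M adj_space n"
  let ?t = "\<lambda>z. est (snd (snd z), fst z)" and ?s = "\<lambda>z. fst (snd z)"
  let ?Q = "\<lambda>z. ({v. ?t z v = 1} \<subseteq> {v. ?s z v = 1} \<and> {v. ?t z v = -1} \<subseteq> {v. ?s z v = -1})
      \<or> ({v. ?t z v = 1} \<subseteq> {v. ?s z v = -1} \<and> {v. ?t z v = -1} \<subseteq> {v. ?s z v = 1})"
  have em: "est \<in> measurable (adj_space n \<Otimes>\<^sub>M node_space n) (label_space n)"
    using est by (simp add: estimator_def)
  have t: "?t \<in> measurable ?S (label_space n)"
    by (rule measurable_compose[OF _ em]) measurable
  have s: "?s \<in> measurable ?S (label_space n)" by measurable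
  have sub: "Measurable.pred ?S (\<lambda>z. f z \<subseteq> g z)"
    if "f \<in> measurable ?S (node_space n)" "g \<in> measurable ?S (node_space n)" for f g
    using measurable_compose[OF measurable_Pair[OF that] pred_subset_node_space] by simp
  note m = measurable_compose[OF t measurable_label_nodes(1)] measurable_compose[OF t measurable_label_nodes(2)]
    measurable_compose[OF s measurable_label_nodes(1)] measurable_compose[OF s measurable_label_nodes(2)]
  have "Measurable.pred ?S (\<lambda>z. ?Q z)"
    by (intro pred_intros_logic sub m)
  then have "{z \<in> space ?S. ?Q z} \<in> sets ?S"
    by (simp add: pred_def)
  also have "{z \<in> space ?S. ?Q z} = recovery_event n est"
    unfolding recovery_event_def
  proof (rule Collect_cong, rule conj_cong[OF refl])
    fix z assume z: "z \<in> space ?S"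
    obtain V s a where zz: "z = (V, s, a)" by (cases z)
    have V: "V \<in> space (node_space n)" "a \<in> space (adj_space n)" using z zz by (auto simp: space_pair_measure)
    then have fin: "finite V" by (simp add: node_space_def space_point_configs)
    let ?t = "est (a, V)"
    have lt: "?t \<in> labellings V" using est V by (auto simp: estimator_def)
    have H: "Ham V ?t s = 0 \<longleftrightarrow> (\<forall>v\<in>V. ?t v = - s v) \<or> (\<forall>v\<in>V. ?t v = s v)"
      by (rule Ham_eq_0_iff_agree[OF fin])
    have tv: "?t v = 1 \<or> ?t v = -1" if "v \<in> V" for v using lt that by (auto simp: labellings_def)
    have Vt: "v \<in> V" if "?t v = 1 \<or> ?t v = -1" for v using lt that by (auto simp: labellings_def)
    have 1: "(\<forall>v\<in>V. ?t v = s v) \<longleftrightarrow> {v. ?t v = 1} \<subseteq> {v. s v = 1} \<and> {v. ?t v = -1} \<subseteq> {v. s v = -1}"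
    proof -
      have "(\<forall>v\<in>V. ?t v = s v) \<longleftrightarrow> (\<forall>v. (?t v = 1 \<longrightarrow> s v = 1) \<and> (?t v = -1 \<longrightarrow> s v = -1))"
        by (metis tv Vt)
      then show ?thesis by auto
    qed
    have 2: "(\<forall>v\<in>V. ?t v = - s v) \<longleftrightarrow> {v. ?t v = 1} \<subseteq> {v. s v = -1} \<and> {v. ?t v = -1} \<subseteq> {v. s v = 1}"
    proof -
      have "(\<forall>v\<in>V. ?t v = - s v) \<longleftrightarrow> (\<forall>v. (?t v = 1 \<longrightarrow> s v = -1) \<and> (?t v = -1 \<longrightarrow> s v = 1))"
        by (metis tv Vt minus_minus)
      then show ?thesis by auto
    qed
    show "?Q z \<longleftrightarrow> (case z of (V, s, a) \<Rightarrow> Ham V (est (a, V)) s = 0)"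
      unfolding zz by (simp only: fst_conv snd_conv prod.case H 1 2) blast
  qed
  finally show ?thesis .
qed

abbreviation (input) recovery_prob ::
    "'w measure \<Rightarrow> nat \<Rightarrow> ('w \<Rightarrow> real set) \<Rightarrow> ('w \<Rightarrow> real \<Rightarrow> int) \<Rightarrow> ('w \<Rightarrow> real \<Rightarrow> real \<Rightarrow> nat) \<Rightarrow>
      ((real \<Rightarrow> real \<Rightarrow> nat) \<times> real set \<Rightarrow> real \<Rightarrow> int) \<Rightarrow> real" where
  "recovery_prob M n V \<sigma> A est \<equiv>
     measure M {\<omega> \<in> space M. real (Ham (V \<omega>) (est (A \<omega>, V \<omega>)) (\<sigma> \<omega>)) / real n = 0}"

text \<open>A bound on the conditional success probability given the nodes bounds the success probability by its
expectation.\<close>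

lemma recovery_prob_le_expectation:
  fixes U :: "'w \<Rightarrow> real"
  assumes G: "GKBM M n lam \<phi> p q V \<sigma> A" and est: "estimator n est" and n: "0 < n"
    and U: "integrable M U"
    and bound: "\<And>\<omega> T. \<omega> \<in> space M \<Longrightarrow>
      P_pmf (label_edge_pmf p q (\<lambda>u v. \<phi> (circle_dist n u v / ln (real n))) (V \<omega>))
        {(s, f). s = T f \<or> s = - T f} \<le> U \<omega>"
  shows "recovery_prob M n V \<sigma> A est
    \<le> (\<integral>\<omega>. U \<omega> \<partial>M)"
proof -
  interpret GKBM M n lam \<phi> p q V \<sigma> A by (rule G)
  have Vm: "V \<in> measurable M (node_space n)" using nodes by (simp add: poisson_process_def)
  let ?S = "recovery_event n est"
  have sp: "(V \<omega>, \<sigma> \<omega>, A \<omega>) \<in> space (node_space n \<Otimes>\<^sub>M label_space n \<Otimes>\<^sub>M adj_space n)" if "\<omega> \<in> space M" for \<omega>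
    using measurable_space[OF Vm that] measurable_space[OF labels_measurable that] measurable_space[OF adj_measurable that]
    by (simp add: space_pair_measure)
  have "{\<omega> \<in> space M. real (Ham (V \<omega>) (est (A \<omega>, V \<omega>)) (\<sigma> \<omega>)) / real n = 0} =
      {\<omega> \<in> space M. (V \<omega>, \<sigma> \<omega>, A \<omega>) \<in> ?S}"
    using sp n by (auto simp: recovery_event_def)
  then have "recovery_prob M n V \<sigma> A est =
      (\<integral>\<omega>. P_pmf (label_adj_pmf n \<phi> p q (V \<omega>)) {(s, a). (V \<omega>, s, a) \<in> ?S} \<partial>M)"
    using conditional_law[OF recovery_event_measurable[OF est]] by simp
  also have "\<dots> \<le> (\<integral>\<omega>. U \<omega> \<partial>M)"
  proof (rule integral_mono'[OF U])
    fix \<omega> assume w: "\<omega> \<in> space M"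
    have Vs: "V \<omega> \<in> space (node_space n)" using measurable_space[OF Vm w] .
    then have fin: "finite (V \<omega>)" by (simp add: node_space_def space_point_configs)
    let ?t = "\<lambda>a. est (a, V \<omega>)"
    have "s = ?t a \<or> s = - ?t a" if "(s, a) \<in> {(s, a). (V \<omega>, s, a) \<in> ?S}" "s \<in> labellings (V \<omega>)" for s a
    proof -
      have "a \<in> space (adj_space n)" "Ham (V \<omega>) (?t a) s = 0"
        using that(1) by (auto simp: recovery_event_def space_pair_measure)
      then show ?thesis using Ham_eq_0_iff[OF fin that(2)] est Vs by (auto simp: estimator_def)
    qed
    then have "P_pmf (label_adj_pmf n \<phi> p q (V \<omega>)) {(s, a). (V \<omega>, s, a) \<in> ?S} \<le>
        P_pmf (label_edge_pmf p q (\<lambda>u v. \<phi> (circle_dist n u v / ln (real n))) (V \<omega>))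
          {(s, f). s = ?t (\<lambda>u v. of_bool (f (min u v, max u v))) \<or> s = - ?t (\<lambda>u v. of_bool (f (min u v, max u v)))}"
      by (intro prob_label_adj_pmf_le[OF fin]) blast
    also have "\<dots> \<le> U \<omega>" by (rule bound[OF w])
    finally show "P_pmf (label_adj_pmf n \<phi> p q (V \<omega>)) {(s, a). (V \<omega>, s, a) \<in> ?S} \<le> U \<omega>" .
    show "0 \<le> U \<omega>"
      using bound[OF w, of "\<lambda>_ _. 0"] measure_nonneg order_trans by blast
  qed
  finally show ?thesis .
qed

section \<open>Many independent blocks\<close>

text \<open>Nodes alone in some \<open>J i\<close> form the set \<open>C\<close> of \<open>genie_bound\<close>,
with the rest of their block as neighbourhood. The global sign is handled by two applications, to
\<open>T\<close> and to \<open>- T\<close>.\<close>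

lemma isolated_blocks_bound:
  fixes V :: "real set" and k :: "real \<Rightarrow> real \<Rightarrow> real" and J B :: "nat \<Rightarrow> real set"
  assumes fin: "finite V" and pq: "0 < p" "p < 1" "0 < q" "q < 1"
    and k01: "\<And>u v. 0 \<le> k u v \<and> k u v \<le> 1" and ksym: "\<And>u v. k u v = k v u"
    and JB: "\<And>i. i < m \<Longrightarrow> J i \<subseteq> B i" and disj: "disjoint_family_on B {..<m}"
    and far: "\<And>i u v. i < m \<Longrightarrow> v \<in> J i \<Longrightarrow> u \<in> V - B i \<Longrightarrow> k v u = 0"
    and t: "0 \<le> t"
  shows "P_pmf (label_edge_pmf p q k V) {(s, f). s = T f \<or> s = - T f}
    \<le> 2 * (\<Prod>i<m. 1 - lone_bound p q t d k (J i) (V \<inter> B i))"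
proof -
  let ?P = "label_edge_pmf p q k V"
  define I where "I = {i. i < m \<and> card (V \<inter> J i) = 1}"
  define cc where "cc i = the_elem (V \<inter> J i)" for i
  define C where "C = cc ` I"
  define ix where "ix = the_inv_into I cc"
  define N where "N c = V \<inter> B (ix c) - J (ix c)" for c
  have finI: "finite I" by (simp add: I_def)
  have cc: "V \<inter> J i = {cc i}" if "i \<in> I" for i
  proof -
    from that have "card (V \<inter> J i) = 1" by (simp add: I_def)
    then obtain x where "V \<inter> J i = {x}" by (auto simp: card_1_singleton_iff)
    then show ?thesis by (simp add: cc_def)
  qed
  have Bd: "B i \<inter> B j = {}" if "i \<in> I" "j \<in> I" "i \<noteq> j" for i j
    using disj that by (auto simp: disjoint_family_on_def I_def)
  have ccJ: "cc i \<in> J i" "cc i \<in> V" "cc i \<in> B i" if "i \<in> I" for i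
    using cc[OF that] JB[of i] that by (auto simp: I_def)
  have inj: "inj_on cc I"
    unfolding inj_on_def using Bd ccJ by (metis disjoint_iff)
  have ix: "ix (cc i) = i" if "i \<in> I" for i
    unfolding ix_def by (rule the_inv_into_f_f[OF inj that])
  have key: "P_pmf ?P {(s, f). s = T' f} \<le> (\<Prod>i<m. 1 - lone_bound p q t d k (J i) (V \<inter> B i))" for T'
  proof -
    have "P_pmf ?P {(s, f). s = T' f} \<le> (\<Prod>c\<in>C. 1 - flip_bound p q t d (N c) (k c))"
    proof (rule genie_bound[OF fin pq k01 ksym _ _ _ _ t])
      show "C \<subseteq> V" unfolding C_def using ccJ by auto
      show "N c \<subseteq> V - C" if c: "c \<in> C" for c
      proof -
        obtain i where i: "i \<in> I" "c = cc i" using c by (auto simp: C_def)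
        have "cc j \<notin> V \<inter> B i - J i" if "j \<in> I" for j
          using ccJ[OF that] Bd[OF that i(1)] by (cases "i = j") auto
        then show ?thesis unfolding N_def i(2) ix[OF i(1)] by (auto simp: C_def)
      qed
      show "disjoint_family_on N C"
        unfolding disjoint_family_on_def
      proof (intro ballI impI)
        fix c c' assume "c \<in> C" "c' \<in> C" "c \<noteq> c'"
        then obtain i j where "i \<in> I" "j \<in> I" "c = cc i" "c' = cc j" "i \<noteq> j" by (auto simp: C_def)
        then show "N c \<inter> N c' = {}" using Bd[of i j] by (auto simp: N_def ix)
      qed
      show "k c u = 0" if c: "c \<in> C" and u: "u \<in> V - N c - {c}" for c u
      proof -
        obtain i where i: "i \<in> I" "c = cc i" using c by (auto simp: C_def)
        have "u \<in> V - B i"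
          using u cc[OF i(1)] unfolding N_def i(2) ix[OF i(1)] by auto
        then show ?thesis using far[of i c u] i ccJ[OF i(1)] by (simp add: I_def)
      qed
    qed
    also have "\<dots> = (\<Prod>i\<in>I. 1 - flip_bound p q t d (N (cc i)) (k (cc i)))"
      unfolding C_def by (subst prod.reindex[OF inj]) simp
    also have "\<dots> = (\<Prod>i\<in>I. 1 - lone_bound p q t d k (J i) (V \<inter> B i))"
    proof (intro prod.cong refl)
      fix i assume i: "i \<in> I"
      have "V \<inter> B i \<inter> J i = {cc i}" using cc[OF i] JB[of i] i by (auto simp: I_def)
      then show "1 - flip_bound p q t d (N (cc i)) (k (cc i)) = 1 - lone_bound p q t d k (J i) (V \<inter> B i)"
        by (simp add: lone_bound_def N_def ix[OF i])
    qed
    also have "\<dots> = (\<Prod>i<m. 1 - lone_bound p q t d k (J i) (V \<inter> B i))"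
    proof (intro prod.mono_neutral_left ballI)
      fix i assume i: "i \<in> {..<m} - I"
      have "V \<inter> B i \<inter> J i = V \<inter> J i" using JB[of i] i by auto
      then show "1 - lone_bound p q t d k (J i) (V \<inter> B i) = 1"
        using i by (auto simp: lone_bound_def I_def)
    qed (auto simp: I_def)
    finally show ?thesis .
  qed
  have "{(s, f). s = T f \<or> s = - T f} = {(s, f). s = T f} \<union> {(s, f). s = (\<lambda>f. - T f) f}" by auto
  then have "P_pmf ?P {(s, f). s = T f \<or> s = - T f} \<le>
      P_pmf ?P {(s, f). s = T f} + P_pmf ?P {(s, f). s = (\<lambda>f. - T f) f}"
    by (simp only: measure_Un_le sets_measure_pmf UNIV_I)
  then show ?thesis using key[of T] key[of "\<lambda>f. - T f"] by linarith
qed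

text \<open>The blocks are independent and \<open>1 - x \<le> exp (- x)\<close>.\<close>

lemma (in poisson_nodes) expectation_blocks_le:
  assumes pq: "0 < p" "p < 1" "0 < q" "q < 1"
    and k: "(\<lambda>(v, u). k v u) \<in> borel_measurable (borel \<Otimes>\<^sub>M borel)"
    and k01: "\<And>u v. 0 \<le> k u v \<and> k u v \<le> 1"
    and J: "\<And>i. i < m \<Longrightarrow> J i \<in> sets (circle n)" and B: "\<And>i. i < m \<Longrightarrow> B i \<in> sets (circle n)"
    and disj: "disjoint_family_on B {..<m}" and d: "0 \<le> d"
    and b: "\<And>i. i < m \<Longrightarrow> b \<le> expectation (\<lambda>\<omega>. lone_bound p q t d k (J i) (V \<omega> \<inter> B i))"
  shows "expectation (\<lambda>\<omega>. \<Prod>i<m. 1 - lone_bound p q t d k (J i) (V \<omega> \<inter> B i)) \<le> exp (- (real m * b))"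
    and "integrable M (\<lambda>\<omega>. \<Prod>i<m. 1 - lone_bound p q t d k (J i) (V \<omega> \<inter> B i))"
proof -
  let ?F = "\<lambda>i X. lone_bound p q t d k (J i) X"
  note rng = lone_bound_range[OF pq d, of k, OF k01]
  have meas: "?F i \<in> borel_measurable (node_space n)" if "i < m" for i
    by (rule measurable_lone_bound[OF pq k k01 J[OF that]])
  have int: "integrable M (\<lambda>\<omega>. ?F i (V \<omega> \<inter> B i))" if "i < m" for i
    using rng measurable_compose[OF V_Int_measurable[OF B[OF that]] meas[OF that]]
    by (intro integrable_const_bound[where B = 1]) auto
  have "expectation (\<lambda>\<omega>. \<Prod>i<m. 1 - ?F i (V \<omega> \<inter> B i)) = (\<Prod>i<m. expectation (\<lambda>\<omega>. 1 - ?F i (V \<omega> \<inter> B i)))"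
    using B disj meas rng
    by (intro expectation_prod_nodes[where F = "\<lambda>i X. 1 - ?F i X"]) auto
  also have "\<dots> \<le> (\<Prod>i<m. exp (- b))"
  proof (intro prod_mono conjI)
    fix i assume i: "i \<in> {..<m}"
    have "expectation (\<lambda>\<omega>. 1 - ?F i (V \<omega> \<inter> B i)) = 1 - expectation (\<lambda>\<omega>. ?F i (V \<omega> \<inter> B i))"
      using int i by (simp add: prob_space)
    also have "\<dots> \<le> 1 - b" using b i by simp
    also have "\<dots> \<le> exp (- b)" using exp_ge_add_one_self[of "- b"] by simp
    finally show "expectation (\<lambda>\<omega>. 1 - ?F i (V \<omega> \<inter> B i)) \<le> exp (- b)" .
    show "0 \<le> expectation (\<lambda>\<omega>. 1 - ?F i (V \<omega> \<inter> B i))"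
      using rng by (intro expectation_nonneg) auto
  qed
  also have "\<dots> = exp (- (real m * b))" by (simp flip: exp_of_nat_mult)
  finally show "expectation (\<lambda>\<omega>. \<Prod>i<m. 1 - ?F i (V \<omega> \<inter> B i)) \<le> exp (- (real m * b))" .
  show "integrable M (\<lambda>\<omega>. \<Prod>i<m. 1 - ?F i (V \<omega> \<inter> B i))"
  proof (rule integrable_const_bound[where B = 1])
    show "AE \<omega> in M. norm (\<Prod>i<m. 1 - ?F i (V \<omega> \<inter> B i)) \<le> 1"
      using rng by (intro AE_I2) (auto simp: abs_prod intro!: prod_le_1)
    show "(\<lambda>\<omega>. \<Prod>i<m. 1 - ?F i (V \<omega> \<inter> B i)) \<in> borel_measurable M"
      using int by (intro borel_measurable_prod borel_measurable_diff) auto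
  qed
qed

text \<open>The integrand of \<open>I_phi\<close> is one minus the affinity. The factor 2 in
\<open>I_phi\<close> counts the two sides of \<open>v\<close>.\<close>

lemma integral_affinity_scaled:
  fixes \<phi> :: "real \<Rightarrow> real"
  assumes \<phi>: "\<phi> \<in> borel_measurable borel" and \<phi>01: "\<And>x. 0 \<le> \<phi> x \<and> \<phi> x \<le> 1"
    and supp: "\<And>x. K \<le> x \<Longrightarrow> \<phi> x = 0" and L: "0 < L"
    and pq: "0 < p" "p < 1" "0 < q" "q < 1"
  shows "integrable lborel (\<lambda>x. 1 - affinity p q (\<phi> (\<bar>v - x\<bar> / L)))"
    and "(LINT x|lborel. 1 - affinity p q (\<phi> (\<bar>v - x\<bar> / L))) = L * I_phi \<phi> p q"
proof -
  define g where "g x = 1 - affinity p q (\<phi> \<bar>x\<bar>)" for x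
  have g01: "0 \<le> g x" "g x \<le> 1" for x
    using affinity_ge[OF pq, of "\<phi> \<bar>x\<bar>"] affinity_le_1[OF pq, of "\<phi> \<bar>x\<bar>"] \<phi>01 by (auto simp: g_def)
  have gs: "g x = 0" if "K \<le> \<bar>x\<bar>" for x using supp[OF that] by (simp add: g_def affinity_0)
  have [measurable]: "g \<in> borel_measurable borel" unfolding g_def using \<phi> by measurable
  have gi: "integrable lborel g"
  proof (rule Bochner_Integration.integrable_bound)
    show "integrable lborel (indicator {-\<bar>K\<bar>..\<bar>K\<bar>} :: real \<Rightarrow> real)" by (intro integrable_real_indicator) auto
    show "AE x in lborel. norm (g x) \<le> norm (indicator {-\<bar>K\<bar>..\<bar>K\<bar>} x :: real)"
    proof (intro AE_I2)
      fix x show "norm (g x) \<le> norm (indicator {-\<bar>K\<bar>..\<bar>K\<bar>} x :: real)"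
        using g01[of x] gs[of x] by (cases "x \<in> {-\<bar>K\<bar>..\<bar>K\<bar>}") (auto simp: indicator_def)
    qed
  qed simp
  have eq: "(\<lambda>x. 1 - affinity p q (\<phi> (\<bar>v - x\<bar> / L))) = (\<lambda>x. g (- v / L + (1 / L) * x))"
  proof
    fix x
    have "- v / L + (1 / L) * x = (x - v) / L" using L by (simp add: field_simps)
    then have "\<bar>v - x\<bar> / L = \<bar>- v / L + (1 / L) * x\<bar>" using L by (simp add: abs_minus_commute)
    then show "1 - affinity p q (\<phi> (\<bar>v - x\<bar> / L)) = g (- v / L + (1 / L) * x)" by (simp add: g_def)
  qed
  show "integrable lborel (\<lambda>x. 1 - affinity p q (\<phi> (\<bar>v - x\<bar> / L)))"
    unfolding eq using L by (intro lborel_integrable_real_affine gi) auto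
  have "(LINT x|lborel. g x) = \<bar>1 / L\<bar> * (LINT x|lborel. g (- v / L + (1 / L) * x))"
    using lborel_integral_real_affine[of "1 / L" g "- v / L"] L by simp
  then have "(LINT x|lborel. g (- v / L + (1 / L) * x)) = L * (LINT x|lborel. g x)"
    using L by simp
  also have "(LINT x|lborel. g x) = 2 * (LINT x:{0..}|lborel. g x)"
  proof -
    have "integrable lborel (\<lambda>x. indicator {0..} x *\<^sub>R g x)"
      using gi by (intro integrable_mult_indicator) auto
    moreover have "g (- x) = g x" for x by (simp add: g_def)
    ultimately have "has_bochner_integral lborel g (2 *\<^sub>R (LINT x|lborel. indicator {0..} x *\<^sub>R g x))"
      by (intro has_bochner_integral_even_function has_bochner_integral_integrable)
    then show ?thesis by (simp add: has_bochner_integral_integral_eq set_lebesgue_integral_def)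
  qed
  also have "(LINT x:{0..}|lborel. g x) = (LINT x:{0..}|lborel. 1 - sqrt (p * q) * \<phi> x - sqrt ((1 - p * \<phi> x) * (1 - q * \<phi> x)))"
    by (intro set_lebesgue_integral_cong) (auto simp: g_def affinity_def)
  finally show "(LINT x|lborel. 1 - affinity p q (\<phi> (\<bar>v - x\<bar> / L))) = L * I_phi \<phi> p q"
    unfolding eq I_phi_def .
qed

text \<open>The cost \<open>cosh (t * K) - 1\<close> of a tilt is quadratic in \<open>t\<close>, its gain is
linear.\<close>

lemma exists_small_tilt:
  fixes K a e :: real
  assumes "0 < e"
  shows "\<exists>t>0. a * (cosh (t * K) - 1) \<le> t * e"
proof -
  have "((\<lambda>t. a * (cosh (t * K) - 1) / t) \<longlongrightarrow> 0) (at_right 0)"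
    unfolding cosh_field_def by real_asymp
  then have "\<forall>\<^sub>F t in at_right 0. a * (cosh (t * K) - 1) / t < e"
    using assms by (rule order_tendstoD)
  moreover have "\<forall>\<^sub>F t in at_right 0. (0::real) < t" by (simp add: eventually_at_right_less)
  ultimately have "\<forall>\<^sub>F t in at_right 0. 0 < t \<and> a * (cosh (t * K) - 1) \<le> t * e"
    by eventually_elim (auto simp: field_simps)
  then show ?thesis
    by (metis (mono_tags, lifting) eventually_happens' trivial_limit_at_right_real)
qed

text \<open>The expected number of failures diverges: there are about \<open>n / (2 * \<kappa> * ln n)\<close>
blocks, each failing with probability of order \<open>n powr (g - 1)\<close>.\<close>

lemma block_count_times_flip_tendsto:
  fixes \<kappa> g s c :: real
  assumes "0 < \<kappa>" "0 < g" "0 < s" "0 < c"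
  shows "filterlim (\<lambda>n. (real n / (2 * \<kappa> * ln (real n) + 1) - 1) *
     (real n powr (g - 1) / 2 * (1 - 2 * real n powr (- s)) * c)) at_top sequentially"
  using assms by real_asymp

lemma GKBM_poisson_nodes: "GKBM M n lam \<phi> p q V \<sigma> A \<Longrightarrow> 0 < lam \<Longrightarrow> poisson_nodes M n lam V"
  by (simp add: poisson_nodes_def poisson_nodes_axioms_def GKBM_def GKBM_axioms_def)

definition block :: "real \<Rightarrow> real \<Rightarrow> nat \<Rightarrow> real set" where
  "block a w i = {a + real i * w <.. a + real i * w + w}"

definition block_centre :: "nat \<Rightarrow> real \<Rightarrow> real \<Rightarrow> nat \<Rightarrow> real set" where
  "block_centre n w r i = {- real n / 2 + real i * w + r <.. - real n / 2 + real i * w + r + 1}"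

lemma block_in_circle:
  assumes "0 \<le> w" "- real n / 2 \<le> a" "a + real (Suc i) * w \<le> real n / 2"
  shows "block a w i \<in> sets (circle n)"
proof -
  have *: "0 \<le> real i * w" "a + real i * w + w \<le> real n / 2" using assms by (auto simp: algebra_simps)
  have "block a w i \<subseteq> {- real n / 2 <.. real n / 2}"
  proof
    fix x assume "x \<in> block a w i"
    then have "a + real i * w < x" "x \<le> a + real i * w + w" by (auto simp: block_def)
    then show "x \<in> {- real n / 2 <.. real n / 2}"
      unfolding greaterThanAtMost_iff using * assms(2) by linarith
  qed
  then show ?thesis by (simp add: block_def sets_circle_iff)
qed

lemma disjoint_blocks:
  assumes "0 \<le> w"
  shows "disjoint_family (block a w)"
proof -
  have *: "block a w i \<inter> block a w j = {}" if "i < j" for i j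
  proof -
    have "real (Suc i) * w \<le> real j * w" using that assms by (intro mult_right_mono) auto
    then show ?thesis by (auto simp: block_def algebra_simps)
  qed
  show ?thesis
    unfolding disjoint_family_on_def using * by (metis Int_commute linorder_neqE_nat)
qed

lemma circle_dist_commute: "circle_dist n u v = circle_dist n v u"
  by (simp add: circle_dist_def abs_minus_commute)

text \<open>The block extends by \<open>r\<close> to both sides of its centre and does not wrap around, so both
arcs from the centre to a point outside the block have length at least \<open>r\<close>.\<close>

lemma circle_dist_outside_block:
  assumes i: "real (Suc i) * (2 * r + 1) \<le> real n" and r: "0 \<le> r"
    and v: "v \<in> block_centre n (2 * r + 1) r i"
    and u: "u \<in> {- real n / 2 <.. real n / 2} - block (- real n / 2) (2 * r + 1) i"
  shows "r \<le> circle_dist n v u"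
proof -
  define a where "a = - real n / 2 + real i * (2 * r + 1)"
  have a: "- real n / 2 \<le> a" "a + (2 * r + 1) \<le> real n / 2"
    using i r by (auto simp: a_def algebra_simps)
  have "a + r < v" "v \<le> a + r + 1" using v by (auto simp: block_centre_def a_def)
  moreover have "u \<le> a \<or> a + (2 * r + 1) < u" "- real n / 2 < u" "u \<le> real n / 2"
    using u by (auto simp: block_def a_def)
  ultimately show ?thesis
    using a r unfolding circle_dist_def by (auto simp: min_def abs_if split: if_splits)
qed

lemma circle_dist_in_block:
  assumes "v \<in> block a w i" "u \<in> block a w i" "w \<le> real n / 2"
  shows "circle_dist n v u = \<bar>v - u\<bar>"
  using assms unfolding circle_dist_def block_def by (auto simp: min_def abs_if)

lemma measure_block_minus_centre:
  assumes "0 \<le> r"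
  shows "measure lborel (block (- real n / 2) (2 * r + 1) i - block_centre n (2 * r + 1) r i) = 2 * r"
proof -
  have "measure lborel (block (- real n / 2) (2 * r + 1) i - block_centre n (2 * r + 1) r i) =
      measure lborel (block (- real n / 2) (2 * r + 1) i) - measure lborel (block_centre n (2 * r + 1) r i)"
    using assms by (intro measure_Diff) (auto simp: block_def block_centre_def)
  then show ?thesis using assms by (simp add: block_def block_centre_def)
qed

text \<open>The lone-node argument at fixed \<open>n\<close>, with \<open>m\<close> disjoint blocks. The centre
of each block has length 1, so the probability of exactly one node in it is \<open>lam * exp (-
lam)\<close>, which does not decay with \<open>n\<close>.\<close>

lemma recovery_prob_exponential_bound:
  fixes \<phi> :: "real \<Rightarrow> real"
  assumes G: "GKBM M n lam \<phi> p q V \<sigma> A" and est: "estimator n est"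
    and lam: "0 < lam" and pq: "0 < p" "p < 1" "0 < q" "q < 1"
    and \<phi>: "\<phi> \<in> borel_measurable borel" and \<phi>01: "\<And>x. 0 \<le> \<phi> x \<and> \<phi> x \<le> 1"
    and supp: "\<And>x. \<kappa> \<le> x \<Longrightarrow> \<phi> x = 0" and \<kappa>: "0 < \<kappa>"
    and n: "2 \<le> n" "2 * (\<kappa> * ln (real n)) + 1 \<le> real n / 2"
    and t: "0 \<le> t" and \<delta>: "0 \<le> \<delta>"
    and m: "real m * (2 * (\<kappa> * ln (real n)) + 1) \<le> real n"
    and b: "b = exp (- (\<delta> * ln (real n))) / 2 * exp (- (lam * (ln (real n) * I_phi \<phi> p q))) *
      (1 - 2 * exp (- (2 * t * (\<delta> * ln (real n)))) *
         exp (lam * ((cosh (t * llr_max p q) - 1) * (2 * (\<kappa> * ln (real n))))))"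
  shows "recovery_prob M n V \<sigma> A est
    \<le> 2 * exp (- (real m * (b * (lam * exp (- lam)))))"
proof -
  interpret P: poisson_nodes M n lam V by (rule GKBM_poisson_nodes[OF G lam])
  define L where "L = ln (real n)"
  define r where "r = \<kappa> * L"
  define w where "w = 2 * r + 1"
  define k where "k u v = \<phi> (circle_dist n u v / L)" for u v
  define J where "J = block_centre n w r"
  define B where "B = block (- real n / 2) w"
  have L: "0 < L" using n by (simp add: L_def)
  have r: "0 < r" using L \<kappa> by (simp add: r_def)
  have iw: "real (Suc i) * w \<le> real n" if "i < m" for i
  proof -
    have "real (Suc i) * w \<le> real m * w" using that r by (intro mult_right_mono) (auto simp: w_def)
    also have "\<dots> \<le> real n" using m by (simp add: w_def r_def L_def)
    finally show ?thesis .
  qed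
  have B: "B i \<in> sets (circle n)" if "i < m" for i
    unfolding B_def using iw[OF that] r by (intro block_in_circle) (auto simp: w_def)
  have JB: "J i \<subseteq> B i" for i using r by (auto simp: J_def B_def block_def block_centre_def w_def)
  have J: "J i \<in> sets (circle n)" if "i < m" for i
    using B[OF that] JB[of i] by (auto simp: sets_circle_iff J_def block_centre_def)
  have disj: "disjoint_family_on B {..<m}"
    using disjoint_blocks[of w "- real n / 2"] r by (auto simp: B_def w_def disjoint_family_on_def)
  have k01: "0 \<le> k u v \<and> k u v \<le> 1" for u v using \<phi>01 by (simp add: k_def)
  have ksym: "k u v = k v u" for u v by (simp add: k_def circle_dist_commute)
  have km: "(\<lambda>(v, u). k v u) \<in> borel_measurable (borel \<Otimes>\<^sub>M borel)"
  proof -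
    have "(\<lambda>z. circle_dist n (fst z) (snd z) / L) \<in> borel_measurable (borel \<Otimes>\<^sub>M borel)"
      unfolding circle_dist_def by measurable
    from measurable_compose[OF this \<phi>] show ?thesis by (simp add: k_def case_prod_unfold)
  qed
  have far: "k v u = 0" if "i < m" "v \<in> J i" "u \<in> {- real n / 2 <.. real n / 2} - B i" for i u v
  proof -
    have "r \<le> circle_dist n v u"
      using that iw[OF that(1)] r by (intro circle_dist_outside_block[of i]) (auto simp: w_def J_def B_def)
    then show ?thesis using L by (auto simp: k_def r_def field_simps intro!: supp)
  qed
  have S: "(LINT x|lborel. indicator (B i - J i) x * (1 - affinity p q (k v x))) \<le> L * I_phi \<phi> p q"
    if i: "i < m" and v: "v \<in> J i" for i v
  proof -
    have "(LINT x|lborel. indicator (B i - J i) x * (1 - affinity p q (k v x)))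
        \<le> (LINT x|lborel. 1 - affinity p q (\<phi> (\<bar>v - x\<bar> / L)))"
    proof (rule integral_mono'[OF integral_affinity_scaled(1)[OF \<phi> \<phi>01 supp L pq]])
      fix x
      show nn: "0 \<le> 1 - affinity p q (\<phi> (\<bar>v - x\<bar> / L))"
        using affinity_le_1[OF pq] \<phi>01 by simp
      have "circle_dist n v x = \<bar>v - x\<bar>" if "x \<in> B i"
        using that v JB[of i] n unfolding B_def
        by (intro circle_dist_in_block[where w = w and i = i]) (auto simp: w_def r_def L_def B_def)
      then show "indicator (B i - J i) x * (1 - affinity p q (k v x)) \<le> 1 - affinity p q (\<phi> (\<bar>v - x\<bar> / L))"
        using nn by (auto simp: indicator_def k_def)
    qed
    also have "\<dots> = L * I_phi \<phi> p q" by (rule integral_affinity_scaled(2)[OF \<phi> \<phi>01 supp L pq])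
    finally show ?thesis .
  qed
  have mJ: "measure lborel (J i) = 1" for i by (simp add: J_def block_centre_def)
  have mR: "measure lborel (B i - J i) = 2 * r" for i
    using measure_block_minus_centre[of r n i] r by (simp add: B_def J_def w_def)
  have E: "b * (lam * exp (- lam)) \<le> P.expectation (\<lambda>\<omega>. lone_bound p q t (\<delta> * L) k (J i) (V \<omega> \<inter> B i))"
    if "i < m" for i
    using P.expectation_lone_bound_ge[OF pq km k01 J[OF that] B[OF that] JB[of i] _ S[OF that] refl,
        of "\<delta> * L" t] \<delta> L
    unfolding mJ mR b by (simp add: r_def L_def)
  note bl = P.expectation_blocks_le[OF pq km k01 J B disj _ E]
  let ?U = "\<lambda>\<omega>. 2 * (\<Prod>i<m. 1 - lone_bound p q t (\<delta> * L) k (J i) (V \<omega> \<inter> B i))"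
  have "recovery_prob M n V \<sigma> A est
      \<le> P.expectation ?U"
  proof (rule recovery_prob_le_expectation[OF G est])
    show "integrable M ?U" using bl(2) \<delta> L by auto
    fix \<omega> T assume "\<omega> \<in> space M"
    then have "finite (V \<omega>)" "V \<omega> \<subseteq> {- real n / 2 <.. real n / 2}" using P.V_space by auto
    then show "P_pmf (label_edge_pmf p q (\<lambda>u v. \<phi> (circle_dist n u v / ln (real n))) (V \<omega>))
        {(s, f). s = T f \<or> s = - T f} \<le> ?U \<omega>"
      using far unfolding L_def[symmetric] k_def[symmetric]
      by (intro isolated_blocks_bound pq k01 ksym JB disj t) auto
  qed (use n in auto)
  also have "\<dots> \<le> 2 * exp (- (real m * (b * (lam * exp (- lam)))))"
    using bl(1) \<delta> L by auto
  finally show ?thesis .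
qed

text \<open>The slack \<open>1 - lam * I_phi \<phi> p q\<close> is shared equally between the loss
\<open>\<delta>\<close> in the Bayes error and the growth of the expected number of failures.\<close>

lemma recovery_prob_tendsto_0:
  fixes \<phi> :: "real \<Rightarrow> real" and M :: "nat \<Rightarrow> 'w measure"
  assumes G: "\<And>n. 2 \<le> n \<Longrightarrow> GKBM (M n) n lam \<phi> p q (V n) (\<sigma> n) (A n)"
    and est: "\<And>n. 2 \<le> n \<Longrightarrow> estimator n (est n)"
    and lam: "0 < lam" and pq: "0 < p" "p < 1" "0 < q" "q < 1"
    and \<phi>: "\<phi> \<in> borel_measurable borel" and \<phi>01: "\<And>x. 0 \<le> \<phi> x \<and> \<phi> x \<le> 1"
    and supp: "\<And>x. \<kappa> \<le> x \<Longrightarrow> \<phi> x = 0" and \<kappa>: "0 < \<kappa>"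
    and I: "lam * I_phi \<phi> p q < 1"
  shows "(\<lambda>n. recovery_prob (M n) n (V n) (\<sigma> n) (A n) (est n)) \<longlonglongrightarrow> 0"
proof -
  define g where "g = (1 - lam * I_phi \<phi> p q) / 2"
  have g: "0 < g" using I by (simp add: g_def)
  obtain t where t: "0 < t" "(2 * \<kappa> * lam) * (cosh (t * llr_max p q) - 1) \<le> t * g"
    using exists_small_tilt[OF g, of "2 * \<kappa> * lam" "llr_max p q"] by blast
  define w where "w n = 2 * \<kappa> * ln (real n) + 1" for n :: nat
  define m where "m n = nat \<lfloor>real n / w n\<rfloor>" for n
  define b where "b n = exp (- (g * ln (real n))) / 2 * exp (- (lam * (ln (real n) * I_phi \<phi> p q))) *
      (1 - 2 * exp (- (2 * t * (g * ln (real n)))) *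
         exp (lam * ((cosh (t * llr_max p q) - 1) * (2 * (\<kappa> * ln (real n))))))" for n :: nat
  define \<beta> where "\<beta> n = real n powr (g - 1) / 2 * (1 - 2 * real n powr (- (t * g)))" for n :: nat
  define c where "c = lam * exp (- lam)"
  have c: "0 < c" using lam by (simp add: c_def)
  have b\<beta>: "\<beta> n \<le> b n" if n: "2 \<le> n" for n
  proof -
    have L: "0 < ln (real n)" using n by simp
    have 1: "exp (- (g * ln (real n))) / 2 * exp (- (lam * (ln (real n) * I_phi \<phi> p q))) = real n powr (g - 1) / 2"
      using n unfolding powr_def by (simp flip: exp_add) (simp add: g_def field_simps)
    have "lam * ((cosh (t * llr_max p q) - 1) * (2 * (\<kappa> * ln (real n)))) \<le> t * g * ln (real n)"
      using mult_right_mono[OF t(2), of "ln (real n)"] L by (simp add: mult_ac)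
    then have "exp (- (2 * t * (g * ln (real n)))) * exp (lam * ((cosh (t * llr_max p q) - 1) * (2 * (\<kappa> * ln (real n)))))
        \<le> exp (- (2 * t * (g * ln (real n)))) * exp (t * g * ln (real n))"
      by (intro mult_left_mono) auto
    also have "\<dots> = real n powr (- (t * g))"
      using n unfolding powr_def by (simp flip: exp_add add: algebra_simps)
    finally have "1 - 2 * real n powr (- (t * g)) \<le> 1 - 2 * exp (- (2 * t * (g * ln (real n)))) *
         exp (lam * ((cosh (t * llr_max p q) - 1) * (2 * (\<kappa> * ln (real n)))))" by simp
    then show ?thesis unfolding b_def \<beta>_def 1 by (intro mult_left_mono) auto
  qed
  \<comment> \<open>The subtracted 1 accounts for rounding down the number of blocks.\<close>
  have lim: "filterlim (\<lambda>n. (real n / w n - 1) * (\<beta> n * c)) at_top sequentially"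
    using block_count_times_flip_tendsto[OF \<kappa> g mult_pos_pos[OF t(1) g] c]
    unfolding w_def \<beta>_def by (simp add: mult.assoc)
  have ev: "\<forall>\<^sub>F n in sequentially. recovery_prob (M n) n (V n) (\<sigma> n) (A n) (est n)
      \<le> 2 * exp (- ((real n / w n - 1) * (\<beta> n * c)))"
  proof -
    have "\<forall>\<^sub>F n in sequentially. w n \<le> real n / 2" unfolding w_def by real_asymp
    moreover have "\<forall>\<^sub>F n in sequentially. 0 < 1 - 2 * real n powr (- (t * g))"
      using mult_pos_pos[OF t(1) g] by real_asymp
    ultimately show ?thesis using eventually_ge_at_top[of 2]
    proof eventually_elim
      case (elim n)
      have w0: "0 < w n" using elim \<kappa> by (simp add: w_def add_nonneg_pos)
      have m1: "real (m n) * w n \<le> real n"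
      proof -
        have "real (m n) \<le> real n / w n" using w0 unfolding m_def by (simp add: of_nat_nat)
        then show ?thesis using w0 by (simp add: field_simps)
      qed
      have m2: "real n / w n - 1 \<le> real (m n)" unfolding m_def by linarith
      have \<beta>0: "0 \<le> \<beta> n" using elim by (simp add: \<beta>_def)
      have "(real n / w n - 1) * (\<beta> n * c) \<le> real (m n) * (b n * c)"
        using m2 \<beta>0 c b\<beta>[OF elim(3)] by (intro mult_mono mult_right_mono) auto
      then have "2 * exp (- (real (m n) * (b n * c))) \<le> 2 * exp (- ((real n / w n - 1) * (\<beta> n * c)))" by simp
      moreover have "recovery_prob (M n) n (V n) (\<sigma> n) (A n) (est n)
          \<le> 2 * exp (- (real (m n) * (b n * (lam * exp (- lam)))))"
        using elim m1 g t unfolding w_def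
        by (intro recovery_prob_exponential_bound[OF G est lam pq \<phi> \<phi>01 supp \<kappa>, where t = t and \<delta> = g])
          (auto simp: b_def mult.assoc)
      ultimately show ?case unfolding c_def by linarith
    qed
  qed
  have "(\<lambda>n. 2 * exp (- ((real n / w n - 1) * (\<beta> n * c)))) \<longlonglongrightarrow> 2 * 0"
    by (intro tendsto_mult tendsto_const filterlim_compose[OF exp_at_bot]
        filterlim_compose[OF filterlim_uminus_at_bot_at_top lim])
  then show ?thesis
    using ev by (intro tendsto_sandwich[OF _ ev tendsto_const]) auto
qed

section \<open>Two empty arcs\<close>

text \<open>The sets are empty independently, with probability \<open>exp (- lam * l)\<close> each.\<close>

lemma (in poisson_nodes) prob_all_occupied_le:
  assumes X: "\<And>i. i < m \<Longrightarrow> X i \<in> sets (circle n)" and disj: "disjoint_family_on X {..<m}"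
    and l: "\<And>i. i < m \<Longrightarrow> measure lborel (X i) = l"
  shows "prob {\<omega> \<in> space M. \<forall>i<m. V \<omega> \<inter> X i \<noteq> {}} \<le> exp (- (real m * exp (- (lam * l))))"
proof -
  let ?F = "\<lambda>Y :: real set. of_bool (Y \<noteq> {}) :: real"
  have F: "?F \<in> borel_measurable (node_space n)"
  proof -
    have "(\<lambda>Y. of_bool (card Y \<noteq> 0) :: real) \<in> borel_measurable (node_space n)"
      by (rule measurable_compose[OF measurable_card_node_space]) simp
    then show ?thesis
      by (rule measurable_cong[THEN iffD1, rotated]) (auto simp: node_space_def space_point_configs)
  qed
  have E: "expectation (\<lambda>\<omega>. ?F (V \<omega> \<inter> X i)) = 1 - exp (- (lam * l))" if i: "i < m" for i
  proof -
    let ?Z = "{\<omega> \<in> space M. V \<omega> \<inter> X i = {}}"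
    have "(\<lambda>\<omega>. ?F (V \<omega> \<inter> X i)) \<in> borel_measurable M"
      by (rule measurable_compose[OF V_Int_measurable[OF X[OF i]] F])
    then have "(\<lambda>\<omega>. ?F (V \<omega> \<inter> X i)) -` {0} \<inter> space M \<in> sets M" by (rule measurable_sets) simp
    moreover have "(\<lambda>\<omega>. ?F (V \<omega> \<inter> X i)) -` {0} \<inter> space M = ?Z" by auto
    ultimately have Z: "?Z \<in> sets M" by simp
    have "expectation (\<lambda>\<omega>. ?F (V \<omega> \<inter> X i)) = expectation (indicator (space M - ?Z))"
      by (rule Bochner_Integration.integral_cong[OF refl]) (simp add: indicator_def)
    also have "\<dots> = 1 - prob ?Z" using Z by (simp add: prob_compl)
    finally show ?thesis using prob_void[OF X[OF i]] l[OF i] by simp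
  qed
  have "prob {\<omega> \<in> space M. \<forall>i<m. V \<omega> \<inter> X i \<noteq> {}} = expectation (\<lambda>\<omega>. \<Prod>i<m. ?F (V \<omega> \<inter> X i))"
  proof -
    let ?A = "{\<omega> \<in> space M. \<forall>i<m. V \<omega> \<inter> X i \<noteq> {}}"
    have "(\<Prod>i<m. ?F (V \<omega> \<inter> X i)) = indicator ?A \<omega>" if w: "\<omega> \<in> space M" for \<omega>
    proof (cases "\<forall>i<m. V \<omega> \<inter> X i \<noteq> {}")
      case True
      then show ?thesis using w by simp
    next
      case False
      then obtain i where "i \<in> {..<m}" "?F (V \<omega> \<inter> X i) = 0" by auto
      then have "(\<Prod>i<m. ?F (V \<omega> \<inter> X i)) = 0" by (intro prod_zero[OF finite_lessThan]) blast
      moreover have "\<omega> \<notin> ?A" using False by blast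
      ultimately show ?thesis by simp
    qed
    then have "expectation (\<lambda>\<omega>. \<Prod>i<m. ?F (V \<omega> \<inter> X i)) = expectation (indicator ?A)"
      by (rule Bochner_Integration.integral_cong[OF refl])
    also have "\<dots> = prob (?A \<inter> space M)" by (rule Bochner_Integration.integral_indicator)
    also have "?A \<inter> space M = ?A" by blast
    finally show ?thesis by (rule sym)
  qed
  also have "\<dots> = (\<Prod>i<m. expectation (\<lambda>\<omega>. ?F (V \<omega> \<inter> X i)))"
  proof (rule expectation_prod_nodes[where F = "\<lambda>_. ?F"])
    show "X i \<in> sets (circle n)" if "i \<in> {..<m}" for i using X that by simp
  qed (use F disj in simp_all)
  also have "\<dots> \<le> (\<Prod>i<m. exp (- exp (- (lam * l))))"
  proof (intro prod_mono conjI)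
    fix i assume i: "i \<in> {..<m}"
    show "0 \<le> expectation (\<lambda>\<omega>. ?F (V \<omega> \<inter> X i))" by (intro expectation_nonneg) auto
    show "expectation (\<lambda>\<omega>. ?F (V \<omega> \<inter> X i)) \<le> exp (- exp (- (lam * l)))"
      using E[of i] i exp_ge_add_one_self[of "- exp (- (lam * l))"] by simp
  qed
  also have "\<dots> = exp (- (real m * exp (- (lam * l))))" by (simp flip: exp_of_nat_mult)
  finally show ?thesis .
qed

text \<open>A path from a node between the two gaps to a node elsewhere crosses one of them, whichever way
around the circle it takes.\<close>

lemma circle_dist_across_gaps:
  assumes a: "- real n / 2 \<le> a" "a + l \<le> - real n / 4" and b: "0 \<le> b" "b + l \<le> real n / 4" and l: "0 < l"
    and V: "V \<subseteq> {- real n / 2 <.. real n / 2}" "V \<inter> {a <.. a + l} = {}" "V \<inter> {b <.. b + l} = {}"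
    and u: "u \<in> V" "u \<in> {a <.. b}" and v: "v \<in> V" "v \<notin> {a <.. b}"
  shows "l \<le> circle_dist n u v"
proof -
  have "u \<notin> {a <.. a + l}" "v \<notin> {b <.. b + l}" using u(1) v(1) V(2,3) by blast+
  then have "a + l < u" "u \<le> b" "v \<le> a \<or> b + l < v" using u(2) v(2) by auto
  moreover have "- real n / 2 < v" "v \<le> real n / 2" using v V by auto
  ultimately have "l \<le> \<bar>u - v\<bar>" "l \<le> real n - \<bar>u - v\<bar>" using a b l by linarith+
  then show ?thesis by (simp add: circle_dist_def)
qed

text \<open>Gaps are sought in the first and third quarters of the circle. Nodes in the second and fourth
quarters ensure that both sides of the cut are nonempty.\<close>

lemma recovery_prob_gap_bound:
  fixes \<phi> :: "real \<Rightarrow> real"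
  assumes G: "GKBM M n lam \<phi> p q V \<sigma> A" and est: "estimator n est"
    and lam: "0 < lam" and pq: "0 < p" "p < 1" "0 < q" "q < 1"
    and \<phi>01: "\<And>x. 0 \<le> \<phi> x \<and> \<phi> x \<le> 1"
    and supp: "\<And>x. \<kappa> \<le> x \<Longrightarrow> \<phi> x = 0" and \<kappa>: "0 < \<kappa>"
    and n: "2 \<le> n" and m: "real m * (\<kappa> * ln (real n)) \<le> real n / 4"
  shows "recovery_prob M n V \<sigma> A est
    \<le> 1 / 2 + exp (- (real m * exp (- (lam * (\<kappa> * ln (real n)))))) + exp (- (lam * (real n / 4)))"
proof -
  interpret P: poisson_nodes M n lam V by (rule GKBM_poisson_nodes[OF G lam])
  define l where "l = \<kappa> * ln (real n)"
  have l: "0 < l" using n \<kappa> by (simp add: l_def)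
  define X where "X = block (- real n / 2) l"
  define Y where "Y = block 0 l"
  define Q2 where "Q2 = {- real n / 4 <.. 0}"
  define Q4 where "Q4 = {real n / 4 <.. real n / 2}"
  have il: "real (Suc i) * l \<le> real n / 4" if "i < m" for i
  proof -
    have "real (Suc i) * l \<le> real m * l" using that l by (intro mult_right_mono) auto
    also have "\<dots> \<le> real n / 4" using m by (simp add: l_def)
    finally show ?thesis .
  qed
  have X: "X i \<in> sets (circle n)" and Y: "Y i \<in> sets (circle n)" if "i < m" for i
    using il[OF that] l n unfolding X_def Y_def by (auto intro!: block_in_circle)
  have Q: "Q2 \<in> sets (circle n)" "Q4 \<in> sets (circle n)" by (auto simp: Q2_def Q4_def sets_circle_iff)
  have mX: "measure lborel (X i) = l" "measure lborel (Y i) = l" for i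
    using l by (auto simp: X_def Y_def block_def)
  have mQ: "measure lborel Q2 = real n / 4" "measure lborel Q4 = real n / 4"
    by (auto simp: Q2_def Q4_def)
  have disj: "disjoint_family_on X {..<m}" "disjoint_family_on Y {..<m}"
    using disjoint_blocks[of l] l unfolding X_def Y_def disjoint_family_on_def by auto
  let ?N = "\<lambda>Z. {\<omega> \<in> space M. \<forall>i<m. V \<omega> \<inter> Z i \<noteq> {}}"
  let ?O = "\<lambda>Z. {\<omega> \<in> space M. V \<omega> \<inter> Z = {}}"
  have Om: "?O Z \<in> sets M" if "Z \<in> sets (circle n)" for Z
  proof -
    have "?O Z = (\<lambda>\<omega>. card (V \<omega> \<inter> Z)) -` {0} \<inter> space M" using P.V_space by auto
    then show ?thesis using P.count_measurable[OF that] by (auto intro: measurable_sets)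
  qed
  have Nm: "?N Z \<in> sets M" if "\<And>i. i < m \<Longrightarrow> Z i \<in> sets (circle n)" for Z
  proof -
    have "?N Z = space M - (\<Union>i<m. ?O (Z i))" by auto
    then show ?thesis using Om that by auto
  qed
  note ev = Nm[OF X] Nm[OF Y] Om[OF Q(1)] Om[OF Q(2)]
  \<comment> \<open>Outside this event the nodes split into two groups without possible links between them.\<close>
  define Bad where "Bad = ?N X \<union> ?N Y \<union> ?O Q2 \<union> ?O Q4"
  have Bm: "Bad \<in> sets M" unfolding Bad_def by (intro sets.Un ev)
  have intBad: "integrable M (indicator Bad :: _ \<Rightarrow> real)"
    using Bm by (intro integrable_real_indicator) (simp_all add: P.emeasure_eq_measure)
  let ?U = "\<lambda>\<omega>. 1 / 2 + 1 / 2 * indicator Bad \<omega> :: real"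
  have "recovery_prob M n V \<sigma> A est
      \<le> P.expectation ?U"
  proof (rule recovery_prob_le_expectation[OF G est])
    show "integrable M ?U" using intBad by simp
    fix \<omega> T assume w: "\<omega> \<in> space M"
    let ?k = "\<lambda>u v. \<phi> (circle_dist n u v / ln (real n))"
    show "P_pmf (label_edge_pmf p q ?k (V \<omega>)) {(s, f). s = T f \<or> s = - T f} \<le> ?U \<omega>"
    proof (cases "\<omega> \<in> Bad")
      case True
      then have "?U \<omega> = 1" by simp
      then show ?thesis by simp
    next
      case False
      then have "\<not> (\<forall>i<m. V \<omega> \<inter> X i \<noteq> {})" "\<not> (\<forall>i<m. V \<omega> \<inter> Y i \<noteq> {})"
          "V \<omega> \<inter> Q2 \<noteq> {}" "V \<omega> \<inter> Q4 \<noteq> {}"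
        using w unfolding Bad_def by blast+
      then obtain i j x y where i: "i < m" "V \<omega> \<inter> X i = {}" and j: "j < m" "V \<omega> \<inter> Y j = {}"
        and xy: "x \<in> V \<omega>" "x \<in> Q2" "y \<in> V \<omega>" "y \<in> Q4" by blast
      have fin: "finite (V \<omega>)" "V \<omega> \<subseteq> {- real n / 2 <.. real n / 2}" using P.V_space[OF w] by auto
      define a where "a = - real n / 2 + real i * l"
      define b where "b = real j * l"
      have ab: "- real n / 2 \<le> a" "a + l \<le> - real n / 4" "0 \<le> b" "b + l \<le> real n / 4"
        using il[OF i(1)] il[OF j(1)] l by (auto simp: a_def b_def algebra_simps)
      have gaps: "V \<omega> \<inter> {a <.. a + l} = {}" "V \<omega> \<inter> {b <.. b + l} = {}"
        using i j by (auto simp: X_def Y_def block_def a_def b_def)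
      have cut: "?k u v = 0" if "u \<in> V \<omega>" "v \<in> V \<omega>" "(u \<in> {a <.. b}) \<noteq> (v \<in> {a <.. b})" for u v
      proof -
        have "l \<le> circle_dist n u v"
        proof (cases "u \<in> {a <.. b}")
          case True
          then show ?thesis using that by (intro circle_dist_across_gaps[OF ab l fin(2) gaps]) auto
        next
          case False
          then have "l \<le> circle_dist n v u" using that by (intro circle_dist_across_gaps[OF ab l fin(2) gaps]) auto
          then show ?thesis by (simp add: circle_dist_commute)
        qed
        then have "\<kappa> \<le> circle_dist n u v / ln (real n)" using n by (simp add: l_def pos_le_divide_eq)
        then show ?thesis by (rule supp)
      qed
      have "P_pmf (label_edge_pmf p q ?k (V \<omega>)) {(s, f). s = T f \<or> s = - T f} \<le> 1 / 2"
      proof (rule disconnected_bound[OF fin(1) pq _ cut])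
        show "x \<in> V \<omega> \<inter> {a <.. b}" "y \<in> V \<omega> - {a <.. b}"
          using xy ab l by (auto simp: Q2_def Q4_def)
      qed (use \<phi>01 in auto)
      then show ?thesis using False by simp
    qed
  qed (use n in auto)
  also have "\<dots> = 1 / 2 + 1 / 2 * P.prob Bad"
    using intBad Bm by (simp add: P.prob_space)
  finally have "recovery_prob M n V \<sigma> A est
      \<le> 1 / 2 + 1 / 2 * P.prob Bad" .
  moreover have "P.prob Bad \<le> P.prob (?N X) + P.prob (?N Y) + P.prob (?O Q2) + P.prob (?O Q4)"
  proof -
    have "P.prob Bad \<le> P.prob (?N X \<union> ?N Y \<union> ?O Q2) + P.prob (?O Q4)"
      unfolding Bad_def by (intro measure_Un_le sets.Un ev)
    moreover have "P.prob (?N X \<union> ?N Y \<union> ?O Q2) \<le> P.prob (?N X \<union> ?N Y) + P.prob (?O Q2)"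
      by (intro measure_Un_le sets.Un ev)
    moreover have "P.prob (?N X \<union> ?N Y) \<le> P.prob (?N X) + P.prob (?N Y)"
      by (intro measure_Un_le sets.Un ev)
    ultimately show ?thesis by linarith
  qed
  moreover have "P.prob (?N X) + P.prob (?N Y) + P.prob (?O Q2) + P.prob (?O Q4)
    \<le> exp (- (real m * exp (- (lam * l)))) + exp (- (real m * exp (- (lam * l)))) +
      exp (- (lam * (real n / 4))) + exp (- (lam * (real n / 4)))"
    using P.prob_all_occupied_le[OF X disj(1) mX(1)] P.prob_all_occupied_le[OF Y disj(2) mX(2)]
      P.prob_void[OF Q(1)] P.prob_void[OF Q(2)] unfolding mQ by (intro add_mono) auto
  ultimately show ?thesis unfolding l_def by linarith
qed

lemma recovery_prob_eventually_le:
  fixes \<phi> :: "real \<Rightarrow> real" and M :: "nat \<Rightarrow> 'w measure"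
  assumes G: "\<And>n. 2 \<le> n \<Longrightarrow> GKBM (M n) n lam \<phi> p q (V n) (\<sigma> n) (A n)"
    and est: "\<And>n. 2 \<le> n \<Longrightarrow> estimator n (est n)"
    and lam: "0 < lam" and pq: "0 < p" "p < 1" "0 < q" "q < 1"
    and \<phi>01: "\<And>x. 0 \<le> \<phi> x \<and> \<phi> x \<le> 1"
    and supp: "\<And>x. \<kappa> \<le> x \<Longrightarrow> \<phi> x = 0" and \<kappa>: "0 < \<kappa>"
    and lk: "lam * \<kappa> < 1"
  shows "\<forall>\<^sub>F n in sequentially. recovery_prob (M n) n (V n) (\<sigma> n) (A n) (est n) \<le> 3 / 4"
proof -
  define l where "l n = \<kappa> * ln (real n)" for n :: nat
  define m where "m n = nat \<lfloor>real n / (4 * l n)\<rfloor>" for n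
  define g where "g = 1 - lam * \<kappa>"
  have g: "0 < g" using lk by (simp add: g_def)
  let ?e = "\<lambda>n. exp (- ((real n / (4 * (\<kappa> * ln (real n))) - 1) * real n powr (g - 1)))"
  have "?e \<longlonglongrightarrow> 0" using \<kappa> g by real_asymp
  moreover have "(\<lambda>n. exp (- (lam * (real n / 4)))) \<longlonglongrightarrow> 0" using lam by real_asymp
  ultimately have "(\<lambda>n. 1 / 2 + ?e n + exp (- (lam * (real n / 4)))) \<longlonglongrightarrow> 1 / 2 + 0 + 0"
    by (intro tendsto_add tendsto_const)
  then have "\<forall>\<^sub>F n in sequentially. 1 / 2 + ?e n + exp (- (lam * (real n / 4))) < 3 / 4"
    by (rule order_tendstoD) simp
  then show ?thesis using eventually_ge_at_top[of 2]
  proof eventually_elim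
    case (elim n)
    have l: "0 < l n" using elim \<kappa> by (simp add: l_def)
    have "real (m n) \<le> real n / (4 * l n)" using l unfolding m_def by (simp add: of_nat_nat)
    then have m1: "real (m n) * l n \<le> real n / 4" using l by (simp add: field_simps)
    have m2: "real n / (4 * l n) - 1 \<le> real (m n)" unfolding m_def by linarith
    have p: "exp (- (lam * (\<kappa> * ln (real n)))) = real n powr (g - 1)"
      using elim by (simp add: powr_def g_def)
    have "(real n / (4 * (\<kappa> * ln (real n))) - 1) * real n powr (g - 1) \<le> real (m n) * real n powr (g - 1)"
      using m2 by (intro mult_right_mono) (auto simp: l_def)
    then have "exp (- (real (m n) * real n powr (g - 1))) \<le> ?e n" by simp
    moreover have "recovery_prob (M n) n (V n) (\<sigma> n) (A n) (est n)
      \<le> 1 / 2 + exp (- (real (m n) * exp (- (lam * (\<kappa> * ln (real n)))))) + exp (- (lam * (real n / 4)))"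
      using elim m1
      by (intro recovery_prob_gap_bound[OF G est lam pq \<phi>01 supp \<kappa>]) (auto simp: l_def)
    ultimately show ?case using elim unfolding p by linarith
  qed
qed

section \<open>No estimator recovers the communities\<close>

lemma label_adj_pmf_cong:
  assumes "\<And>u v. u \<in> V \<Longrightarrow> v \<in> V \<Longrightarrow> \<phi> (circle_dist n u v / ln (real n)) = \<phi>' (circle_dist n u v / ln (real n))"
  shows "label_adj_pmf n \<phi> p q V = label_adj_pmf n \<phi>' p q V"
proof -
  have "Pi_pmf {(u, v). u \<in> V \<and> v \<in> V \<and> u < v} False (\<lambda>(u, v). bernoulli_pmf (link_prob n \<phi> p q s u v)) =
      Pi_pmf {(u, v). u \<in> V \<and> v \<in> V \<and> u < v} False (\<lambda>(u, v). bernoulli_pmf (link_prob n \<phi>' p q s u v))" for s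
    using assms by (intro Pi_pmf_cong) (auto simp: link_prob_def)
  then show ?thesis by (simp add: label_adj_pmf_def adj_pmf_def)
qed

text \<open>The model evaluates \<open>\<phi>\<close> only at nonnegative arguments, so \<open>\<phi>\<close>
may be replaced by a Borel function on the whole real line.\<close>

lemma GKBM_extend_kernel:
  assumes G: "GKBM M n lam \<phi> p q V \<sigma> A" and n: "2 \<le> n"
  shows "GKBM M n lam (\<lambda>x. \<phi> (max 0 x)) p q V \<sigma> A"
proof -
  interpret GKBM M n lam \<phi> p q V \<sigma> A by (rule G)
  have eq: "label_adj_pmf n \<phi> p q (V \<omega>) = label_adj_pmf n (\<lambda>x. \<phi> (max 0 x)) p q (V \<omega>)" if "\<omega> \<in> space M" for \<omega>
  proof (rule label_adj_pmf_cong)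
    have "V \<omega> \<in> space (node_space n)"
      using nodes that by (auto simp: poisson_process_def dest: measurable_space)
    then have sub: "V \<omega> \<subseteq> {- real n / 2 <.. real n / 2}"
      by (auto simp: node_space_def space_point_configs space_circle)
    fix u v assume "u \<in> V \<omega>" "v \<in> V \<omega>"
    then have "- real n / 2 < u" "u \<le> real n / 2" "- real n / 2 < v" "v \<le> real n / 2" using sub by auto
    then have "0 \<le> real n - \<bar>u - v\<bar>" by linarith
    then have "0 \<le> circle_dist n u v / ln (real n)" using n by (simp add: circle_dist_def)
    then show "\<phi> (circle_dist n u v / ln (real n)) = \<phi> (max 0 (circle_dist n u v / ln (real n)))" by simp
  qed
  show ?thesis
  proof (unfold_locales)
    fix S assume S: "S \<in> sets (node_space n \<Otimes>\<^sub>M label_space n \<Otimes>\<^sub>M adj_space n)"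
    show "prob {\<omega> \<in> space M. (V \<omega>, \<sigma> \<omega>, A \<omega>) \<in> S} =
      (\<integral>\<omega>. P_pmf (label_adj_pmf n (\<lambda>x. \<phi> (max 0 x)) p q (V \<omega>)) {(s, a). (V \<omega>, s, a) \<in> S} \<partial>M)"
      unfolding conditional_law[OF S] by (intro Bochner_Integration.integral_cong refl) (simp add: eq)
  qed (rule nodes labels_measurable adj_measurable)+
qed

theorem theorem4p1:
  fixes lam p q :: real and \<phi> :: "real \<Rightarrow> real"
    and M :: "nat \<Rightarrow> 'w measure"
    and V :: "nat \<Rightarrow> 'w \<Rightarrow> real set"
    and \<sigma> :: "nat \<Rightarrow> 'w \<Rightarrow> real \<Rightarrow> int"
    and A :: "nat \<Rightarrow> 'w \<Rightarrow> real \<Rightarrow> real \<Rightarrow> nat"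
    and est :: "nat \<Rightarrow> (real \<Rightarrow> real \<Rightarrow> nat) \<times> real set \<Rightarrow> real \<Rightarrow> int"
  assumes "0 < lam" and "0 < p" and "p < 1" and "0 < q" and "q < 1"
    and "\<phi> \<in> borel_measurable (restrict_space borel {0..})"
    and "\<And>x. 0 \<le> x \<Longrightarrow> 0 \<le> \<phi> x \<and> \<phi> x \<le> 1"
    and "bounded {x. 0 \<le> x \<and> \<phi> x \<noteq> 0}"
    and "lam * phi_range \<phi> < 1 \<or> lam * I_phi \<phi> p q < 1"
    and "\<And>n. 2 \<le> n \<Longrightarrow> GKBM (M n) n lam \<phi> p q (V n) (\<sigma> n) (A n)"
    and "\<And>n. 2 \<le> n \<Longrightarrow> estimator n (est n)"
  shows "\<not> (\<lambda>n. measure (M n)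
              {\<omega> \<in> space (M n). real (Ham (V n \<omega>) (est n (A n \<omega>, V n \<omega>)) (\<sigma> n \<omega>)) / real n = 0})
           \<longlonglongrightarrow> 1"
proof
  note lam = assms(1) and pq = assms(2-5) and G = assms(10) and est = assms(11)
  let ?P = "\<lambda>n. measure (M n)
      {\<omega> \<in> space (M n). real (Ham (V n \<omega>) (est n (A n \<omega>, V n \<omega>)) (\<sigma> n \<omega>)) / real n = 0}"
  assume lim: "?P \<longlonglongrightarrow> 1"
  define \<psi> where "\<psi> x = \<phi> (max 0 x)" for x
  have G': "GKBM (M n) n lam \<psi> p q (V n) (\<sigma> n) (A n)" if "2 \<le> n" for n
    using GKBM_extend_kernel[OF G[OF that] that] by (simp add: \<psi>_def[abs_def])
  have \<psi>m: "\<psi> \<in> borel_measurable borel"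
    unfolding \<psi>_def by (rule measurable_compose[OF _ assms(6)]) (auto intro!: measurable_restrict_space2)
  have \<psi>01: "0 \<le> \<psi> x \<and> \<psi> x \<le> 1" for x using assms(7)[of "max 0 x"] by (simp add: \<psi>_def)
  have I: "I_phi \<psi> p q = I_phi \<phi> p q"
    unfolding I_phi_def by (intro arg_cong[of _ _ "\<lambda>x. 2 * x"] set_lebesgue_integral_cong) (auto simp: \<psi>_def)
  have bdd: "bdd_above (insert 0 {x. 0 \<le> x \<and> \<phi> x \<noteq> 0})"
    using assms(8) by (simp add: bounded_imp_bdd_above)
  have r0: "0 \<le> phi_range \<phi>" unfolding phi_range_def by (rule cSup_upper[OF _ bdd]) simp
  have supp: "\<psi> x = 0" if "phi_range \<phi> < x" for x
  proof (rule ccontr)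
    assume "\<psi> x \<noteq> 0"
    then have "x \<in> insert 0 {x. 0 \<le> x \<and> \<phi> x \<noteq> 0}" using that r0 by (simp add: \<psi>_def)
    then have "x \<le> phi_range \<phi>" unfolding phi_range_def by (rule cSup_upper[OF _ bdd])
    then show False using that by simp
  qed
  from assms(9) have ev: "\<forall>\<^sub>F n in sequentially. ?P n \<le> 3 / 4"
  proof
    assume 1: "lam * phi_range \<phi> < 1"
    \<comment> \<open>Any value strictly between \<open>phi_range \<phi>\<close> and \<open>1 / lam\<close> serves.\<close>
    define \<kappa> where "\<kappa> = (phi_range \<phi> + 1 / lam) / 2"
    have "phi_range \<phi> < 1 / lam" using 1 lam by (simp add: field_simps)
    then have \<kappa>: "phi_range \<phi> < \<kappa>" "\<kappa> < 1 / lam" by (simp_all add: \<kappa>_def)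
    then have "lam * \<kappa> < 1" using lam by (simp add: field_simps)
    then show ?thesis
      using \<kappa> r0 supp by (intro recovery_prob_eventually_le[OF G' est lam pq \<psi>01, where \<kappa> = \<kappa>]) auto
  next
    assume 2: "lam * I_phi \<phi> p q < 1"
    have "?P \<longlonglongrightarrow> 0"
      using 2 r0 supp unfolding I[symmetric]
      by (intro recovery_prob_tendsto_0[OF G' est lam pq \<psi>m \<psi>01, where \<kappa> = "phi_range \<phi> + 1"]) auto
    then have "\<forall>\<^sub>F n in sequentially. ?P n < 3 / 4" by (rule order_tendstoD) simp
    then show ?thesis by (rule eventually_mono) simp
  qed
  have "1 \<le> (3 / 4 :: real)"
    using tendsto_upperbound[OF lim ev] by simp
  then show False by simp
qed

end
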